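(* Let $N\in\mathbb{N}$, $N\ge2$, $T>0$, $\mu,\nu\ge0$, and let $(v,b,p)$ be a weak solution of the system $(MHD)_{\mu,\nu}$ on $\mathbb{R}^N\times(0,T)$ (in the sense defined in the context). Suppose that either $p\in L^1_+(0,T;L^1(\mathbb{R}^N))$, or $p\in L^1(0,T;\mathcal{H}^q(\mathbb{R}^N))$ for some $q\in(0,1]$. Then: If $N\ge3$, then $v(x,t)=b(x,t)=0$ for almost every $(x,t)\in\mathbb{R}^N\times(0,T)$. If $N=2$, then $v(x,t)=0$ for almost every $(x,t)\in\mathbb{R}^2\times(0,T)$, $$\int_{\mathbb{R}^2}(b^1(x,t))^2\,dx=\int_{\mathbb{R}^2}(b^2(x,t))^2\,dx\qquad\text{for almost every }t\in(0,T),$$ and $b$ is a weak solution of the heat equation $\partial_t b=\mu\Delta b$ on $\mathbb{R}^2\times(0,T)$.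
   Context: The magnetohydrodynamic system $(MHD)_{\mu,\nu}$ on $\mathbb{R}^N$ is $$\partial_t v+(v\cdot\nabla)v=(b\cdot\nabla)b-\nabla\big(p+\tfrac12|b|^2\big)+\nu\Delta v,\qquad \partial_t b+(v\cdot\nabla)b=(b\cdot\nabla)v+\mu\Delta b,\qquad \operatorname{div}v=\operatorname{div}b=0,$$ with velocity $v=(v^1,\dots,v^N)$, magnetic field $b=(b^1,\dots,b^N)$ and scalar pressure $p$. Notation. For $a,c\in\mathbb{R}^N$, $a\otimes c$ is the $N\times N$ matrix with entries $(a\otimes c)_{ij}=a_ic_j$; for $N\times N$ matrices, $A:B=\sum_{i,j=1}^N A_{ij}B_{ij}$; $(\nabla\phi)_{ij}=\partial_i\phi_j$. $L^2_\sigma(\mathbb{R}^N)=\{v\in[L^2(\mathbb{R}^N)]^N:\operatorname{div}v=0\}$, with the divergence taken in the sense of distributions. $\mathcal{S}$ is the Schwartz class on $\mathbb{R}^N$, $\mathcal{S}'$ its dual, and $\langle\cdot,\cdot\rangle$ the dual pairing between them (so $\langle f,\psi\rangle=\int f\psi\,dx$ if $f\in L^1(\mathbb{R}^N)$). $C^1_0(0,T)$, $C_0^2(\mathbb{R}^N)$ and $C_0^\infty(\mathbb{R}^N)$ denote $C^1$, $C^2$, $C^\infty$ functions with compact support in the indicated open set. Hardy space. Fix $\varphi\in\mathcal{S}$ with $\int_{\mathbb{R}^N}\varphi\,dx\ne0$ and set $\varphi_t(x)=t^{-N}\varphi(t^{-1}x)$ for $t>0$. For $0<q\le1$, $$\mathcal{H}^q(\mathbb{R}^N)=\Big\{f\in\mathcal{S}'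 : \mathcal{M}_\varphi f(x):=\sup_{t>0}|f*\varphi_t(x)|\in L^q(\mathbb{R}^N)\Big\},\qquad \|f\|_{\mathcal{H}^q}=\|\mathcal{M}_\varphi f\|_{L^q};$$ the space does not depend on the choice of $\varphi$. The condition $p\in L^1(0,T;\mathcal{H}^q(\mathbb{R}^N))$ includes $\int_0^T\|p(t)\|_{\mathcal{H}^q}\,dt<\infty$. Function class. $$L^1_{+}(0,T;L^1(\mathbb{R}^N))=\Big\{f\in L^1(0,T;L^1(\mathbb{R}^N)):\int_{\mathbb{R}^N}f(x,t)\,dx\ge0\text{ for a.e. }t\in(0,T)\Big\}.$$ Weak solution of $(MHD)_{\mu,\nu}$. A triple $(v,b,p)\in[L^1(0,T;L^2_\sigma(\mathbb{R}^N))]^2\times L^1(0,T;\mathcal{S}'(\mathbb{R}^N))$ is a weak solution of $(MHD)_{\mu,\nu}$ on $\mathbb{R}^N\times(0,T)$ if, for all $\xi\in C^1_0(0,T)$ and all $\phi\in[C_0^\infty(\mathbb{R}^N)]^N$, $$-\int_0^T\!\!\int_{\mathbb{R}^N}v\cdot\phi\,\xi'\,dx\,dt-\int_0^T\!\!\int_{\mathbb{R}^N}v\otimes v:\nabla\phi\,\xi\,dx\,dt=-\int_0^T\!\!\int_{\mathbb{R}^N}b\otimes b:\nabla\phi\,\xi\,dx\,dt+\int_0^T\langle p(t),\operatorname{div}\phi\rangle\,\xi(t)\,dt$$ $$+\frac12\int_0^T\!\!\int_{\mathbb{R}^N}|b|^2\operatorname{div}\phi\,\xi\,dx\,dt+\nu\int_0^T\!\!\int_{\mathbb{R}^N}v\cdot\Delta\phi\,\xi\,dx\,dt$$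 and $$-\int_0^T\!\!\int_{\mathbb{R}^N}b\cdot\phi\,\xi'\,dx\,dt-\int_0^T\!\!\int_{\mathbb{R}^N}v\otimes b:\nabla\phi\,\xi\,dx\,dt=-\int_0^T\!\!\int_{\mathbb{R}^N}b\otimes v:\nabla\phi\,\xi\,dx\,dt+\mu\int_0^T\!\!\int_{\mathbb{R}^N}b\cdot\Delta\phi\,\xi\,dx\,dt,$$ where $v=v(x,t)$, $b=b(x,t)$, $\phi=\phi(x)$, $\xi=\xi(t)$, and it is part of the definition that all these integrals are well defined (absolutely convergent). No initial condition is imposed. Weak solution of the heat equation. $b$ is a weak solution of $\partial_t b=\mu\Delta b$ on $\mathbb{R}^2\times(0,T)$ if $$-\int_0^T\!\!\int_{\mathbb{R}^2}b(x,t)\cdot\phi(x)\,\xi'(t)\,dx\,dt=\mu\int_0^T\!\!\int_{\mathbb{R}^2}b(x,t)\cdot\Delta\phi(x)\,\xi(t)\,dx\,dt$$ for all $\phi\in[C_0^2(\mathbb{R}^2)]^2$ and $\xi\in C_0^1(0,T)$. *)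

theory Defs
  imports "HOL-Analysis.Analysis"
begin

section \<open>Partial derivatives and test functions\<close>

definition pderivative :: "'n::finite \<Rightarrow> (real^'n \<Rightarrow> real) \<Rightarrow> real^'n \<Rightarrow> real" where
  "pderivative i f x = frechet_derivative f (at x) (axis i 1)"

text \<open>The multi-index is given as a list of directions; the order of the list is immaterial for
  the smooth functions to which this is applied.\<close>

primrec iterated_pderivative :: "'n::finite list \<Rightarrow> (real^'n \<Rightarrow> real) \<Rightarrow> real^'n \<Rightarrow> real" where
  "iterated_pderivative [] f = f"
| "iterated_pderivative (i # \<alpha>) f = pderivative i (iterated_pderivative \<alpha> f)"

primrec Ck :: "nat \<Rightarrow> (real^'n::finite \<Rightarrow> real) \<Rightarrow> bool" where
  "Ck 0 f \<longleftrightarrow> continuous_on UNIV f"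
| "Ck (Suc k) f \<longleftrightarrow> f differentiable_on UNIV \<and> (\<forall>i. Ck k (pderivative i f))"

definition smooth :: "(real^'n::finite \<Rightarrow> real) \<Rightarrow> bool" where
  "smooth f \<longleftrightarrow> (\<forall>k. Ck k f)"

definition compact_support :: "('a::topological_space \<Rightarrow> 'b::zero) \<Rightarrow> bool" where
  "compact_support f \<longleftrightarrow> compact (closure {x. f x \<noteq> 0})"

definition C0_infinity :: "(real^'n::finite \<Rightarrow> real) set" where
  "C0_infinity = {\<psi>. smooth \<psi> \<and> compact_support \<psi>}"

definition C0_2 :: "(real^'n::finite \<Rightarrow> real) set" where
  "C0_2 = {\<psi>. Ck 2 \<psi> \<and> compact_support \<psi>}"

text \<open>Functions on the open interval with compact support in it are identified with their
  extension by zero to the real line.\<close>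

definition C0_1_time :: "real \<Rightarrow> (real \<Rightarrow> real) set" where
  "C0_1_time T = {\<xi>. \<xi> C1_differentiable_on UNIV \<and> compact_support \<xi>
                     \<and> closure {t. \<xi> t \<noteq> 0} \<subseteq> {0<..<T}}"

definition vector_fields :: "(real^'n::finite \<Rightarrow> real) set \<Rightarrow> (real^'n \<Rightarrow> real^'n) set" where
  "vector_fields F = {\<phi>. \<forall>i. (\<lambda>x. \<phi> x $ i) \<in> F}"

definition gradient :: "(real^'n::finite \<Rightarrow> real) \<Rightarrow> real^'n \<Rightarrow> real^'n" where
  "gradient \<psi> x = (\<chi> i. pderivative i \<psi> x)"

definition jacobian :: "(real^'n::finite \<Rightarrow> real^'n) \<Rightarrow> real^'n \<Rightarrow> real^'n^'n" where
  "jacobian \<phi> x = (\<chi> i j. pderivative i (\<lambda>y. \<phi> y $ j) x)"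

definition divergence :: "(real^'n::finite \<Rightarrow> real^'n) \<Rightarrow> real^'n \<Rightarrow> real" where
  "divergence \<phi> x = (\<Sum>i\<in>UNIV. pderivative i (\<lambda>y. \<phi> y $ i) x)"

definition laplacian :: "(real^'n::finite \<Rightarrow> real) \<Rightarrow> real^'n \<Rightarrow> real" where
  "laplacian \<psi> x = (\<Sum>i\<in>UNIV. pderivative i (pderivative i \<psi>) x)"

definition vector_laplacian :: "(real^'n::finite \<Rightarrow> real^'n) \<Rightarrow> real^'n \<Rightarrow> real^'n" where
  "vector_laplacian \<phi> x = (\<chi> j. laplacian (\<lambda>y. \<phi> y $ j) x)"

definition tensor :: "real^'n::finite \<Rightarrow> real^'n \<Rightarrow> real^'n^'n" where
  "tensor a c = (\<chi> i j. a $ i * c $ j)"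

definition frobenius :: "real^'n::finite^'n \<Rightarrow> real^'n^'n \<Rightarrow> real" where
  "frobenius A B = (\<Sum>i\<in>UNIV. \<Sum>j\<in>UNIV. A $ i $ j * B $ i $ j)"

section \<open>Schwartz functions and tempered distributions\<close>

text \<open>All functions and distributions are real valued, as are the velocity, the magnetic field
  and the pressure.\<close>

definition schwartz :: "(real^'n::finite \<Rightarrow> real) set" where
  "schwartz = {\<psi>. smooth \<psi> \<and>
     (\<forall>k \<alpha>. bdd_above (range (\<lambda>x. norm x ^ k * \<bar>iterated_pderivative \<alpha> \<psi> x\<bar>)))}"

definition schwartz_seminorm :: "nat \<Rightarrow> 'n::finite list \<Rightarrow> (real^'n \<Rightarrow> real) \<Rightarrow> real" where
  "schwartz_seminorm k \<alpha> \<psi> = (SUP x. norm x ^ k * \<bar>iterated_pderivative \<alpha> \<psi> x\<bar>)"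

definition schwartz_topology :: "(real^'n::finite \<Rightarrow> real) topology" where
  "schwartz_topology = topology_generated_by
     {{\<eta> \<in> schwartz. schwartz_seminorm k \<alpha> (\<lambda>x. \<eta> x - \<psi> x) < r} | k \<alpha> \<psi> r. \<psi> \<in> schwartz \<and> 0 < r}"

text \<open>The dual pairing of a distribution \<open>f\<close> with \<open>\<psi>\<close> is the application \<open>f \<psi>\<close>; the values of \<open>f\<close>
  outside the Schwartz class are irrelevant.\<close>

type_synonym 'n functional = "(real^'n \<Rightarrow> real) \<Rightarrow> real"

definition tempered :: "'n::finite functional set" where
  "tempered = {f.
     (\<forall>\<psi>\<in>schwartz. \<forall>\<eta>\<in>schwartz. f (\<lambda>x. \<psi> x + \<eta> x) = f \<psi> + f \<eta>) \<and>
     (\<forall>c. \<forall>\<psi>\<in>schwartz. f (\<lambda>x. c * \<psi> x) = c * f \<psi>) \<and>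
     continuous_map schwartz_topology euclideanreal f}"

section \<open>Hardy spaces\<close>

definition dilate :: "(real^'n::finite \<Rightarrow> real) \<Rightarrow> real \<Rightarrow> real^'n \<Rightarrow> real" where
  "dilate \<phi> s x = \<phi> ((1 / s) *\<^sub>R x) / s ^ CARD('n)"

definition convolution :: "'n::finite functional \<Rightarrow> (real^'n \<Rightarrow> real) \<Rightarrow> real^'n \<Rightarrow> real" where
  "convolution f \<psi> x = f (\<lambda>y. \<psi> (x - y))"

definition maximal_function ::
    "(real^'n::finite \<Rightarrow> real) \<Rightarrow> 'n functional \<Rightarrow> real^'n \<Rightarrow> ennreal" where
  "maximal_function \<phi> f x = (SUP s\<in>{0<..}. ennreal \<bar>convolution f (dilate \<phi> s) x\<bar>)"

text \<open>Powers with positive real exponent.\<close>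

definition ennreal_powr :: "ennreal \<Rightarrow> real \<Rightarrow> ennreal" where
  "ennreal_powr a q = (if a = \<infinity> then \<infinity> else ennreal (enn2real a powr q))"

definition hardy_norm :: "(real^'n::finite \<Rightarrow> real) \<Rightarrow> real \<Rightarrow> 'n functional \<Rightarrow> ennreal" where
  "hardy_norm \<phi> q f =
     ennreal_powr (\<integral>\<^sup>+x. ennreal_powr (maximal_function \<phi> f x) q \<partial>lebesgue) (1 / q)"

definition hardy :: "(real^'n::finite \<Rightarrow> real) \<Rightarrow> real \<Rightarrow> 'n functional set" where
  "hardy \<phi> q = {f \<in> tempered.
     maximal_function \<phi> f \<in> borel_measurable lebesgue \<and> hardy_norm \<phi> q f < \<infinity>}"

section \<open>Spaces of time-dependent functions and distributions\<close>

text \<open>A function of time and space is curried, with time first. The measure on space-time is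
  Lebesgue measure on the strip.\<close>

definition strip :: "real \<Rightarrow> (real \<times> (real^'n::finite)) measure" where
  "strip T = lebesgue_on ({0<..<T} \<times> UNIV)"

abbreviation time_measure :: "real \<Rightarrow> real measure" where
  "time_measure T \<equiv> lebesgue_on {0<..<T}"

definition L2_sigma :: "(real^'n::finite \<Rightarrow> real^'n) set" where
  "L2_sigma = {u. u \<in> borel_measurable lebesgue \<and> integrable lebesgue (\<lambda>x. (norm (u x))\<^sup>2) \<and>
     (\<forall>\<psi>\<in>C0_infinity. (LINT x|lebesgue. u x \<bullet> gradient \<psi> x) = 0)}"

text \<open>Elements of the Bochner spaces with values in \<open>L\<^sup>2\<close> and \<open>L\<^sup>1\<close> are represented by jointly
  measurable functions; every equivalence class has such a representative.\<close>

definition L1_L2_sigma :: "real \<Rightarrow> (real \<Rightarrow> real^'n::finite \<Rightarrow> real^'n) set" where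
  "L1_L2_sigma T = {u.
     (\<lambda>(t, x). u t x) \<in> borel_measurable (strip T) \<and>
     (AE t in time_measure T. u t \<in> L2_sigma) \<and>
     integrable (time_measure T) (\<lambda>t. sqrt (LINT x|lebesgue. (norm (u t x))\<^sup>2))}"

definition L1_L1 :: "real \<Rightarrow> (real \<Rightarrow> real^'n::finite \<Rightarrow> real) set" where
  "L1_L1 T = {f.
     (\<lambda>(t, x). f t x) \<in> borel_measurable (strip T) \<and>
     (AE t in time_measure T. integrable lebesgue (f t)) \<and>
     integrable (time_measure T) (\<lambda>t. LINT x|lebesgue. \<bar>f t x\<bar>)}"

definition L1_plus_L1 :: "real \<Rightarrow> (real \<Rightarrow> real^'n::finite \<Rightarrow> real) set" where
  "L1_plus_L1 T = {f \<in> L1_L1 T. AE t in time_measure T. 0 \<le> (LINT x|lebesgue. f t x)}"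

text \<open>Integrability of distribution-valued functions is meant in the weak sense, i.e. after
  pairing with each Schwartz function.\<close>

definition L1_tempered :: "real \<Rightarrow> (real \<Rightarrow> 'n::finite functional) set" where
  "L1_tempered T = {p.
     (AE t in time_measure T. p t \<in> tempered) \<and>
     (\<forall>\<psi>\<in>schwartz. integrable (time_measure T) (\<lambda>t. p t \<psi>))}"

definition L1_hardy ::
    "real \<Rightarrow> (real^'n::finite \<Rightarrow> real) \<Rightarrow> real \<Rightarrow> (real \<Rightarrow> 'n functional) set" where
  "L1_hardy T \<phi> q = {p \<in> L1_tempered T.
     (AE t in time_measure T. p t \<in> hardy \<phi> q) \<and>
     (\<lambda>t. hardy_norm \<phi> q (p t)) \<in> borel_measurable (time_measure T) \<and>
     (\<integral>\<^sup>+t. hardy_norm \<phi> q (p t) \<partial>time_measure T) < \<infinity>}"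

text \<open>The distribution-valued function \<open>p\<close> is given by the function \<open>f\<close>.\<close>

definition represented_by ::
    "real \<Rightarrow> (real \<Rightarrow> 'n::finite functional) \<Rightarrow> (real \<Rightarrow> real^'n \<Rightarrow> real) \<Rightarrow> bool" where
  "represented_by T p f \<longleftrightarrow>
     (AE t in time_measure T. \<forall>\<psi>\<in>schwartz. p t \<psi> = (LINT x|lebesgue. f t x * \<psi> x))"

section \<open>Weak solutions\<close>

definition strip_integrable :: "real \<Rightarrow> (real \<Rightarrow> real^'n::finite \<Rightarrow> real) \<Rightarrow> bool" where
  "strip_integrable T g \<longleftrightarrow> integrable (strip T) (\<lambda>(t, x). g t x)"

definition strip_integral :: "real \<Rightarrow> (real \<Rightarrow> real^'n::finite \<Rightarrow> real) \<Rightarrow> real" where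
  "strip_integral T g = (LINT z|strip T. (case z of (t, x) \<Rightarrow> g t x))"

definition mhd_weak_solution ::
    "real \<Rightarrow> real \<Rightarrow> real \<Rightarrow> (real \<Rightarrow> real^'n::finite \<Rightarrow> real^'n) \<Rightarrow> (real \<Rightarrow> real^'n \<Rightarrow> real^'n)
      \<Rightarrow> (real \<Rightarrow> 'n functional) \<Rightarrow> bool" where
  "mhd_weak_solution \<mu> \<nu> T v b p \<longleftrightarrow>
     v \<in> L1_L2_sigma T \<and> b \<in> L1_L2_sigma T \<and> p \<in> L1_tempered T \<and>
     (\<forall>\<xi>\<in>C0_1_time T. \<forall>\<phi>\<in>vector_fields C0_infinity.
        strip_integrable T (\<lambda>t x. (v t x \<bullet> \<phi> x) * deriv \<xi> t) \<and>
        strip_integrable T (\<lambda>t x. frobenius (tensor (v t x) (v t x)) (jacobian \<phi> x) * \<xi> t) \<and>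
        strip_integrable T (\<lambda>t x. frobenius (tensor (b t x) (b t x)) (jacobian \<phi> x) * \<xi> t) \<and>
        integrable (time_measure T) (\<lambda>t. p t (divergence \<phi>) * \<xi> t) \<and>
        strip_integrable T (\<lambda>t x. (norm (b t x))\<^sup>2 * divergence \<phi> x * \<xi> t) \<and>
        strip_integrable T (\<lambda>t x. (v t x \<bullet> vector_laplacian \<phi> x) * \<xi> t) \<and>
        - strip_integral T (\<lambda>t x. (v t x \<bullet> \<phi> x) * deriv \<xi> t)
        - strip_integral T (\<lambda>t x. frobenius (tensor (v t x) (v t x)) (jacobian \<phi> x) * \<xi> t)
        = - strip_integral T (\<lambda>t x. frobenius (tensor (b t x) (b t x)) (jacobian \<phi> x) * \<xi> t)
          + (LINT t|time_measure T. p t (divergence \<phi>) * \<xi> t)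
          + 1 / 2 * strip_integral T (\<lambda>t x. (norm (b t x))\<^sup>2 * divergence \<phi> x * \<xi> t)
          + \<nu> * strip_integral T (\<lambda>t x. (v t x \<bullet> vector_laplacian \<phi> x) * \<xi> t)) \<and>
     (\<forall>\<xi>\<in>C0_1_time T. \<forall>\<phi>\<in>vector_fields C0_infinity.
        strip_integrable T (\<lambda>t x. (b t x \<bullet> \<phi> x) * deriv \<xi> t) \<and>
        strip_integrable T (\<lambda>t x. frobenius (tensor (v t x) (b t x)) (jacobian \<phi> x) * \<xi> t) \<and>
        strip_integrable T (\<lambda>t x. frobenius (tensor (b t x) (v t x)) (jacobian \<phi> x) * \<xi> t) \<and>
        strip_integrable T (\<lambda>t x. (b t x \<bullet> vector_laplacian \<phi> x) * \<xi> t) \<and>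
        - strip_integral T (\<lambda>t x. (b t x \<bullet> \<phi> x) * deriv \<xi> t)
        - strip_integral T (\<lambda>t x. frobenius (tensor (v t x) (b t x)) (jacobian \<phi> x) * \<xi> t)
        = - strip_integral T (\<lambda>t x. frobenius (tensor (b t x) (v t x)) (jacobian \<phi> x) * \<xi> t)
          + \<mu> * strip_integral T (\<lambda>t x. (b t x \<bullet> vector_laplacian \<phi> x) * \<xi> t))"

definition heat_weak_solution ::
    "real \<Rightarrow> real \<Rightarrow> (real \<Rightarrow> real^'n::finite \<Rightarrow> real^'n) \<Rightarrow> bool" where
  "heat_weak_solution \<mu> T b \<longleftrightarrow>
     (\<forall>\<phi>\<in>vector_fields C0_2. \<forall>\<xi>\<in>C0_1_time T.
        strip_integrable T (\<lambda>t x. (b t x \<bullet> \<phi> x) * deriv \<xi> t) \<and>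
        strip_integrable T (\<lambda>t x. (b t x \<bullet> vector_laplacian \<phi> x) * \<xi> t) \<and>
        - strip_integral T (\<lambda>t x. (b t x \<bullet> \<phi> x) * deriv \<xi> t)
        = \<mu> * strip_integral T (\<lambda>t x. (b t x \<bullet> vector_laplacian \<phi> x) * \<xi> t))"

end

theory Submission
  imports Defs
begin

text \<open>Testing the momentum equation with a gradient field \<open>\<nabla>\<psi>\<close> removes the time derivative and the
  viscosity, because \<open>v(t)\<close> is divergence free and \<open>\<Delta>\<nabla>\<psi>\<close> is again a gradient. What remains holds at
  almost every time separately: with the stress
  \<open>F\<^sub>i\<^sub>j = v\<^sub>i v\<^sub>j - b\<^sub>i b\<^sub>j + \<delta>\<^sub>i\<^sub>j |b|\<^sup>2/2\<close>, which is integrable over space, the balance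
  \<open>\<langle>p, \<Delta>\<psi>\<rangle> + \<integral> F : D\<^sup>2\<psi> = 0\<close> holds for all \<open>\<psi>\<close> in a given countable family of test functions
  (\<open>mhd_balance\<close>). Put \<open>A\<^sub>i\<^sub>j = \<integral> F\<^sub>i\<^sub>j\<close>. The claim is that the diagonal entries of \<open>A\<close> are all equal
  to one number \<open>-s \<le> 0\<close> (\<open>mhd_stress_integral\<close>). Their sum is
  \<open>\<integral> |v|\<^sup>2 + (N/2 - 1) \<integral> |b|\<^sup>2 \<ge> 0\<close>, so that \<open>s = 0\<close> and \<open>v = 0\<close>; moreover \<open>b = 0\<close> if \<open>N \<ge> 3\<close>, whereas for
  \<open>N = 2\<close> the separate equations \<open>A\<^sub>k\<^sub>k = 0\<close> say that the components of \<open>b\<close> have equal norms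
  (\<open>stress_integral_consequences\<close>). Once \<open>v = 0\<close>, the nonlinear terms of the induction equation are
  gone and \<open>b\<close> solves the heat equation.

  The test functions \<open>\<psi>\<^sub>m(x) = m\<^sup>2 g(x/m)\<close>, where \<open>g\<close> is \<open>x\<^sub>k\<^sup>2/2\<close> times a bump function equal to one at the origin,
  have bounded Hessians that tend to \<open>e\<^sub>k \<otimes> e\<^sub>k\<close>. If \<open>p(t)\<close> is integrable, the balance therefore gives
  \<open>A\<^sub>k\<^sub>k = - \<integral> p(t)\<close>, which is at most zero by hypothesis (\<open>balance_integrable_pressure\<close>).

  If \<open>p(t)\<close> lies in a Hardy space, it need not have an integral to which \<open>\<langle>p, \<Delta>\<psi>\<^sub>m\<rangle>\<close> could be compared, and the
  pressure is rescaled instead. The smooth functions \<open>w\<^sub>n(y) = \<langle>p, \<phi>(y - \<sqdot>/n)\<rangle> = n\<^sup>N (p * \<phi>\<^sub>n)(ny)\<close> are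
  dominated by \<open>n\<^sup>N M(ny)\<close>, where \<open>M\<close> is the maximal function, so that the integral of \<open>|w\<^sub>n|\<^sup>q\<close> over a
  ball away from the origin is at most \<open>n\<^sup>N\<^sup>q\<^sup>-\<^sup>N\<close> times a tail of \<open>\<integral> M\<^sup>q\<close> and tends to zero
  (\<open>hardy_decay\<close>). On the other hand the balance shows that \<open>\<Delta>w\<^sub>n\<close> converges boundedly to
  \<open>- A : D\<^sup>2\<phi>\<close>. For \<open>q < 1\<close>, smallness in \<open>L\<^sup>q\<close> alone does not force the limit of the Laplacians to
  vanish, but a bound for the Laplacian and the \<open>L\<^sup>q\<close> size on a ball together bound a function on a
  smaller one (\<open>hardy_littlewood_bound\<close>). Hence \<open>w\<^sub>n\<close> tends to zero also in \<open>L\<^sup>1\<close> locally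
  (\<open>laplacian_limit_vanishes\<close>), \<open>A : D\<^sup>2\<phi>\<close> vanishes off the origin and by continuity everywhere, and
  integrating it against \<open>\<psi>\<^sub>m\<close> yields \<open>A\<^sub>k\<^sub>k \<integral> \<phi> = 0\<close> (\<open>balance_hardy_pressure\<close>).\<close>

section \<open>Calculus of partial derivatives\<close>

lemma pderivative_eqI:
  "(f has_derivative f') (at x) \<Longrightarrow> pderivative i f x = f' (axis i 1)"
  unfolding pderivative_def by (metis frechet_derivative_at)

lemma has_derivative_pderivative:
  fixes f :: "real^'n::finite \<Rightarrow> real"
  assumes "f differentiable (at x)"
  shows "(f has_derivative (\<lambda>v. \<Sum>i\<in>UNIV. v $ i * pderivative i f x)) (at x)"
proof -
  obtain f' where f': "(f has_derivative f') (at x)"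
    using assms by (auto simp: differentiable_def)
  interpret linear f' using f' by (rule has_derivative_linear)
  have "f' v = (\<Sum>i\<in>UNIV. v $ i * pderivative i f x)" for v
  proof -
    have "f' v = f' (\<Sum>i\<in>UNIV. v $ i *s axis i 1)" by (simp add: basis_expansion)
    also have "\<dots> = (\<Sum>i\<in>UNIV. v $ i * f' (axis i 1))"
      by (simp add: sum scale scalar_mult_eq_scaleR)
    finally show ?thesis by (simp add: pderivative_eqI[OF f'])
  qed
  then show ?thesis using f' by presburger
qed

lemma pderivative_add:
  assumes "f differentiable (at x)" "g differentiable (at x)"
  shows "pderivative i (\<lambda>x. f x + g x) x = pderivative i f x + pderivative i g x"
  using pderivative_eqI[OF has_derivative_add[OF assms[unfolded frechet_derivative_works]]]
  by (simp add: pderivative_def)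

lemma pderivative_mult:
  assumes "f differentiable (at x)" "g differentiable (at x)"
  shows "pderivative i (\<lambda>x. f x * g x) x = f x * pderivative i g x + pderivative i f x * g x"
  using pderivative_eqI[OF has_derivative_mult[OF assms[unfolded frechet_derivative_works]]]
  by (simp add: pderivative_def)

lemma pderivative_const [simp]: "pderivative i (\<lambda>x. c) = (\<lambda>x. 0)"
  by (rule ext, rule pderivative_eqI, rule has_derivative_const)

lemma pderivative_cmult:
  assumes "f differentiable (at x)"
  shows "pderivative i (\<lambda>x. c * f x) x = c * pderivative i f x"
  using pderivative_mult[OF differentiable_const assms] by simp

lemma pderivative_coordinate:
  "pderivative i (\<lambda>x. x $ j) = (\<lambda>x. if i = j then 1 else 0)"
proof
  fix x :: "real^'a"
  have "((\<lambda>x. x $ j) has_derivative (\<lambda>x. x $ j)) (at x)"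
    by (rule bounded_linear_imp_has_derivative[OF bounded_linear_vec_nth])
  from pderivative_eqI[OF this] show "pderivative i (\<lambda>x. x $ j) x = (if i = j then 1 else 0)"
    by (simp add: axis_def)
qed

lemma differentiable_affine:
  fixes f :: "real^'n::finite \<Rightarrow> real"
  assumes "f differentiable (at (a + c *\<^sub>R x))"
  shows "(\<lambda>x. f (a + c *\<^sub>R x)) differentiable (at x)"
  by (rule differentiable_compose[where g="\<lambda>x. a + c *\<^sub>R x"]) (use assms in \<open>auto intro!: derivative_intros\<close>)

lemma pderivative_affine:
  fixes f :: "real^'n::finite \<Rightarrow> real"
  assumes "f differentiable (at (a + c *\<^sub>R x))"
  shows "pderivative i (\<lambda>x. f (a + c *\<^sub>R x)) x = c * pderivative i f (a + c *\<^sub>R x)"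
proof -
  obtain f' where f': "(f has_derivative f') (at (a + c *\<^sub>R x))"
    using assms by (auto simp: differentiable_def)
  have "((\<lambda>x. a + c *\<^sub>R x) has_derivative (\<lambda>v. c *\<^sub>R v)) (at x)"
    by (auto intro!: derivative_eq_intros)
  from diff_chain_at[OF this f'] have
    "((\<lambda>x. f (a + c *\<^sub>R x)) has_derivative (\<lambda>v. f' (c *\<^sub>R v))) (at x)" by (simp add: o_def)
  from pderivative_eqI[OF this, of i] pderivative_eqI[OF f', of i] show ?thesis
    using linear_scale[OF has_derivative_linear[OF f']] by simp
qed

lemma pderivative_chain:
  fixes q :: "real^'n::finite \<Rightarrow> real"
  assumes "q differentiable (at x)" "(h has_real_derivative d) (at (q x))"
  shows "(\<lambda>x. h (q x)) differentiable (at x)"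
    and "pderivative i (\<lambda>x. h (q x)) x = d * pderivative i q x"
proof -
  have "(q has_derivative frechet_derivative q (at x)) (at x)"
    using assms(1) by (simp add: frechet_derivative_works)
  from diff_chain_at[OF this assms(2)[unfolded has_field_derivative_def]]
  have *: "((\<lambda>x. h (q x)) has_derivative (\<lambda>v. d * frechet_derivative q (at x) v)) (at x)"
    by (simp add: o_def)
  then show "(\<lambda>x. h (q x)) differentiable (at x)" by (auto simp: differentiable_def)
  show "pderivative i (\<lambda>x. h (q x)) x = d * pderivative i q x"
    using pderivative_eqI[OF *] by (simp add: pderivative_def)
qed

section \<open>Classes of differentiable functions\<close>

lemma Ck_continuous: "Ck k f \<Longrightarrow> continuous_on UNIV f"
  by (cases k) (auto intro: differentiable_imp_continuous_on)

lemma Ck_Suc_imp: "Ck (Suc k) f \<Longrightarrow> Ck k f"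
proof (induction k arbitrary: f)
  case 0 then show ?case by (auto intro: differentiable_imp_continuous_on)
next
  case (Suc k) then show ?case by auto
qed

lemma Ck_SucI:
  assumes "\<And>x. f differentiable (at x)" "\<And>i. Ck k (pderivative i f)"
  shows "Ck (Suc k) f"
  using assms by (simp add: differentiable_on_def differentiable_at_withinI)

lemma Ck_differentiable: "Ck (Suc k) f \<Longrightarrow> f differentiable (at x)"
  by (simp add: differentiable_on_def)

lemma smooth_iff:
  "smooth f \<longleftrightarrow> (\<forall>x. f differentiable (at x)) \<and> (\<forall>i. smooth (pderivative i f))"
proof
  assume "smooth f"
  then have "Ck (Suc k) f" for k unfolding smooth_def by blast
  then show "(\<forall>x. f differentiable (at x)) \<and> (\<forall>i. smooth (pderivative i f))"
    using Ck_differentiable[of 0 f] by (auto simp: smooth_def)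
next
  assume *: "(\<forall>x. f differentiable (at x)) \<and> (\<forall>i. smooth (pderivative i f))"
  then have "Ck (Suc k) f" for k by (intro Ck_SucI) (auto simp: smooth_def)
  then show "smooth f" unfolding smooth_def by (metis Ck_Suc_imp)
qed

lemma smooth_differentiable: "smooth f \<Longrightarrow> f differentiable (at x)"
  using smooth_iff by blast

lemma smooth_pderivative: "smooth f \<Longrightarrow> smooth (pderivative i f)"
  using smooth_iff by blast

lemma smooth_continuous: "smooth f \<Longrightarrow> continuous_on A f"
  by (metis Ck_continuous continuous_on_subset smooth_def subset_UNIV)

lemma smooth_measurable: "smooth f \<Longrightarrow> f \<in> borel_measurable borel"
  using smooth_continuous[of f UNIV] by (rule borel_measurable_continuous_onI)

text \<open>A class of functions that are differentiable and whose partial derivatives stay in the class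
  consists of smooth functions. Most smoothness proofs below exhibit such a class.\<close>

lemma smooth_coinduct:
  assumes "P f" "\<And>g. P g \<Longrightarrow> (\<forall>x. g differentiable (at x)) \<and> (\<forall>i. P (pderivative i g))"
  shows "smooth f"
proof -
  have "Ck k g" if "P g" for k g
    using that
  proof (induction k arbitrary: g)
    case 0
    then have "\<forall>x. g differentiable (at x)" using assms(2) by blast
    then have "g differentiable_on UNIV" by (simp add: differentiable_on_def)
    then show ?case by (auto intro: differentiable_imp_continuous_on)
  next
    case (Suc k) then show ?case using assms(2)[OF Suc.prems] by (intro Ck_SucI) auto
  qed
  then show ?thesis using assms(1) by (simp add: smooth_def)
qed

lemma Ck_add: "Ck k f \<Longrightarrow> Ck k g \<Longrightarrow> Ck k (\<lambda>x. f x + g x)"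
proof (induction k arbitrary: f g)
  case 0 then show ?case by (auto intro: continuous_intros)
next
  case (Suc k)
  have "pderivative i (\<lambda>x. f x + g x) = (\<lambda>x. pderivative i f x + pderivative i g x)" for i
    using Suc.prems by (intro ext pderivative_add Ck_differentiable)
  then show ?case using Suc by (auto intro!: derivative_intros)
qed

lemma Ck_mult: "Ck k f \<Longrightarrow> Ck k g \<Longrightarrow> Ck k (\<lambda>x. f x * g x)"
proof (induction k arbitrary: f g)
  case 0 then show ?case by (auto intro: continuous_intros)
next
  case (Suc k)
  have *: "pderivative i (\<lambda>x. f x * g x) = (\<lambda>x. f x * pderivative i g x + pderivative i f x * g x)" for i
    using Suc.prems by (intro ext pderivative_mult Ck_differentiable)
  have "Ck k f" "Ck k g" using Suc.prems Ck_Suc_imp by blast+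
  then have "Ck k (pderivative i (\<lambda>x. f x * g x))" for i
    unfolding * using Suc.prems by (intro Ck_add Suc.IH) auto
  then show ?case using Suc.prems by (auto intro!: derivative_intros)
qed

lemma smooth_add: "smooth f \<Longrightarrow> smooth g \<Longrightarrow> smooth (\<lambda>x. f x + g x)"
  by (simp add: smooth_def Ck_add)

lemma smooth_mult: "smooth f \<Longrightarrow> smooth g \<Longrightarrow> smooth (\<lambda>x. f x * g x)"
  by (simp add: smooth_def Ck_mult)

lemma smooth_const: "smooth (\<lambda>x::real^'a::finite. c)"
proof (rule smooth_coinduct[where P="\<lambda>f. \<exists>c. f = (\<lambda>x. c)"])
  show "\<exists>d. (\<lambda>x. c) = (\<lambda>x. d)" by blast
next
  fix g :: "real^'a \<Rightarrow> real"
  assume "\<exists>c. g = (\<lambda>x. c)"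
  then obtain c where g: "g = (\<lambda>x. c)" by blast
  then show "(\<forall>x. g differentiable (at x)) \<and> (\<forall>i. \<exists>c. pderivative i g = (\<lambda>x. c))"
    unfolding g pderivative_const by (auto intro: derivative_intros)
qed

lemma smooth_cmult: "smooth f \<Longrightarrow> smooth (\<lambda>x. c * f x)"
  by (intro smooth_mult smooth_const)

lemma smooth_minus: "smooth f \<Longrightarrow> smooth (\<lambda>x. - f x)"
  using smooth_cmult[of f "-1"] by simp

lemma smooth_diff: "smooth f \<Longrightarrow> smooth g \<Longrightarrow> smooth (\<lambda>x. f x - g x)"
  using smooth_add[OF _ smooth_minus, of f g] by simp

lemma smooth_sum: "(\<And>i. i \<in> I \<Longrightarrow> smooth (f i)) \<Longrightarrow> smooth (\<lambda>x. \<Sum>i\<in>I. f i x)"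
  by (induction I rule: infinite_finite_induct) (auto intro: smooth_const smooth_add)

lemma smooth_coordinate: "smooth (\<lambda>x. x $ j)"
  by (subst smooth_iff) (auto simp: pderivative_coordinate smooth_const
      intro!: bounded_linear_imp_differentiable bounded_linear_vec_nth)

lemma smooth_affine:
  assumes "smooth f" shows "smooth (\<lambda>x. f (a + c *\<^sub>R x))"
proof (rule smooth_coinduct[where P="\<lambda>g. \<exists>d h. smooth h \<and> g = (\<lambda>x. d * h (a + c *\<^sub>R x))"])
  show "\<exists>d h. smooth h \<and> (\<lambda>x. f (a + c *\<^sub>R x)) = (\<lambda>x. d * h (a + c *\<^sub>R x))"
    using assms by (intro exI[of _ 1] exI[of _ f]) auto
next
  fix g assume "\<exists>d h. smooth h \<and> g = (\<lambda>x. d * h (a + c *\<^sub>R x))"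
  then obtain d h where h: "smooth h" and g: "g = (\<lambda>x. d * h (a + c *\<^sub>R x))" by blast
  have dif: "(\<lambda>x. h (a + c *\<^sub>R x)) differentiable (at x)" for x
    by (intro differentiable_affine smooth_differentiable h)
  have "pderivative i g = (\<lambda>x. (d * c) * pderivative i h (a + c *\<^sub>R x))" for i
    unfolding g using dif h by (auto simp: pderivative_cmult pderivative_affine smooth_differentiable)
  moreover have "g differentiable (at x)" for x
    unfolding g using dif by (intro derivative_intros)
  ultimately show "(\<forall>x. g differentiable (at x)) \<and>
     (\<forall>i. \<exists>d h. smooth h \<and> pderivative i g = (\<lambda>x. d * h (a + c *\<^sub>R x)))"
    using smooth_pderivative[OF h] by blast
qed

section \<open>Symmetry of second derivatives\<close>

lemma derivative_along_line:
  fixes f :: "real^'n::finite \<Rightarrow> real"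
  assumes "f differentiable (at (x + t *\<^sub>R v))"
  shows "((\<lambda>t. f (x + t *\<^sub>R v)) has_real_derivative (\<Sum>i\<in>UNIV. v $ i * pderivative i f (x + t *\<^sub>R v))) (at t)"
proof -
  have "((\<lambda>t. x + t *\<^sub>R v) has_derivative (\<lambda>s. s *\<^sub>R v)) (at t)"
    by (auto intro!: derivative_eq_intros)
  from diff_chain_at[OF this has_derivative_pderivative[OF assms]]
  have "((\<lambda>t. f (x + t *\<^sub>R v)) has_derivative
      (\<lambda>s. \<Sum>i\<in>UNIV. (s *\<^sub>R v) $ i * pderivative i f (x + t *\<^sub>R v))) (at t)"
    by (simp add: o_def)
  also have "(\<lambda>s. \<Sum>i\<in>UNIV. (s *\<^sub>R v) $ i * pderivative i f (x + t *\<^sub>R v))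
     = (*) (\<Sum>i\<in>UNIV. v $ i * pderivative i f (x + t *\<^sub>R v))"
    by (auto simp: sum_distrib_left mult_ac)
  finally show ?thesis by (simp add: has_field_derivative_def)
qed

lemmas smooth_derivative_along_line = derivative_along_line[OF smooth_differentiable]

lemma sum_axis_mult: "(\<Sum>k\<in>UNIV. axis i (1::real) $ k * g k) = g i"
proof -
  have "(\<Sum>k\<in>UNIV. axis i (1::real) $ k * g k) = (\<Sum>k\<in>UNIV. if k = i then g k else 0)"
    by (intro sum.cong) (auto simp: axis_def)
  then show ?thesis by simp
qed

text \<open>The mixed second difference is symmetric in the two directions. Applying the mean value theorem
  first in direction \<open>i\<close> and then in direction \<open>j\<close> turns it into a nearby value of \<open>\<partial>\<^sub>j \<partial>\<^sub>i f\<close>, and comparison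
  with the other order gives the symmetry of second derivatives.\<close>

lemma second_difference_mean_value:
  fixes f :: "real^'n::finite \<Rightarrow> real"
  assumes f: "smooth f" and h: "0 < h"
  obtains y where "norm (y - x) \<le> 2 * h"
    "f (x + h *\<^sub>R axis i 1 + h *\<^sub>R axis j 1) - f (x + h *\<^sub>R axis i 1) - f (x + h *\<^sub>R axis j 1) + f x
      = h * h * pderivative j (pderivative i f) y"
proof -
  let ?e = "\<lambda>k. axis k 1 :: real^'n"
  define g where "g t = f (x + h *\<^sub>R ?e j + t *\<^sub>R ?e i) - f (x + t *\<^sub>R ?e i)" for t
  have "(g has_real_derivative
     pderivative i f (x + h *\<^sub>R ?e j + t *\<^sub>R ?e i) - pderivative i f (x + t *\<^sub>R ?e i)) (at t)" for t
    unfolding g_def using DERIV_diff[OF smooth_derivative_along_line[OF f, of "x + h *\<^sub>R ?e j" "?e i" t]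
        smooth_derivative_along_line[OF f, of "x" "?e i" t]]
    by (simp add: sum_axis_mult)
  then obtain s where s: "0 < s" "s < h" "g h - g 0 =
     h * (pderivative i f (x + h *\<^sub>R ?e j + s *\<^sub>R ?e i) - pderivative i f (x + s *\<^sub>R ?e i))"
    using MVT2[OF h, of g "\<lambda>t. pderivative i f (x + h *\<^sub>R ?e j + t *\<^sub>R ?e i) - pderivative i f (x + t *\<^sub>R ?e i)"]
    by auto
  define k where "k t = pderivative i f (x + s *\<^sub>R ?e i + t *\<^sub>R ?e j)" for t
  have "(k has_real_derivative pderivative j (pderivative i f) (x + s *\<^sub>R ?e i + t *\<^sub>R ?e j)) (at t)" for t
    unfolding k_def using smooth_derivative_along_line[OF smooth_pderivative[OF f], of i "x + s *\<^sub>R ?e i" "?e j" t]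
    by (simp add: sum_axis_mult)
  then obtain r where r: "0 < r" "r < h" "k h - k 0 =
     h * pderivative j (pderivative i f) (x + s *\<^sub>R ?e i + r *\<^sub>R ?e j)"
    using MVT2[OF h, of k "\<lambda>t. pderivative j (pderivative i f) (x + s *\<^sub>R ?e i + t *\<^sub>R ?e j)"]
    by auto
  show ?thesis
  proof
    have "norm (s *\<^sub>R ?e i + r *\<^sub>R ?e j) \<le> norm (s *\<^sub>R ?e i) + norm (r *\<^sub>R ?e j)"
      by (rule norm_triangle_ineq)
    also have "\<dots> \<le> 2 * h" using s r by simp
    finally show "norm (x + s *\<^sub>R ?e i + r *\<^sub>R ?e j - x) \<le> 2 * h" by (simp add: algebra_simps)
    have "g h - g 0 = h * (k h - k 0)" using s(3) by (simp add: k_def algebra_simps)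
    then show "f (x + h *\<^sub>R axis i 1 + h *\<^sub>R axis j 1) - f (x + h *\<^sub>R axis i 1) - f (x + h *\<^sub>R axis j 1) + f x
      = h * h * pderivative j (pderivative i f) (x + s *\<^sub>R ?e i + r *\<^sub>R ?e j)"
      using r(3) by (simp add: g_def algebra_simps)
  qed
qed

lemma pderivative_commute:
  fixes f :: "real^'n::finite \<Rightarrow> real"
  assumes f: "smooth f"
  shows "pderivative i (pderivative j f) = pderivative j (pderivative i f)"
proof
  fix x
  define A where "A = pderivative i (pderivative j f)"
  define B where "B = pderivative j (pderivative i f)"
  have cont: "isCont A x" "isCont B x"
    using smooth_continuous[of A UNIV] smooth_continuous[of B UNIV] f
    by (auto simp: A_def B_def continuous_on_eq_continuous_at smooth_pderivative)
  have "dist (A x) (B x) < e" if "0 < e" for e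
  proof -
    obtain d1 where d1: "d1 > 0" "\<And>y. dist y x < d1 \<Longrightarrow> dist (A y) (A x) < e/2"
      using cont(1) \<open>0 < e\<close> unfolding continuous_at_eps_delta by (metis half_gt_zero)
    obtain d2 where d2: "d2 > 0" "\<And>y. dist y x < d2 \<Longrightarrow> dist (B y) (B x) < e/2"
      using cont(2) \<open>0 < e\<close> unfolding continuous_at_eps_delta by (metis half_gt_zero)
    define h where "h = min d1 d2 / 4"
    have h: "0 < h" "2 * h < d1" "2 * h < d2" using d1 d2 by (auto simp: h_def)
    obtain y where y: "norm (y - x) \<le> 2 * h"
      "f (x + h *\<^sub>R axis i 1 + h *\<^sub>R axis j 1) - f (x + h *\<^sub>R axis i 1) - f (x + h *\<^sub>R axis j 1) + f x
      = h * h * B y" using second_difference_mean_value[OF f h(1), of x i j] unfolding B_def by metis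
    obtain z where z: "norm (z - x) \<le> 2 * h"
      "f (x + h *\<^sub>R axis j 1 + h *\<^sub>R axis i 1) - f (x + h *\<^sub>R axis j 1) - f (x + h *\<^sub>R axis i 1) + f x
      = h * h * A z" using second_difference_mean_value[OF f h(1), of x j i] unfolding A_def by metis
    have "x + h *\<^sub>R axis j 1 + h *\<^sub>R axis i 1 = x + h *\<^sub>R axis i 1 + h *\<^sub>R axis j 1"
      by (simp add: algebra_simps)
    then have "h * h * A z = h * h * B y" using y(2) z(2) by (simp only:)
    then have "A z = B y" using h by simp
    moreover have "dist (A z) (A x) < e/2" "dist (B y) (B x) < e/2"
      using d1 d2 y z h by (auto simp: dist_norm)
    ultimately show ?thesis
      by (metis dist_commute dist_triangle_half_l)
  qed
  then have "A x = B x" by (metis dist_self dist_pos_lt less_irrefl)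
  then show "pderivative i (pderivative j f) x = pderivative j (pderivative i f) x"
    by (simp add: A_def B_def)
qed

section \<open>Iterated partial derivatives\<close>

lemma smooth_iterated: "smooth f \<Longrightarrow> smooth (iterated_pderivative \<alpha> f)"
  by (induction \<alpha>) (auto intro: smooth_pderivative)

lemma iterated_pderivative_snoc:
  "iterated_pderivative (\<alpha> @ [i]) f = iterated_pderivative \<alpha> (pderivative i f)"
  by (induction \<alpha>) auto

lemma iterated_pderivative_commute:
  "smooth f \<Longrightarrow> iterated_pderivative \<alpha> (pderivative i f) = pderivative i (iterated_pderivative \<alpha> f)"
  by (induction \<alpha>) (auto simp: pderivative_commute smooth_iterated)

lemma iterated_pderivative_add:
  assumes "smooth f" "smooth g"
  shows "iterated_pderivative \<alpha> (\<lambda>x. f x + g x)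
    = (\<lambda>x. iterated_pderivative \<alpha> f x + iterated_pderivative \<alpha> g x)"
  by (induction \<alpha>) (auto intro!: ext pderivative_add smooth_differentiable smooth_iterated assms)

lemma iterated_pderivative_cmult:
  assumes "smooth f"
  shows "iterated_pderivative \<alpha> (\<lambda>x. c * f x) = (\<lambda>x. c * iterated_pderivative \<alpha> f x)"
  by (induction \<alpha>) (auto intro!: ext pderivative_cmult smooth_differentiable smooth_iterated assms)

lemma iterated_pderivative_diff:
  assumes "smooth f" "smooth g"
  shows "iterated_pderivative \<alpha> (\<lambda>x. f x - g x)
    = (\<lambda>x. iterated_pderivative \<alpha> f x - iterated_pderivative \<alpha> g x)"
  using iterated_pderivative_add[OF assms(1) smooth_cmult[OF assms(2)], of \<alpha> "-1"]
  unfolding iterated_pderivative_cmult[OF assms(2)] by simp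

lemma iterated_pderivative_zero [simp]: "iterated_pderivative \<alpha> (\<lambda>x. 0) = (\<lambda>x. 0)"
  by (induction \<alpha>) auto

lemma iterated_pderivative_sum:
  assumes "\<And>i. i \<in> I \<Longrightarrow> smooth (f i)"
  shows "iterated_pderivative \<alpha> (\<lambda>x. \<Sum>i\<in>I. f i x) = (\<lambda>x. \<Sum>i\<in>I. iterated_pderivative \<alpha> (f i) x)"
  using assms
  by (induction I rule: infinite_finite_induct) (auto simp: iterated_pderivative_add smooth_sum)

lemma iterated_pderivative_affine:
  assumes "smooth f"
  shows "iterated_pderivative \<alpha> (\<lambda>x. f (a + c *\<^sub>R x))
    = (\<lambda>x. c ^ length \<alpha> * iterated_pderivative \<alpha> f (a + c *\<^sub>R x))"
proof (induction \<alpha>)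
  case (Cons i \<alpha>)
  have d: "iterated_pderivative \<alpha> f differentiable (at x)" for x
    by (intro smooth_differentiable smooth_iterated assms)
  then show ?case using Cons
    by (auto simp: pderivative_cmult pderivative_affine differentiable_affine)
qed auto

section \<open>Smooth bump functions\<close>

text \<open>The factors \<open>t\<^sup>-\<^sup>j\<close> make the family of functions \<open>exp (-1/t) t\<^sup>-\<^sup>j\<close> closed under differentiation up to
  linear combinations, so that smoothness of all of them follows from a formula for one derivative.\<close>

definition exp_inv :: "nat \<Rightarrow> real \<Rightarrow> real" where
  "exp_inv j t = (if 0 < t then exp (- inverse t) * inverse t ^ j else 0)"

lemma power_le_fact_exp:
  fixes x :: real
  assumes "0 \<le> x"
  shows "x ^ n \<le> fact n * exp x"
proof -
  have "(\<Sum>k\<in>{n}. x ^ k /\<^sub>R fact k) \<le> exp x"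
    unfolding exp_def by (rule sum_le_suminf) (use assms summable_exp_generic[of x] in auto)
  then show ?thesis by (simp add: field_simps)
qed

lemma exp_inv_nonneg: "0 \<le> exp_inv j t"
  by (simp add: exp_inv_def)

text \<open>This quadratic bound is what makes the derivative at the origin exist and vanish.\<close>

lemma exp_inv_quadratic: "exp_inv j t \<le> fact (j + 2) * t\<^sup>2"
proof (cases "0 < t")
  case True
  have "inverse t ^ (j + 2) \<le> fact (j + 2) * exp (inverse t)"
    by (rule power_le_fact_exp) (use True in simp)
  then have "inverse t ^ (j + 2) * exp (- inverse t) \<le> fact (j + 2) * exp (inverse t) * exp (- inverse t)"
    by (rule mult_right_mono) simp
  also have "\<dots> = fact (j + 2)" by (simp add: mult.assoc flip: exp_add)
  finally have "inverse t ^ (j + 2) * exp (- inverse t) * t\<^sup>2 \<le> fact (j + 2) * t\<^sup>2"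
    by (rule mult_right_mono) simp
  moreover have "inverse t ^ (j + 2) * exp (- inverse t) * t\<^sup>2 = exp_inv j t"
    using True by (simp add: exp_inv_def power_add field_simps power2_eq_square)
  ultimately show ?thesis by linarith
qed (simp add: exp_inv_def)

lemma exp_inv_derivative:
  "(exp_inv j has_real_derivative (- real j * exp_inv (j + 1) t + exp_inv (j + 2) t)) (at t)"
proof -
  consider "t < 0" | "t = 0" | "0 < t" by linarith
  then show ?thesis
  proof cases
    case 1
    have "((\<lambda>t. 0) has_real_derivative 0) (at t)" by simp
    then have "(exp_inv j has_real_derivative 0) (at t)"
      by (rule DERIV_cong_ev[THEN iffD1, rotated -1])
        (use 1 in \<open>auto simp: exp_inv_def intro!: eventually_mono[OF eventually_nhds_in_open[of "{..<0}"]]\<close>)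
    then show ?thesis using 1 by (simp add: exp_inv_def)
  next
    case 2
    have "((\<lambda>h. exp_inv j h / h) \<longlongrightarrow> 0) (at 0)"
    proof (rule Lim_null_comparison)
      show "\<forall>\<^sub>F h in at 0. norm (exp_inv j h / h) \<le> fact (j + 2) * \<bar>h\<bar>"
      proof (intro always_eventually allI)
        fix h :: real
        have "exp_inv j h \<le> fact (j + 2) * (\<bar>h\<bar> * \<bar>h\<bar>)"
          using exp_inv_quadratic[of j h] by (simp add: power2_eq_square)
        then show "norm (exp_inv j h / h) \<le> fact (j + 2) * \<bar>h\<bar>"
          by (cases "h = 0") (auto simp: exp_inv_nonneg divide_le_eq mult.assoc)
      qed
      have "((\<lambda>h::real. fact (j + 2) * \<bar>h\<bar>) \<longlongrightarrow> fact (j + 2) * \<bar>0\<bar>) (at 0)" 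
        by (intro tendsto_intros)
      then show "((\<lambda>h::real. fact (j + 2) * \<bar>h\<bar>) \<longlongrightarrow> 0) (at 0)" by simp
    qed
    then show ?thesis using 2 by (simp add: DERIV_def exp_inv_def)
  next
    case 3
    have "((\<lambda>t. exp (- inverse t) * inverse t ^ j) has_real_derivative
       (exp (- inverse t) * inverse t ^ 2 * inverse t ^ j
       + exp (- inverse t) * (real j * inverse t ^ (j - 1) * (- (inverse t ^ 2))))) (at t)"
      using 3 by (auto intro!: derivative_eq_intros simp: power2_eq_square algebra_simps)
    moreover have "real j * inverse t ^ (j - 1) * (- (inverse t ^ 2)) = - real j * inverse t ^ (j + 1)"
      by (cases j) (auto simp: power2_eq_square algebra_simps)
    ultimately have "((\<lambda>t. exp (- inverse t) * inverse t ^ j) has_real_derivative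
       (exp (- inverse t) * inverse t ^ 2 * inverse t ^ j
       + exp (- inverse t) * (- real j * inverse t ^ (j + 1)))) (at t)" by (simp only:)
    then have "((\<lambda>t. exp (- inverse t) * inverse t ^ j) has_real_derivative
       (- real j * exp_inv (j + 1) t + exp_inv (j + 2) t)) (at t)"
      using 3 by (simp add: exp_inv_def power_add power2_eq_square algebra_simps)
    then show ?thesis
      by (rule DERIV_cong_ev[THEN iffD1, rotated -1])
        (use 3 in \<open>auto simp: exp_inv_def intro!: eventually_mono[OF eventually_nhds_in_open[of "{0<..}"]]\<close>)
  qed
qed

definition bump :: "nat \<Rightarrow> real^'n::finite \<Rightarrow> real" where
  "bump j x = exp_inv j (1 - x \<bullet> x)"

lemma bump_nonneg: "0 \<le> bump j x"
  by (simp add: bump_def exp_inv_nonneg)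

lemma bump_eq_0: "1 \<le> norm x \<Longrightarrow> bump j x = 0"
  by (simp add: bump_def exp_inv_def dot_square_norm not_less)

lemma bump_pos: "norm x < 1 \<Longrightarrow> 0 < bump j x"
  by (simp add: bump_def exp_inv_def dot_square_norm power_less_one_iff abs_square_less_1)

lemma quadratic_has_derivative:
  "((\<lambda>x::real^'n::finite. 1 - x \<bullet> x) has_derivative (\<lambda>v. - 2 * (x \<bullet> v))) (at x)"
  by (auto intro!: derivative_eq_intros simp: inner_commute)

text \<open>For \<open>j = 0\<close> the formula says that \<open>2 x bump 2 x\<close> is minus the gradient of \<open>bump 0\<close>, which is the
  source of the mean value inequality below.\<close>

lemma pderivative_bump:
  fixes x :: "real^'a::finite"
  shows "bump j differentiable (at x)"
    and "pderivative i (bump j) x = - 2 * x $ i * (- real j * bump (j + 1) x + bump (j + 2) x)"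
proof -
  have q: "(\<lambda>x::real^'a. 1 - x \<bullet> x) differentiable (at x)"
    using quadratic_has_derivative differentiable_def by blast
  have p: "pderivative i (\<lambda>x::real^'a. 1 - x \<bullet> x) x = - 2 * x $ i"
    unfolding pderivative_eqI[OF quadratic_has_derivative] by (simp add: inner_axis)
  note * = pderivative_chain[OF q exp_inv_derivative[of j]]
  show "bump j differentiable (at x)" using *(1) by (simp add: bump_def[abs_def])
  show "pderivative i (bump j) x = - 2 * x $ i * (- real j * bump (j + 1) x + bump (j + 2) x)"
    using *(2)[of i] p by (simp add: bump_def[abs_def])
qed

lemma smooth_bump: "smooth (bump j :: real^'a::finite \<Rightarrow> real)"
proof -
  have "Ck k (bump j :: real^'a \<Rightarrow> real)" for k
  proof (induction k arbitrary: j)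
    case 0 
    have "(bump j :: real^'a \<Rightarrow> real) differentiable_on UNIV" by (simp add: differentiable_on_def pderivative_bump(1))
    then show ?case by (simp add: differentiable_imp_continuous_on)
  next
    case (Suc k)
    have c: "Ck k (\<lambda>x::real^'a. c * x $ i)" "Ck k (\<lambda>x::real^'a. c)" for c i
      using smooth_cmult[OF smooth_coordinate, of c i] smooth_const[where c=c and 'a='a]
      by (auto simp: smooth_def)
    have "Ck k (\<lambda>x. - 2 * x $ i * (- real j * bump (j + 1) x + bump (j + 2) x))" for i :: 'a
      by (intro Ck_mult Ck_add c Suc)
    moreover have "pderivative i (bump j) = (\<lambda>x. - 2 * x $ i * (- real j * bump (j + 1) x + bump (j + 2) x))" for i :: 'a
      by (rule ext) (rule pderivative_bump(2))
    ultimately show ?case by (intro Ck_SucI) (auto intro: pderivative_bump(1))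
  qed
  then show ?thesis by (simp add: smooth_def)
qed

section \<open>Test functions\<close>

lemma compact_support_bound:
  fixes f :: "'a::euclidean_space \<Rightarrow> 'b::zero"
  shows "compact_support f \<longleftrightarrow> (\<exists>R>0. \<forall>x. R < norm x \<longrightarrow> f x = 0)"
proof
  assume "compact_support f"
  then obtain R where "0 < R" "\<forall>x\<in>closure {x. f x \<noteq> 0}. norm x \<le> R"
    unfolding compact_support_def using compact_imp_bounded bounded_pos by blast
  then show "\<exists>R>0. \<forall>x. R < norm x \<longrightarrow> f x = 0"
    by (metis (mono_tags, lifting) closure_subset mem_Collect_eq not_less subsetD)
next
  assume "\<exists>R>0. \<forall>x. R < norm x \<longrightarrow> f x = 0"
  then obtain R where R: "\<forall>x. R < norm x \<longrightarrow> f x = 0" by blast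
  then have "{x. f x \<noteq> 0} \<subseteq> cball 0 R" by (auto simp: not_less[symmetric])
  then have "bounded {x. f x \<noteq> 0}" using bounded_cball bounded_subset by blast
  then show "compact_support f" unfolding compact_support_def by (simp add: compact_closure)
qed

lemma C0_infinityI:
  assumes "smooth f" "\<And>x. R < norm x \<Longrightarrow> f x = 0"
  shows "f \<in> C0_infinity"
proof -
  have "\<exists>R>0. \<forall>x. R < norm x \<longrightarrow> f x = 0"
    by (rule exI[of _ "\<bar>R\<bar> + 1"]) (use assms(2) in auto)
  then show ?thesis using assms(1) by (simp add: C0_infinity_def compact_support_bound)
qed

lemma C0_infinityE:
  assumes "f \<in> C0_infinity"
  obtains R where "0 < R" "\<And>x. R < norm x \<Longrightarrow> f x = 0"
  using assms unfolding C0_infinity_def compact_support_bound by auto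

lemma C0_infinity_smooth: "f \<in> C0_infinity \<Longrightarrow> smooth f"
  by (simp add: C0_infinity_def)

lemma pderivative_zero_on_open:
  fixes f :: "real^'n::finite \<Rightarrow> real"
  assumes "open S" "\<And>x. x \<in> S \<Longrightarrow> f x = 0" "x \<in> S"
  shows "pderivative i f x = 0"
proof -
  have "((\<lambda>x. 0) has_derivative (\<lambda>v. 0)) (at x)" by simp
  then have "(f has_derivative (\<lambda>v. 0)) (at x)"
    by (rule has_derivative_transform_within_open[OF _ assms(1,3)]) (use assms(2) in auto)
  then show ?thesis using pderivative_eqI by blast
qed

lemma pderivative_local_zero:
  fixes f :: "real^'n::finite \<Rightarrow> real"
  assumes "\<And>x. R < norm x \<Longrightarrow> f x = 0" "R < norm x"
  shows "pderivative i f x = 0"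
  by (rule pderivative_zero_on_open[of "{x. R < norm x}"])
    (use assms in \<open>auto intro!: open_Collect_less continuous_intros\<close>)

lemma C0_infinity_pderivative:
  assumes "f \<in> C0_infinity" shows "pderivative i f \<in> C0_infinity"
  using assms
proof (rule C0_infinityE)
  fix R assume "\<And>x. R < norm x \<Longrightarrow> f x = 0"
  then have "pderivative i f x = 0" if "R < norm x" for x
    using that by (rule pderivative_local_zero)
  then show ?thesis
    by (intro C0_infinityI[of "pderivative i f" R] smooth_pderivative[OF C0_infinity_smooth[OF assms]])
qed

lemma C0_infinity_iterated: "f \<in> C0_infinity \<Longrightarrow> iterated_pderivative \<alpha> f \<in> C0_infinity"
  by (induction \<alpha>) (auto intro: C0_infinity_pderivative)

lemma C0_infinity_mult:
  assumes "smooth f" "g \<in> C0_infinity" shows "(\<lambda>x. f x * g x) \<in> C0_infinity"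
  using assms(2)
proof (rule C0_infinityE)
  fix R assume "\<And>x. R < norm x \<Longrightarrow> g x = 0"
  then have "f x * g x = 0" if "R < norm x" for x using that by simp
  then show ?thesis
    by (intro C0_infinityI[of "\<lambda>x. f x * g x" R] smooth_mult[OF assms(1) C0_infinity_smooth[OF assms(2)]])
qed

lemma C0_infinity_mult':
  assumes "g \<in> C0_infinity" "smooth f" shows "(\<lambda>x. g x * f x) \<in> C0_infinity"
  using C0_infinity_mult[OF assms(2,1)] by (simp add: mult.commute)

lemma C0_infinity_zero: "(\<lambda>x. 0) \<in> C0_infinity"
  by (rule C0_infinityI) (auto intro: smooth_const)

lemma C0_infinity_add:
  assumes "f \<in> C0_infinity" "g \<in> C0_infinity" shows "(\<lambda>x. f x + g x) \<in> C0_infinity"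
proof -
  obtain R S where "\<And>x. R < norm x \<Longrightarrow> f x = 0" "\<And>x. S < norm x \<Longrightarrow> g x = 0"
    using assms C0_infinityE by metis
  then have "f x + g x = 0" if "max R S < norm x" for x using that by simp
  then show ?thesis
    by (intro C0_infinityI[of "\<lambda>x. f x + g x" "max R S"] smooth_add[OF assms[THEN C0_infinity_smooth]])
qed

lemma C0_infinity_sum:
  "(\<And>i. i \<in> I \<Longrightarrow> f i \<in> C0_infinity) \<Longrightarrow> (\<lambda>x. \<Sum>i\<in>I. f i x) \<in> C0_infinity"
  by (induction I rule: infinite_finite_induct) (auto intro: C0_infinity_zero C0_infinity_add)

lemma C0_infinity_affine:
  fixes f :: "real^'n::finite \<Rightarrow> real"
  assumes "f \<in> C0_infinity" "c \<noteq> 0" shows "(\<lambda>x. f (a + c *\<^sub>R x)) \<in> C0_infinity"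
proof -
  obtain R where R: "\<And>x. R < norm x \<Longrightarrow> f x = 0" using assms C0_infinityE by metis
  show ?thesis
  proof (rule C0_infinityI[where R="(R + norm a) / \<bar>c\<bar>"])
    fix x :: "real^'n" assume "(R + norm a) / \<bar>c\<bar> < norm x"
    then have "R + norm a < norm (c *\<^sub>R x)" using assms(2) by (simp add: field_simps)
    also have "norm (c *\<^sub>R x) \<le> norm (a + c *\<^sub>R x) + norm a"
      by (metis add.commute norm_add_leD norm_minus_cancel order_refl uminus_add_conv_diff add_diff_cancel_left' norm_triangle_ineq4)
    finally show "f (a + c *\<^sub>R x) = 0" by (intro R) simp
  qed (intro smooth_affine C0_infinity_smooth assms)
qed

lemma bump_C0_infinity: "bump j \<in> C0_infinity"
  by (rule C0_infinityI[where R=1]) (auto intro: smooth_bump bump_eq_0)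

lemma laplacian_smooth: "smooth f \<Longrightarrow> smooth (laplacian f)"
  unfolding laplacian_def[abs_def] by (intro smooth_sum smooth_pderivative)

lemma laplacian_C0_infinity: "f \<in> C0_infinity \<Longrightarrow> laplacian f \<in> C0_infinity"
  unfolding laplacian_def[abs_def] by (intro C0_infinity_sum C0_infinity_pderivative)

lemma bounded_if_continuous_compact_support:
  fixes f :: "real^'n::finite \<Rightarrow> real"
  assumes "continuous_on UNIV f" "\<And>x. R < norm x \<Longrightarrow> f x = 0"
  obtains B where "0 < B" "\<And>x. \<bar>f x\<bar> \<le> B"
proof -
  have "compact (f ` cball 0 R)"
    by (intro compact_continuous_image continuous_on_subset[OF assms(1)]) auto
  then obtain B where B: "0 < B" "\<forall>y\<in>f ` cball 0 R. norm y \<le> B"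
    using compact_imp_bounded bounded_pos by blast
  have "\<bar>f x\<bar> \<le> B" for x
    using assms(2)[of x] B by (cases "R < norm x") auto
  then show ?thesis using that B(1) by blast
qed

lemma C0_infinity_bounded:
  assumes "f \<in> C0_infinity"
  obtains B where "0 < B" "\<And>x. \<bar>f x\<bar> \<le> B"
  by (metis assms C0_infinityE C0_infinity_smooth bounded_if_continuous_compact_support smooth_continuous)

lemma integrable_continuous_compact_support:
  fixes f :: "real^'n::finite \<Rightarrow> real"
  assumes "continuous_on UNIV f" "\<And>x. R < norm x \<Longrightarrow> f x = 0"
  shows "integrable lborel f"
proof -
  have "integrable lborel (\<lambda>x. indicator (cball 0 R) x *\<^sub>R f x)"
    by (rule borel_integrable_compact) (auto intro: continuous_on_subset[OF assms(1)])
  moreover have "(\<lambda>x. indicator (cball 0 R) x *\<^sub>R f x) = f"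
    using assms(2) by (auto simp: indicator_def fun_eq_iff not_le[symmetric])
  ultimately show ?thesis by simp
qed

lemma C0_infinity_integrable:
  assumes "f \<in> C0_infinity" shows "integrable lborel f"
  by (metis assms C0_infinityE C0_infinity_smooth integrable_continuous_compact_support smooth_continuous)

section \<open>Integration by parts\<close>

lemma lborel_integral_affine:
  fixes f :: "real^'n::finite \<Rightarrow> real"
  assumes "f \<in> borel_measurable borel" "c \<noteq> 0"
  shows "(LINT x|lborel. f x) = \<bar>c\<bar> ^ CARD('n) * (LINT x|lborel. f (t + c *\<^sub>R x))"
proof -
  have "(LINT x|lborel. f x) = (LINT x|density (distr lborel borel (\<lambda>x. t + c *\<^sub>R x)) (\<lambda>_. ennreal (\<bar>c\<bar> ^ CARD('n))). f x)"
    using lborel_affine[OF assms(2), where t=t] by (simp add: DIM_cart)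
  also have "\<dots> = (LINT x|distr lborel borel (\<lambda>x. t + c *\<^sub>R x). \<bar>c\<bar> ^ CARD('n) * f x)"
    using assms(1) by (subst integral_density) auto
  also have "\<dots> = (LINT x|lborel. \<bar>c\<bar> ^ CARD('n) * f (t + c *\<^sub>R x))"
    using assms(1) by (subst integral_distr) auto
  finally show ?thesis by simp
qed

text \<open>Translation invariance of the measure makes the integrals of all difference quotients vanish, and the
  difference quotients converge dominatedly to the derivative.\<close>

lemma integral_pderivative_zero:
  fixes f :: "real^'n::finite \<Rightarrow> real"
  assumes f: "Ck (Suc 0) f" and R: "\<And>x. R < norm x \<Longrightarrow> f x = 0"
  shows "(LINT x|lborel. pderivative i f x) = 0"
proof -
  let ?e = "axis i 1 :: real^'n"
  have cf: "continuous_on UNIV f" by (rule Ck_continuous[OF f])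
  have cp: "continuous_on UNIV (pderivative i f)" using f by simp
  obtain B where B: "0 < B" "\<And>x. \<bar>pderivative i f x\<bar> \<le> B"
  proof (rule bounded_if_continuous_compact_support[OF cp])
    show "pderivative i f x = 0" if "R < norm x" for x using R that by (rule pderivative_local_zero)
  qed blast
  have der: "((\<lambda>t. f (x + t *\<^sub>R ?e)) has_real_derivative pderivative i f (x + t *\<^sub>R ?e)) (at t)" for x t
    using derivative_along_line[OF Ck_differentiable[OF f], where x=x and v="?e" and t=t] by (simp add: sum_axis_mult)
  define g where "g n x = (f (x + (1 / real (Suc n)) *\<^sub>R ?e) - f x) / (1 / real (Suc n))" for n x
  have mf [measurable]: "f \<in> borel_measurable borel" by (rule borel_measurable_continuous_onI[OF cf])
  have mp [measurable]: "pderivative i f \<in> borel_measurable borel"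
    by (rule borel_measurable_continuous_onI[OF cp])
  have "(\<lambda>n. LINT x|lborel. g n x) \<longlonglongrightarrow> (LINT x|lborel. pderivative i f x)"
  proof (rule integral_dominated_convergence[where w="\<lambda>x. B * indicator (cball 0 (R + 1)) x"])
    show "integrable lborel (\<lambda>x::real^'n. B * indicator (cball 0 (R + 1)) x)"
      using emeasure_bounded_finite[OF bounded_cball, of "0 :: real^'n" "R + 1"]
      by (intro integrable_mult_right integrable_real_indicator) (auto simp: infinity_ennreal_def)
    show "g n \<in> borel_measurable lborel" for n unfolding g_def by measurable
    show "AE x in lborel. (\<lambda>n. g n x) \<longlonglongrightarrow> pderivative i f x"
    proof (intro AE_I2)
      fix x
      have "((\<lambda>h. (f (x + h *\<^sub>R ?e) - f x) / h) \<longlongrightarrow> pderivative i f x) (at 0)"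
        using der[of x 0] by (simp add: DERIV_def)
      moreover have "filterlim (\<lambda>n. 1 / real (Suc n)) (at 0) sequentially"
        unfolding filterlim_at by (intro conjI LIMSEQ_Suc[OF lim_1_over_n]) simp
      ultimately show "(\<lambda>n. g n x) \<longlonglongrightarrow> pderivative i f x"
        unfolding g_def by (rule filterlim_compose)
    qed
    show "AE x in lborel. norm (g n x) \<le> B * indicator (cball 0 (R + 1)) x" for n
    proof (intro AE_I2)
      fix x
      define h where "h = 1 / real (Suc n)"
      have h: "0 < h" "h \<le> 1" by (auto simp: h_def)
      have gx: "g n x = (f (x + h *\<^sub>R ?e) - f x) / h" by (simp only: g_def h_def)
      obtain z where "f (x + h *\<^sub>R ?e) - f (x + 0 *\<^sub>R ?e) = (h - 0) * pderivative i f (x + z *\<^sub>R ?e)"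
        using MVT2[OF h(1) der] by blast
      then have le: "\<bar>g n x\<bar> \<le> B"
        using h(1) B(2) by (simp add: gx)
      show "norm (g n x) \<le> B * indicator (cball 0 (R + 1)) x"
      proof (cases "norm x \<le> R + 1")
        case False
        have "norm x \<le> norm (x + h *\<^sub>R ?e) + norm (h *\<^sub>R ?e)"
          by (metis add_diff_cancel norm_triangle_ineq4)
        then have "R < norm (x + h *\<^sub>R ?e)" using False h by simp
        then show ?thesis using False R by (simp add: gx)
      qed (use le in simp)
    qed
  qed auto
  moreover have "(LINT x|lborel. g n x) = 0" for n
  proof -
    let ?t = "(1 / real (Suc n)) *\<^sub>R ?e"
    have i1: "integrable lborel f" by (rule integrable_continuous_compact_support[OF cf R])
    have i2: "integrable lborel (\<lambda>x. f (x + ?t))"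
    proof (rule integrable_continuous_compact_support)
      show "continuous_on UNIV (\<lambda>x. f (x + ?t))"
        by (rule continuous_on_compose2[OF cf]) (auto intro!: continuous_intros)
      fix x :: "real^'n" assume "R + norm ?t < norm x"
      moreover have "norm x \<le> norm (x + ?t) + norm ?t" by (metis add_diff_cancel norm_triangle_ineq4)
      ultimately show "f (x + ?t) = 0" by (intro R) linarith
    qed
    have "(LINT x|lborel. f (x + ?t)) = (LINT x|lborel. f x)"
      using lborel_integral_affine[OF mf, of 1 ?t] by (simp add: add.commute)
    then show ?thesis unfolding g_def using i1 i2 by simp
  qed
  ultimately show ?thesis by (simp add: LIMSEQ_const_iff)
qed

lemma integral_by_parts:
  fixes f g :: "real^'n::finite \<Rightarrow> real"
  assumes f: "smooth f" and g: "g \<in> C0_infinity"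
  shows "(LINT x|lborel. f x * pderivative i g x) = - (LINT x|lborel. pderivative i f x * g x)"
proof -
  have "pderivative i (\<lambda>x. f x * g x) = (\<lambda>x. f x * pderivative i g x + pderivative i f x * g x)"
    by (intro ext pderivative_mult smooth_differentiable[OF f]
        smooth_differentiable[OF C0_infinity_smooth[OF g]])
  moreover have "(LINT x|lborel. pderivative i (\<lambda>x. f x * g x) x) = 0"
  proof -
    have fg: "(\<lambda>x. f x * g x) \<in> C0_infinity" by (rule C0_infinity_mult[OF f g])
    obtain R where "\<And>x. R < norm x \<Longrightarrow> f x * g x = 0" using fg by (rule C0_infinityE) blast
    moreover have "Ck (Suc 0) (\<lambda>x. f x * g x)" using C0_infinity_smooth[OF fg] by (simp only: smooth_def)
    ultimately show ?thesis by (intro integral_pderivative_zero)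
  qed
  moreover have "integrable lborel (\<lambda>x. f x * pderivative i g x)"
    by (rule C0_infinity_integrable, rule C0_infinity_mult[OF f C0_infinity_pderivative[OF g]])
  moreover have "integrable lborel (\<lambda>x. pderivative i f x * g x)"
    by (rule C0_infinity_integrable, rule C0_infinity_mult[OF smooth_pderivative[OF f] g])
  ultimately show ?thesis by simp
qed

lemma integral_by_parts_twice:
  fixes f g :: "real^'n::finite \<Rightarrow> real"
  assumes f: "smooth f" and g: "g \<in> C0_infinity"
  shows "(LINT x|lborel. f x * pderivative i (pderivative j g) x)
    = (LINT x|lborel. pderivative j (pderivative i f) x * g x)"
  using integral_by_parts[OF f C0_infinity_pderivative[OF g], of i j]
    integral_by_parts[OF smooth_pderivative[OF f, of i] g, of j] by simp

lemma laplacian_symmetric: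
  fixes f g :: "real^'n::finite \<Rightarrow> real"
  assumes f: "smooth f" and g: "g \<in> C0_infinity"
  shows "(LINT x|lborel. f x * laplacian g x) = (LINT x|lborel. laplacian f x * g x)"
proof -
  have "integrable lborel (\<lambda>x. f x * pderivative i (pderivative i g) x)"
    "integrable lborel (\<lambda>x. pderivative i (pderivative i f) x * g x)" for i
    by (rule C0_infinity_integrable, rule C0_infinity_mult,
        intro smooth_pderivative f, intro C0_infinity_pderivative g)+
  then show ?thesis
    unfolding laplacian_def sum_distrib_left sum_distrib_right
    using integral_by_parts_twice[OF f g] by simp
qed

section \<open>Integrals against bounded continuous functions\<close>

lemma integrable_mult_bounded_continuous:
  fixes G h :: "real^'n::finite \<Rightarrow> real"
  assumes G: "integrable lebesgue G" and h: "continuous_on UNIV h" "\<And>x. \<bar>h x\<bar> \<le> B"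
  shows "integrable lebesgue (\<lambda>x. G x * h x)"
proof (rule Bochner_Integration.integrable_bound)
  show "integrable lebesgue (\<lambda>x. B * G x)" using G by simp
  have "h \<in> borel_measurable lebesgue"
    using borel_measurable_continuous_onI[OF h(1)] by (intro measurable_completion) simp
  then show "(\<lambda>x. G x * h x) \<in> borel_measurable lebesgue"
    using G by (intro borel_measurable_times) auto
  show "AE x in lebesgue. norm (G x * h x) \<le> norm (B * G x)"
  proof (intro AE_I2)
    fix x
    have "\<bar>G x\<bar> * \<bar>h x\<bar> \<le> \<bar>G x\<bar> * \<bar>B\<bar>" using h(2)[of x] by (intro mult_left_mono) auto
    then show "norm (G x * h x) \<le> norm (B * G x)" by (simp add: abs_mult mult.commute)
  qed
qed

lemma integral_mult_bounded_le:
  fixes G h :: "real^'n::finite \<Rightarrow> real"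
  assumes G: "integrable lebesgue G" and h: "continuous_on UNIV h" "\<And>x. \<bar>h x\<bar> \<le> B"
  shows "\<bar>LINT x|lebesgue. G x * h x\<bar> \<le> B * (LINT x|lebesgue. \<bar>G x\<bar>)"
proof -
  have "norm (G x * h x) \<le> B * \<bar>G x\<bar>" for x
    using mult_right_mono[OF h(2)[of x], of "\<bar>G x\<bar>"] by (simp add: abs_mult mult.commute)
  from Bochner_Integration.integral_norm_bound_integral[OF integrable_mult_bounded_continuous[OF assms] _ this]
  show ?thesis using G by simp
qed

lemma integral_dilation_limit:
  fixes G h :: "real^'n::finite \<Rightarrow> real"
  assumes G: "integrable lebesgue G" and h: "continuous_on UNIV h" "\<And>x. \<bar>h x\<bar> \<le> B" and c: "c \<longlonglongrightarrow> 0"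
  shows "(\<lambda>n. LINT x|lebesgue. G x * h (y + c n *\<^sub>R x)) \<longlonglongrightarrow> (LINT x|lebesgue. G x) * h y"
proof -
  have "(\<lambda>n. LINT x|lebesgue. G x * h (y + c n *\<^sub>R x)) \<longlonglongrightarrow> (LINT x|lebesgue. G x * h y)"
  proof (rule integral_dominated_convergence[where w="\<lambda>x. B * \<bar>G x\<bar>"])
    show "integrable lebesgue (\<lambda>x. B * \<bar>G x\<bar>)" "(\<lambda>x. G x * h y) \<in> borel_measurable lebesgue"
      using G by auto
    have "continuous_on UNIV (\<lambda>x. h (y + c n *\<^sub>R x))" for n
      by (rule continuous_on_compose2[OF h(1)]) (auto intro!: continuous_intros)
    then show "(\<lambda>x. G x * h (y + c n *\<^sub>R x)) \<in> borel_measurable lebesgue" for n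
      by (rule borel_measurable_integrable[OF integrable_mult_bounded_continuous[OF G _ h(2)]])
    show "AE x in lebesgue. (\<lambda>n. G x * h (y + c n *\<^sub>R x)) \<longlonglongrightarrow> G x * h y"
    proof (intro AE_I2 tendsto_intros)
      fix x
      have "(\<lambda>n. y + c n *\<^sub>R x) \<longlonglongrightarrow> y + 0 *\<^sub>R x" by (intro tendsto_intros c)
      then show "(\<lambda>n. h (y + c n *\<^sub>R x)) \<longlonglongrightarrow> h y"
        using continuous_on_tendsto_compose[OF h(1)] by simp
    qed
    show "AE x in lebesgue. norm (G x * h (y + c n *\<^sub>R x)) \<le> B * \<bar>G x\<bar>" for n
    proof (intro AE_I2)
      fix x
      show "norm (G x * h (y + c n *\<^sub>R x)) \<le> B * \<bar>G x\<bar>"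
        using mult_right_mono[OF h(2), of "\<bar>G x\<bar>"] by (simp add: abs_mult mult.commute)
    qed
  qed
  then show ?thesis by simp
qed

lemma LIMSEQ_inverse_Suc: "(\<lambda>n. 1 / real (Suc n)) \<longlonglongrightarrow> 0"
  by (rule LIMSEQ_Suc[OF lim_1_over_n])

section \<open>Schwartz functions\<close>

lemma schwartz_smooth: "\<psi> \<in> schwartz \<Longrightarrow> smooth \<psi>"
  by (simp add: schwartz_def)

lemma schwartz_bound:
  assumes "\<psi> \<in> schwartz"
  obtains C where "0 < C" "\<And>x. norm x ^ k * \<bar>iterated_pderivative \<alpha> \<psi> x\<bar> \<le> C"
proof -
  have "\<exists>C. \<forall>x. norm x ^ k * \<bar>iterated_pderivative \<alpha> \<psi> x\<bar> \<le> C"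
    using assms unfolding schwartz_def bdd_above_def by auto
  then obtain C where C: "\<And>x. norm x ^ k * \<bar>iterated_pderivative \<alpha> \<psi> x\<bar> \<le> C" by blast
  have "norm x ^ k * \<bar>iterated_pderivative \<alpha> \<psi> x\<bar> \<le> max C 1" for x using C[of x] by simp
  then show ?thesis by (rule that[rotated]) simp
qed

lemma schwartzI:
  assumes "smooth \<psi>" "\<And>k \<alpha>. \<exists>C. \<forall>x. norm x ^ k * \<bar>iterated_pderivative \<alpha> \<psi> x\<bar> \<le> C"
  shows "\<psi> \<in> schwartz"
  using assms unfolding schwartz_def bdd_above_def by auto

lemma schwartz_bounded:
  assumes "\<psi> \<in> schwartz"
  obtains C where "0 < C" "\<And>x. \<bar>\<psi> x\<bar> \<le> C"
  using schwartz_bound[OF assms, of 0 "[]"] by auto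

lemma schwartz_pderivative: "\<psi> \<in> schwartz \<Longrightarrow> pderivative i \<psi> \<in> schwartz"
proof (rule schwartzI)
  fix k \<alpha> assume \<psi>: "\<psi> \<in> schwartz"
  show "\<exists>C. \<forall>x. norm x ^ k * \<bar>iterated_pderivative \<alpha> (pderivative i \<psi>) x\<bar> \<le> C"
    unfolding iterated_pderivative_snoc[symmetric] using schwartz_bound[OF \<psi>] by metis
qed (auto intro: smooth_pderivative schwartz_smooth)

lemma schwartz_iterated: "\<psi> \<in> schwartz \<Longrightarrow> iterated_pderivative \<alpha> \<psi> \<in> schwartz"
  by (induction \<alpha>) (auto intro: schwartz_pderivative)

lemma C0_infinity_schwartz:
  assumes f: "f \<in> C0_infinity" shows "f \<in> schwartz"
proof (rule schwartzI)
  fix k \<alpha>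
  let ?g = "iterated_pderivative \<alpha> f"
  obtain R where R: "0 < R" "\<And>x. R < norm x \<Longrightarrow> ?g x = 0"
    using C0_infinity_iterated[OF f] by (rule C0_infinityE) blast
  obtain B where B: "0 < B" "\<And>x. \<bar>?g x\<bar> \<le> B"
    using C0_infinity_iterated[OF f] by (rule C0_infinity_bounded) blast
  have "norm x ^ k * \<bar>?g x\<bar> \<le> R ^ k * B" for x
    using R B(1) B(2)[of x] by (cases "R < norm x") (auto intro!: mult_mono power_mono)
  then show "\<exists>C. \<forall>x. norm x ^ k * \<bar>?g x\<bar> \<le> C" by blast
qed (rule C0_infinity_smooth[OF f])

lemma schwartz_add:
  assumes "\<psi> \<in> schwartz" "\<eta> \<in> schwartz" shows "(\<lambda>x. \<psi> x + \<eta> x) \<in> schwartz"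
proof (rule schwartzI)
  fix k \<alpha>
  obtain C where C: "\<And>x. norm x ^ k * \<bar>iterated_pderivative \<alpha> \<psi> x\<bar> \<le> C"
    using schwartz_bound[OF assms(1)] by blast
  obtain D where D: "\<And>x. norm x ^ k * \<bar>iterated_pderivative \<alpha> \<eta> x\<bar> \<le> D"
    using schwartz_bound[OF assms(2)] by blast
  have "norm x ^ k * \<bar>iterated_pderivative \<alpha> \<psi> x + iterated_pderivative \<alpha> \<eta> x\<bar> \<le> C + D" for x
  proof -
    have "norm x ^ k * \<bar>iterated_pderivative \<alpha> \<psi> x + iterated_pderivative \<alpha> \<eta> x\<bar>
      \<le> norm x ^ k * (\<bar>iterated_pderivative \<alpha> \<psi> x\<bar> + \<bar>iterated_pderivative \<alpha> \<eta> x\<bar>)"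
      by (intro mult_left_mono abs_triangle_ineq) simp
    then show ?thesis using C[of x] D[of x] by (simp add: distrib_left)
  qed
  then show "\<exists>C. \<forall>x. norm x ^ k * \<bar>iterated_pderivative \<alpha> (\<lambda>x. \<psi> x + \<eta> x) x\<bar> \<le> C"
    by (auto simp: iterated_pderivative_add schwartz_smooth assms)
qed (intro smooth_add schwartz_smooth assms)

lemma schwartz_cmult:
  assumes "\<psi> \<in> schwartz" shows "(\<lambda>x. c * \<psi> x) \<in> schwartz"
proof (rule schwartzI)
  fix k \<alpha>
  obtain C where C: "\<And>x. norm x ^ k * \<bar>iterated_pderivative \<alpha> \<psi> x\<bar> \<le> C"
    using schwartz_bound[OF assms(1)] by blast
  have "norm x ^ k * \<bar>c * iterated_pderivative \<alpha> \<psi> x\<bar> \<le> \<bar>c\<bar> * C" for x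
    using mult_left_mono[OF C[of x], of "\<bar>c\<bar>"] by (simp add: abs_mult mult_ac)
  then show "\<exists>C. \<forall>x. norm x ^ k * \<bar>iterated_pderivative \<alpha> (\<lambda>x. c * \<psi> x) x\<bar> \<le> C"
    by (auto simp: iterated_pderivative_cmult schwartz_smooth assms)
qed (intro smooth_cmult schwartz_smooth assms)

lemma schwartz_diff:
  assumes "\<psi> \<in> schwartz" "\<eta> \<in> schwartz" shows "(\<lambda>x. \<psi> x - \<eta> x) \<in> schwartz"
  using schwartz_add[OF assms(1) schwartz_cmult[OF assms(2), of "-1"]] by simp

lemma schwartz_zero: "(\<lambda>x. 0) \<in> schwartz"
  by (rule schwartzI) (auto intro: smooth_const)

lemma schwartz_sum:
  "(\<And>i. i \<in> I \<Longrightarrow> f i \<in> schwartz) \<Longrightarrow> (\<lambda>x. \<Sum>i\<in>I. f i x) \<in> schwartz"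
  by (induction I rule: infinite_finite_induct) (auto intro: schwartz_zero schwartz_add)

lemma laplacian_schwartz: "\<psi> \<in> schwartz \<Longrightarrow> laplacian \<psi> \<in> schwartz"
  unfolding laplacian_def[abs_def] by (intro schwartz_sum schwartz_pderivative)

lemma power_le_power_sum:
  fixes a b c :: real
  assumes "0 \<le> a" "a \<le> b + c" "0 \<le> b" "0 \<le> c"
  shows "a ^ k \<le> 2 ^ k * b ^ k + 2 ^ k * c ^ k"
proof (cases "b \<le> c")
  case True
  then have "a ^ k \<le> (2 * c) ^ k" using assms by (intro power_mono) auto
  then show ?thesis using assms by (simp add: power_mult_distrib add_increasing)
next
  case False
  then have "a ^ k \<le> (2 * b) ^ k" using assms by (intro power_mono) auto
  then show ?thesis using assms by (simp add: power_mult_distrib add_increasing2)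
qed

text \<open>After a translation or dilation the weight and the derivative are evaluated at different points;
  the decay survives as long as the two points have comparable norms.\<close>

lemma schwartz_weighted_bound:
  fixes \<psi> :: "real^'n::finite \<Rightarrow> real"
  assumes \<psi>: "\<psi> \<in> schwartz" and "0 \<le> L" "0 \<le> M"
  shows "\<exists>C>0. \<forall>(x::real^'n) w. norm x \<le> L * norm w + M
    \<longrightarrow> norm x ^ k * \<bar>iterated_pderivative \<alpha> \<psi> w\<bar> \<le> C"
proof -
  let ?g = "iterated_pderivative \<alpha> \<psi>"
  obtain C where C: "0 < C" "\<And>x. norm x ^ k * \<bar>?g x\<bar> \<le> C" using schwartz_bound[OF \<psi>] by blast
  obtain D where D: "0 < D" "\<And>x. norm x ^ 0 * \<bar>?g x\<bar> \<le> D" using schwartz_bound[OF \<psi>] by blast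
  show ?thesis
  proof (intro exI conjI allI impI)
    show "0 < 2 ^ k * L ^ k * C + 2 ^ k * M ^ k * D + 1"
      using C D assms by (intro add_nonneg_pos add_nonneg_nonneg) auto
    fix x w :: "real^'n" assume "norm x \<le> L * norm w + M"
    then have "norm x ^ k \<le> 2 ^ k * (L * norm w) ^ k + 2 ^ k * M ^ k"
      using assms by (intro power_le_power_sum) auto
    then have "norm x ^ k * \<bar>?g w\<bar> \<le> (2 ^ k * (L * norm w) ^ k + 2 ^ k * M ^ k) * \<bar>?g w\<bar>"
      by (rule mult_right_mono) simp
    also have "\<dots> = 2 ^ k * L ^ k * (norm w ^ k * \<bar>?g w\<bar>) + 2 ^ k * M ^ k * (norm w ^ 0 * \<bar>?g w\<bar>)"
      by (simp add: power_mult_distrib algebra_simps)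
    also have "\<dots> \<le> 2 ^ k * L ^ k * C + 2 ^ k * M ^ k * D"
      using C D assms by (intro add_mono mult_left_mono) auto
    finally show "norm x ^ k * \<bar>?g w\<bar> \<le> 2 ^ k * L ^ k * C + 2 ^ k * M ^ k * D + 1" by simp
  qed
qed

lemma norm_le_affine:
  fixes a x :: "'a::real_normed_vector"
  assumes "c \<noteq> 0"
  shows "norm x \<le> (1 / \<bar>c\<bar>) * norm (a + c *\<^sub>R x) + norm a / \<bar>c\<bar>"
proof -
  have "norm (c *\<^sub>R x) \<le> norm (a + c *\<^sub>R x) + norm a"
    by (metis add_diff_cancel_left' norm_triangle_ineq4)
  then show ?thesis using assms by (simp add: field_simps)
qed

lemma schwartz_affine:
  fixes \<psi> :: "real^'n::finite \<Rightarrow> real"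
  assumes \<psi>: "\<psi> \<in> schwartz" and c: "c \<noteq> 0"
  shows "(\<lambda>x. \<psi> (a + c *\<^sub>R x)) \<in> schwartz"
proof (rule schwartzI)
  fix k \<alpha>
  let ?g = "iterated_pderivative \<alpha> \<psi>"
  have nn: "0 \<le> 1 / \<bar>c\<bar>" "0 \<le> norm a / \<bar>c\<bar>" by auto
  obtain C where C: "\<And>(x::real^'n) w. norm x \<le> (1 / \<bar>c\<bar>) * norm w + norm a / \<bar>c\<bar>
      \<Longrightarrow> norm x ^ k * \<bar>?g w\<bar> \<le> C"
    using schwartz_weighted_bound[OF \<psi> nn, of k \<alpha>] by blast
  have "norm x ^ k * \<bar>c ^ length \<alpha> * ?g (a + c *\<^sub>R x)\<bar> \<le> \<bar>c\<bar> ^ length \<alpha> * C" for x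
    using mult_left_mono[OF C[OF norm_le_affine[OF c, of x a]], of "\<bar>c\<bar> ^ length \<alpha>"]
    by (simp add: abs_mult power_abs mult_ac)
  then show "\<exists>C. \<forall>x. norm x ^ k * \<bar>iterated_pderivative \<alpha> (\<lambda>x. \<psi> (a + c *\<^sub>R x)) x\<bar> \<le> C"
    by (auto simp: iterated_pderivative_affine schwartz_smooth \<psi>)
qed (intro smooth_affine schwartz_smooth \<psi>)

section \<open>Null sequences of Schwartz functions and tempered functionals\<close>

text \<open>Convergence to zero in every Schwartz seminorm, expressed by pointwise bounds in order to avoid
  suprema.\<close>

definition schwartz_null :: "(nat \<Rightarrow> real^'n::finite \<Rightarrow> real) \<Rightarrow> bool" where
  "schwartz_null e \<longleftrightarrow> (\<forall>n. e n \<in> schwartz) \<and>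
     (\<forall>k \<alpha>. \<forall>\<epsilon>>0. \<forall>\<^sub>F n in sequentially. \<forall>x. norm x ^ k * \<bar>iterated_pderivative \<alpha> (e n) x\<bar> \<le> \<epsilon>)"

lemma schwartz_nullI:
  assumes "\<And>n. e n \<in> schwartz"
    and "\<And>k \<alpha>. \<exists>C. \<forall>\<^sub>F n in sequentially. \<forall>x. norm x ^ k * \<bar>iterated_pderivative \<alpha> (e n) x\<bar> \<le> C * a n"
    and "a \<longlonglongrightarrow> 0"
  shows "schwartz_null e"
  unfolding schwartz_null_def
proof (intro conjI allI impI assms(1))
  fix k \<alpha> and \<epsilon> :: real assume "0 < \<epsilon>"
  obtain C where C: "\<forall>\<^sub>F n in sequentially. \<forall>x. norm x ^ k * \<bar>iterated_pderivative \<alpha> (e n) x\<bar> \<le> C * a n"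
    using assms(2) by blast
  have "(\<lambda>n. C * a n) \<longlonglongrightarrow> C * 0" by (intro tendsto_intros assms(3))
  then have "\<forall>\<^sub>F n in sequentially. C * a n < \<epsilon>" using \<open>0 < \<epsilon>\<close> by (intro order_tendstoD) auto
  with C show "\<forall>\<^sub>F n in sequentially. \<forall>x. norm x ^ k * \<bar>iterated_pderivative \<alpha> (e n) x\<bar> \<le> \<epsilon>"
    by eventually_elim (meson order_trans less_imp_le)
qed

lemma schwartz_null_pderivative: "schwartz_null e \<Longrightarrow> schwartz_null (\<lambda>n. pderivative i (e n))"
  unfolding schwartz_null_def iterated_pderivative_snoc[symmetric]
  by (auto intro: schwartz_pderivative)

lemma schwartz_null_add:
  fixes e d :: "nat \<Rightarrow> real^'n::finite \<Rightarrow> real"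
  assumes "schwartz_null e" "schwartz_null d"
  shows "schwartz_null (\<lambda>n x. e n x + d n x)"
  unfolding schwartz_null_def
proof (intro conjI allI impI)
  fix k \<alpha> and \<epsilon> :: real assume "0 < \<epsilon>"
  then have "0 < \<epsilon> / 2" by simp
  then have "\<forall>\<^sub>F n in sequentially. \<forall>x. norm x ^ k * \<bar>iterated_pderivative \<alpha> (e n) x\<bar> \<le> \<epsilon> / 2"
    "\<forall>\<^sub>F n in sequentially. \<forall>x. norm x ^ k * \<bar>iterated_pderivative \<alpha> (d n) x\<bar> \<le> \<epsilon> / 2"
    using assms unfolding schwartz_null_def by blast+
  then show "\<forall>\<^sub>F n in sequentially. \<forall>x. norm x ^ k * \<bar>iterated_pderivative \<alpha> (\<lambda>x. e n x + d n x) x\<bar> \<le> \<epsilon>"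
  proof eventually_elim
    case (elim n)
    have sm: "smooth (e n)" "smooth (d n)" using assms by (auto simp: schwartz_null_def schwartz_smooth)
    show ?case
    proof
      fix x
      have "norm x ^ k * \<bar>iterated_pderivative \<alpha> (e n) x + iterated_pderivative \<alpha> (d n) x\<bar>
        \<le> norm x ^ k * (\<bar>iterated_pderivative \<alpha> (e n) x\<bar> + \<bar>iterated_pderivative \<alpha> (d n) x\<bar>)"
        by (intro mult_left_mono abs_triangle_ineq) simp
      also have "\<dots> \<le> \<epsilon>" using elim(1)[rule_format, of x] elim(2)[rule_format, of x]
        by (simp add: distrib_left)
      finally show "norm x ^ k * \<bar>iterated_pderivative \<alpha> (\<lambda>x. e n x + d n x) x\<bar> \<le> \<epsilon>"
        by (simp add: iterated_pderivative_add sm)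
    qed
  qed
qed (use assms in \<open>auto simp: schwartz_null_def intro: schwartz_add\<close>)

lemma schwartz_null_zero: "schwartz_null (\<lambda>n x. 0)"
  by (auto simp: schwartz_null_def schwartz_zero)

lemma schwartz_null_sum:
  "(\<And>i. i \<in> I \<Longrightarrow> schwartz_null (e i)) \<Longrightarrow> schwartz_null (\<lambda>n x. \<Sum>i\<in>I. e i n x)"
  by (induction I rule: infinite_finite_induct) (auto intro: schwartz_null_zero schwartz_null_add)

lemma schwartz_null_laplacian: "schwartz_null e \<Longrightarrow> schwartz_null (\<lambda>n. laplacian (e n))"
  unfolding laplacian_def[abs_def] by (intro schwartz_null_sum schwartz_null_pderivative)

lemma schwartz_null_scale:
  fixes e :: "nat \<Rightarrow> real^'n::finite \<Rightarrow> real"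
  assumes e: "schwartz_null e" and c: "c \<noteq> 0"
  shows "schwartz_null (\<lambda>n x. e n (c *\<^sub>R x))"
  unfolding schwartz_null_def
proof (intro conjI allI impI)
  show "(\<lambda>x. e n (c *\<^sub>R x)) \<in> schwartz" for n
    using schwartz_affine[OF _ c, of "e n" 0] e by (simp add: schwartz_null_def)
  fix k and \<alpha> :: "'n list" and \<epsilon> :: real assume "0 < \<epsilon>"
  define \<delta> where "\<delta> = \<epsilon> * \<bar>c\<bar> ^ k / \<bar>c\<bar> ^ length \<alpha>"
  have "0 < \<delta>" using \<open>0 < \<epsilon>\<close> c by (simp add: \<delta>_def)
  then have "\<forall>\<^sub>F n in sequentially. \<forall>x. norm x ^ k * \<bar>iterated_pderivative \<alpha> (e n) x\<bar> \<le> \<delta>"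
    using e unfolding schwartz_null_def by blast
  then show "\<forall>\<^sub>F n in sequentially. \<forall>x. norm x ^ k * \<bar>iterated_pderivative \<alpha> (\<lambda>x. e n (c *\<^sub>R x)) x\<bar> \<le> \<epsilon>"
  proof eventually_elim
    case (elim n)
    have sm: "smooth (e n)" using e by (auto simp: schwartz_null_def schwartz_smooth)
    show ?case
    proof
      fix x :: "real^'n"
      have "norm (c *\<^sub>R x) ^ k * \<bar>iterated_pderivative \<alpha> (e n) (c *\<^sub>R x)\<bar> \<le> \<delta>" using elim by blast
      then have "norm x ^ k * \<bar>c ^ length \<alpha> * iterated_pderivative \<alpha> (e n) (c *\<^sub>R x)\<bar> \<le> \<epsilon>"
        using c by (simp add: \<delta>_def abs_mult power_abs power_mult_distrib field_simps)
      then show "norm x ^ k * \<bar>iterated_pderivative \<alpha> (\<lambda>x. e n (c *\<^sub>R x)) x\<bar> \<le> \<epsilon>"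
        using iterated_pderivative_affine[OF sm, of \<alpha> 0 c] by simp
    qed
  qed
qed

text \<open>The form in which continuity for the Schwartz topology is used. It is visibly inherited by sums,
  by integrals against integrable functions, and by compositions with derivatives and dilations.\<close>

definition seq_tempered :: "'n::finite functional \<Rightarrow> bool" where
  "seq_tempered L \<longleftrightarrow>
     (\<forall>\<psi>\<in>schwartz. \<forall>\<eta>\<in>schwartz. L (\<lambda>x. \<psi> x + \<eta> x) = L \<psi> + L \<eta>) \<and>
     (\<forall>c. \<forall>\<psi>\<in>schwartz. L (\<lambda>x. c * \<psi> x) = c * L \<psi>) \<and>
     (\<forall>e. schwartz_null e \<longrightarrow> (\<lambda>n. L (e n)) \<longlonglongrightarrow> 0)"

text \<open>By induction over the generation of the topology from seminorm balls, every open set that contains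
  zero eventually contains each null sequence.\<close>

lemma tempered_seq_tempered:
  fixes f :: "'n::finite functional"
  assumes "f \<in> tempered" shows "seq_tempered f"
proof -
  have f: "\<forall>\<psi>\<in>schwartz. \<forall>\<eta>\<in>schwartz. f (\<lambda>x. \<psi> x + \<eta> x) = f \<psi> + f \<eta>"
    "\<forall>c. \<forall>\<psi>\<in>schwartz. f (\<lambda>x. c * \<psi> x) = c * f \<psi>"
    "continuous_map schwartz_topology euclideanreal f"
    using assms by (auto simp: tempered_def)
  have f0: "f (\<lambda>x. 0) = 0" using f(2)[rule_format, OF schwartz_zero, of 0] by simp
  have "(\<lambda>n. f (e n)) \<longlonglongrightarrow> 0" if e: "schwartz_null e" for e
  proof -
    let ?B = "{{\<eta> \<in> schwartz. schwartz_seminorm k \<alpha> (\<lambda>x. \<eta> x - \<psi> x) < r} | k (\<alpha> :: 'n list) \<psi> r. \<psi> \<in> schwartz \<and> 0 < r}"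
    have ev: "\<forall>\<^sub>F n in sequentially. e n \<in> U" if "generate_topology_on ?B U" "(\<lambda>x. 0) \<in> U" for U
      using that
    proof (induction rule: generate_topology_on.induct)
      case (Int a b) then show ?case by (auto intro: eventually_conj)
    next
      case (UN K)
      then obtain k where "k \<in> K" "(\<lambda>x. 0) \<in> k" by blast
      with UN have "\<forall>\<^sub>F n in sequentially. e n \<in> k" by blast
      then show ?case by eventually_elim (use \<open>k \<in> K\<close> in blast)
    next
      case (Basis s)
      then obtain k \<alpha> \<psi> r where s: "s = {\<eta> \<in> schwartz. schwartz_seminorm k \<alpha> (\<lambda>x. \<eta> x - \<psi> x) < r}"
        "\<psi> \<in> schwartz" "0 < r" by blast
      define q where "q = schwartz_seminorm k \<alpha> (\<lambda>x. 0 - \<psi> x)"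
      have q: "q < r" using Basis s by (simp add: q_def)
      have ms: "(\<lambda>x. 0 - \<psi> x) \<in> schwartz" by (rule schwartz_diff[OF schwartz_zero s(2)])
      have "norm x ^ k * \<bar>iterated_pderivative \<alpha> (\<lambda>x. 0 - \<psi> x) x\<bar> \<le> q" for x
        unfolding q_def schwartz_seminorm_def
        using ms by (intro cSUP_upper) (auto simp: schwartz_def)
      moreover have "iterated_pderivative \<alpha> (\<lambda>x. 0 - \<psi> x) = (\<lambda>x. 0 - iterated_pderivative \<alpha> \<psi> x)"
        by (subst iterated_pderivative_diff) (auto intro: smooth_const schwartz_smooth s)
      ultimately have qx: "norm x ^ k * \<bar>iterated_pderivative \<alpha> \<psi> x\<bar> \<le> q" for x
        by simp
      have "0 < (r - q) / 2" using q by simp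
      then have "\<forall>\<^sub>F n in sequentially. \<forall>x. norm x ^ k * \<bar>iterated_pderivative \<alpha> (e n) x\<bar> \<le> (r - q) / 2"
        using e \<open>0 < (r - q) / 2\<close> unfolding schwartz_null_def by blast
      then show ?case
      proof eventually_elim
        case (elim n)
        have en: "e n \<in> schwartz" using e by (simp add: schwartz_null_def)
        have "norm x ^ k * \<bar>iterated_pderivative \<alpha> (\<lambda>x. e n x - \<psi> x) x\<bar> \<le> (r - q) / 2 + q" for x
        proof -
          have "norm x ^ k * \<bar>iterated_pderivative \<alpha> (e n) x - iterated_pderivative \<alpha> \<psi> x\<bar>
            \<le> norm x ^ k * (\<bar>iterated_pderivative \<alpha> (e n) x\<bar> + \<bar>iterated_pderivative \<alpha> \<psi> x\<bar>)"
            by (intro mult_left_mono abs_triangle_ineq4) simp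
          also have "\<dots> \<le> (r - q) / 2 + q" unfolding distrib_left
            by (rule add_mono[OF elim[rule_format] qx])
          finally show ?thesis by (simp add: iterated_pderivative_diff schwartz_smooth s en)
        qed
        then have "schwartz_seminorm k \<alpha> (\<lambda>x. e n x - \<psi> x) \<le> (r - q) / 2 + q"
          unfolding schwartz_seminorm_def by (intro cSUP_least) auto
        also have "\<dots> < r" using q by (simp add: field_simps)
        finally show ?case using s en by simp
      qed
    qed auto
    show ?thesis
    proof (rule tendstoI)
      fix \<epsilon> :: real assume "0 < \<epsilon>"
      define U where "U = {\<psi> \<in> topspace schwartz_topology. f \<psi> \<in> ball 0 \<epsilon>}"
      have "openin schwartz_topology U" unfolding U_def
        by (rule openin_continuous_map_preimage[OF f(3)]) simp
      then have "generate_topology_on ?B U"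
        unfolding schwartz_topology_def by (simp add: openin_topology_generated_by_iff)
      moreover have "(\<lambda>x. 0) \<in> topspace (schwartz_topology :: (real^'n \<Rightarrow> real) topology)"
      proof -
        have "schwartz_seminorm 0 [] (\<lambda>x::real^'n. 0 - 0) < 1" by (simp add: schwartz_seminorm_def)
        then have "(\<lambda>x. 0) \<in> {\<eta> \<in> schwartz. schwartz_seminorm 0 [] (\<lambda>x::real^'n. \<eta> x - 0) < 1}"
          using schwartz_zero by auto
        moreover have "{\<eta> \<in> schwartz. schwartz_seminorm 0 [] (\<lambda>x::real^'n. \<eta> x - 0) < 1} \<in> ?B"
          by (rule CollectI, intro exI[of _ 0] exI[of _ "[]"] exI[of _ "\<lambda>x. 0"] exI[of _ 1])
            (simp add: schwartz_zero)
        ultimately show ?thesis unfolding schwartz_topology_def topology_generated_by_topspace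
          by (rule UnionI[rotated])
      qed
      then have "(\<lambda>x. 0) \<in> U" using \<open>0 < \<epsilon>\<close> by (simp add: U_def f0)
      ultimately have "\<forall>\<^sub>F n in sequentially. e n \<in> U" by (rule ev)
      then show "\<forall>\<^sub>F n in sequentially. dist (f (e n)) 0 < \<epsilon>"
        by eventually_elim (simp add: U_def dist_commute)
    qed
  qed
  then show ?thesis using f by (simp add: seq_tempered_def)
qed

lemma seq_tempered_add: "seq_tempered L \<Longrightarrow> \<psi> \<in> schwartz \<Longrightarrow> \<eta> \<in> schwartz \<Longrightarrow> L (\<lambda>x. \<psi> x + \<eta> x) = L \<psi> + L \<eta>"
  by (simp add: seq_tempered_def)

lemma seq_tempered_cmult: "seq_tempered L \<Longrightarrow> \<psi> \<in> schwartz \<Longrightarrow> L (\<lambda>x. c * \<psi> x) = c * L \<psi>"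
  by (simp add: seq_tempered_def)

lemma seq_tempered_null: "seq_tempered L \<Longrightarrow> schwartz_null e \<Longrightarrow> (\<lambda>n. L (e n)) \<longlonglongrightarrow> 0"
  by (simp add: seq_tempered_def)

lemma seq_tempered_diff:
  assumes "seq_tempered L" "\<psi> \<in> schwartz" "\<eta> \<in> schwartz"
  shows "L (\<lambda>x. \<psi> x - \<eta> x) = L \<psi> - L \<eta>"
  using seq_tempered_add[OF assms(1,2) schwartz_cmult[OF assms(3), of "-1"]]
    seq_tempered_cmult[OF assms(1,3), of "-1"] by simp

lemma seq_tempered_zero: "seq_tempered L \<Longrightarrow> L (\<lambda>x. 0) = 0"
  using seq_tempered_cmult[OF _ schwartz_zero, of L 0] by simp

lemma seq_tempered_sum:
  assumes "seq_tempered L"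
  shows "(\<And>i. i \<in> I \<Longrightarrow> f i \<in> schwartz) \<Longrightarrow> L (\<lambda>x. \<Sum>i\<in>I. f i x) = (\<Sum>i\<in>I. L (f i))"
  by (induction I rule: infinite_finite_induct)
    (auto simp: seq_tempered_zero[OF assms] seq_tempered_add[OF assms] schwartz_sum)

lemma seq_tempered_LIMSEQ:
  assumes L: "seq_tempered L" and \<psi>: "\<psi> \<in> schwartz" and e: "\<And>n. e n \<in> schwartz"
    and null: "schwartz_null (\<lambda>n x. e n x - \<psi> x)"
  shows "(\<lambda>n. L (e n)) \<longlonglongrightarrow> L \<psi>"
proof -
  have "(\<lambda>n. L (e n) - L \<psi>) \<longlonglongrightarrow> 0"
    using seq_tempered_null[OF L null] by (simp add: seq_tempered_diff[OF L e \<psi>])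
  then show ?thesis by (simp add: LIM_zero_iff)
qed

lemma seq_tempered_scale:
  fixes L :: "'n::finite functional"
  assumes L: "seq_tempered L" and c: "c \<noteq> 0"
  shows "seq_tempered (\<lambda>\<psi>. L (\<lambda>z. \<psi> (c *\<^sub>R z)))"
proof -
  have "(\<lambda>z. \<psi> (c *\<^sub>R z)) \<in> schwartz" if "\<psi> \<in> schwartz" for \<psi> :: "real^'n \<Rightarrow> real"
    using schwartz_affine[OF that c, of 0] by simp
  note sch = this
  show ?thesis
    unfolding seq_tempered_def
    by (intro conjI ballI allI impI seq_tempered_add[OF L sch sch] seq_tempered_cmult[OF L sch]
        seq_tempered_null[OF L schwartz_null_scale[OF _ c]])
qed

lemma seq_tempered_integral:
  fixes g :: "real^'n::finite \<Rightarrow> real"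
  assumes g: "integrable lebesgue g"
  shows "seq_tempered (\<lambda>\<psi>. LINT x|lebesgue. g x * \<psi> x)"
proof -
  have int: "integrable lebesgue (\<lambda>x. g x * \<psi> x)" if \<psi>: "\<psi> \<in> schwartz" for \<psi>
    by (rule schwartz_bounded[OF \<psi>])
      (rule integrable_mult_bounded_continuous[OF g smooth_continuous[OF schwartz_smooth[OF \<psi>]]])
  show ?thesis
    unfolding seq_tempered_def
  proof (intro conjI ballI allI impI)
    fix \<psi> \<eta> :: "real^'n \<Rightarrow> real" assume "\<psi> \<in> schwartz" "\<eta> \<in> schwartz"
    then show "(LINT x|lebesgue. g x * (\<psi> x + \<eta> x)) = (LINT x|lebesgue. g x * \<psi> x) + (LINT x|lebesgue. g x * \<eta> x)"
      using int by (simp add: distrib_left)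
  next
    fix c and \<psi> :: "real^'n \<Rightarrow> real" assume "\<psi> \<in> schwartz"
    then show "(LINT x|lebesgue. g x * (c * \<psi> x)) = c * (LINT x|lebesgue. g x * \<psi> x)"
      by (simp add: mult.left_commute[of _ c])
  next
    fix e :: "nat \<Rightarrow> real^'n \<Rightarrow> real" assume e: "schwartz_null e"
    show "(\<lambda>n. LINT x|lebesgue. g x * e n x) \<longlonglongrightarrow> 0"
    proof (rule tendstoI)
      fix \<epsilon> :: real assume "0 < \<epsilon>"
      define G where "G = (LINT x|lebesgue. \<bar>g x\<bar>)"
      have G: "0 \<le> G" by (simp add: G_def)
      then have "0 < \<epsilon> / (G + 1)" using \<open>0 < \<epsilon>\<close> by simp
      then have "\<forall>\<^sub>F n in sequentially. \<forall>x. norm x ^ 0 * \<bar>iterated_pderivative [] (e n) x\<bar> \<le> \<epsilon> / (G + 1)"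
        using e unfolding schwartz_null_def by blast
      then show "\<forall>\<^sub>F n in sequentially. dist (LINT x|lebesgue. g x * e n x) 0 < \<epsilon>"
      proof eventually_elim
        case (elim n)
        have "continuous_on UNIV (e n)" 
          using e by (intro smooth_continuous schwartz_smooth) (simp add: schwartz_null_def)
        then have "\<bar>LINT x|lebesgue. g x * e n x\<bar> \<le> \<epsilon> / (G + 1) * G"
          unfolding G_def by (rule integral_mult_bounded_le[OF g]) (use elim in \<open>simp add: G_def\<close>)
        also have "\<dots> < \<epsilon>" using G \<open>0 < \<epsilon>\<close> by (simp add: field_simps)
        finally show ?case by simp
      qed
    qed
  qed
qed

section \<open>Cutting off a Schwartz function\<close>

text \<open>The product rule splits a derivative of \<open>F\<^sub>n \<psi>\<close> into two products of the same kind, so an induction on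
  the order of differentiation works as soon as the class \<open>P\<close> of multiplier sequences is closed under
  derivatives. The growth factor \<open>1 + |x|\<close> admits the multipliers \<open>\<theta>(x/n) - 1\<close>, whose size is of order
  \<open>|x|/n\<close>; the decay of \<open>\<psi>\<close> absorbs it.\<close>

lemma iterated_product_rate:
  fixes F :: "nat \<Rightarrow> real^'n::finite \<Rightarrow> real"
  assumes P: "\<And>F i. P F \<Longrightarrow> P (\<lambda>n. pderivative i (F n))" "\<And>F n. P F \<Longrightarrow> smooth (F n)"
      "\<And>F. P F \<Longrightarrow> \<exists>C. \<forall>n x. \<bar>F n x\<bar> \<le> C * a n * (1 + norm x)"
    and "P F" "\<psi> \<in> schwartz"
  shows "\<exists>C. \<forall>n x. norm x ^ k * \<bar>iterated_pderivative \<alpha> (\<lambda>x. F n x * \<psi> x) x\<bar> \<le> C * a n"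
  using assms(4,5)
proof (induction "length \<alpha>" arbitrary: \<alpha> F \<psi>)
  case 0
  obtain C where C: "\<And>n x. \<bar>F n x\<bar> \<le> C * a n * (1 + norm x)" using P(3)[OF 0(2)] by blast
  have nn: "0 \<le> C * a n" for n using order_trans[OF abs_ge_zero C[of n 0]] by simp
  obtain A where A: "\<And>x. norm x ^ k * \<bar>iterated_pderivative [] \<psi> x\<bar> \<le> A"
    using schwartz_bound[OF 0(3)] by blast
  obtain B where B: "\<And>x. norm x ^ Suc k * \<bar>iterated_pderivative [] \<psi> x\<bar> \<le> B"
    using schwartz_bound[OF 0(3)] by blast
  have "norm x ^ k * \<bar>F n x * \<psi> x\<bar> \<le> (C * (A + B)) * a n" for n x
  proof -
    have "norm x ^ k * \<bar>F n x * \<psi> x\<bar> \<le> norm x ^ k * ((C * a n * (1 + norm x)) * \<bar>\<psi> x\<bar>)"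
      unfolding abs_mult by (intro mult_left_mono mult_right_mono C) auto
    also have "\<dots> = C * a n * (norm x ^ k * \<bar>\<psi> x\<bar> + norm x ^ Suc k * \<bar>\<psi> x\<bar>)"
      by (simp add: algebra_simps)
    also have "\<dots> \<le> C * a n * (A + B)"
      using A[of x] B[of x] by (intro mult_left_mono add_mono nn) auto
    finally show ?thesis by (simp add: mult_ac)
  qed
  then show ?case using 0(1) by auto
next
  case (Suc m)
  then obtain \<beta> i where \<alpha>: "\<alpha> = \<beta> @ [i]" "length \<beta> = m"
    by (metis length_append_singleton nat.inject rev_exhaust list.size(3) nat.distinct(1))
  have \<psi>: "pderivative i \<psi> \<in> schwartz" by (rule schwartz_pderivative[OF Suc(4)])
  obtain A where A: "\<And>n x. norm x ^ k * \<bar>iterated_pderivative \<beta> (\<lambda>x. F n x * pderivative i \<psi> x) x\<bar> \<le> A * a n"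
    using Suc(1)[OF \<alpha>(2)[symmetric] Suc(3) \<psi>] by blast
  obtain B where B: "\<And>n x. norm x ^ k * \<bar>iterated_pderivative \<beta> (\<lambda>x. pderivative i (F n) x * \<psi> x) x\<bar> \<le> B * a n"
    using Suc(1)[OF \<alpha>(2)[symmetric] P(1)[OF Suc(3)] Suc(4)] by blast
  have "norm x ^ k * \<bar>iterated_pderivative \<alpha> (\<lambda>x. F n x * \<psi> x) x\<bar> \<le> (A + B) * a n" for n x
  proof -
    have sm: "smooth (F n)" "smooth \<psi>" using P(2) Suc by (auto intro: schwartz_smooth)
    have "pderivative i (\<lambda>x. F n x * \<psi> x) = (\<lambda>x. F n x * pderivative i \<psi> x + pderivative i (F n) x * \<psi> x)"
      by (intro ext pderivative_mult smooth_differentiable sm)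
    then have eq: "iterated_pderivative \<alpha> (\<lambda>x. F n x * \<psi> x) x =
       iterated_pderivative \<beta> (\<lambda>x. F n x * pderivative i \<psi> x) x
       + iterated_pderivative \<beta> (\<lambda>x. pderivative i (F n) x * \<psi> x) x"
      unfolding \<alpha> iterated_pderivative_snoc
      by (simp add: iterated_pderivative_add smooth_mult sm smooth_pderivative)
    have "norm x ^ k * \<bar>iterated_pderivative \<alpha> (\<lambda>x. F n x * \<psi> x) x\<bar> \<le>
       norm x ^ k * \<bar>iterated_pderivative \<beta> (\<lambda>x. F n x * pderivative i \<psi> x) x\<bar>
       + norm x ^ k * \<bar>iterated_pderivative \<beta> (\<lambda>x. pderivative i (F n) x * \<psi> x) x\<bar>"
      unfolding eq distrib_left[symmetric] by (intro mult_left_mono abs_triangle_ineq) simp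
    then show ?thesis using A[of x n] B[of x n] by (simp add: distrib_right)
  qed
  then show ?case by blast
qed

lemma lipschitz_C0_infinity:
  fixes g :: "real^'n::finite \<Rightarrow> real"
  assumes g: "g \<in> C0_infinity"
  obtains K where "0 \<le> K" "\<And>x. \<bar>g x - g 0\<bar> \<le> K * norm x"
proof -
  have "\<exists>B. \<forall>x. \<bar>pderivative i g x\<bar> \<le> B" for i
    using C0_infinity_bounded[OF C0_infinity_pderivative[OF g]] by metis
  then obtain B where B: "\<And>i x. \<bar>pderivative i g x\<bar> \<le> B i" by metis
  show ?thesis
  proof
    show "0 \<le> (\<Sum>i\<in>UNIV. B i)" using B by (intro sum_nonneg) (meson abs_ge_zero order_trans)
    fix x
    obtain z where z: "g (0 + 1 *\<^sub>R x) - g (0 + 0 *\<^sub>R x) = (1 - 0) * (\<Sum>i\<in>UNIV. x $ i * pderivative i g (0 + z *\<^sub>R x))"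
      using MVT2[OF zero_less_one smooth_derivative_along_line[OF C0_infinity_smooth[OF g], of 0 x]] by blast
    have "\<bar>g x - g 0\<bar> \<le> (\<Sum>i\<in>UNIV. \<bar>x $ i * pderivative i g (0 + z *\<^sub>R x)\<bar>)"
      using z by (simp add: sum_abs)
    also have "\<dots> \<le> (\<Sum>i\<in>UNIV. norm x * B i)"
      using B component_le_norm_cart by (intro sum_mono) (auto simp: abs_mult intro!: mult_mono)
    finally show "\<bar>g x - g 0\<bar> \<le> (\<Sum>i\<in>UNIV. B i) * norm x" by (simp add: sum_distrib_left mult.commute)
  qed
qed

text \<open>The multiplier \<open>\<theta>(x/n) - 1\<close> is of order \<open>|x|/n\<close> by the Lipschitz bound, and each derivative of it
  gains a factor \<open>1/n\<close>.\<close>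

lemma cutoff_converges:
  fixes \<theta> \<psi> :: "real^'n::finite \<Rightarrow> real"
  assumes \<theta>: "\<theta> \<in> C0_infinity" "\<theta> 0 = 1" and \<psi>: "\<psi> \<in> schwartz"
  shows "schwartz_null (\<lambda>n x. \<theta> ((1 / real (Suc n)) *\<^sub>R x) * \<psi> x - \<psi> x)"
proof (rule schwartz_nullI)
  fix n
  have "(\<lambda>x. \<theta> ((1 / real (Suc n)) *\<^sub>R x)) \<in> C0_infinity"
    using C0_infinity_affine[OF \<theta>(1), of "1 / real (Suc n)" 0] by simp
  then show "(\<lambda>x. \<theta> ((1 / real (Suc n)) *\<^sub>R x) * \<psi> x - \<psi> x) \<in> schwartz"
    by (intro schwartz_diff \<psi> C0_infinity_schwartz C0_infinity_mult' schwartz_smooth[OF \<psi>])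
next
  fix k \<alpha>
  define D where "D g n x = g ((1 / real (Suc n)) *\<^sub>R x)" for g :: "real^'n \<Rightarrow> real" and n x
  define P where "P F \<longleftrightarrow> F = (\<lambda>n x. D \<theta> n x - 1) \<or>
     (\<exists>c g C. g \<in> C0_infinity \<and> (\<forall>n. \<bar>c n\<bar> \<le> C * (1 / real (Suc n))) \<and> F = (\<lambda>n x. c n * D g n x))" for F
  have DC: "D g n \<in> C0_infinity" if "g \<in> C0_infinity" for g n
    using C0_infinity_affine[OF that, of "1 / real (Suc n)" 0] by (simp add: D_def[abs_def])
  have pD: "pderivative i (D g n) = (\<lambda>x. (1 / real (Suc n)) * D (pderivative i g) n x)" if "g \<in> C0_infinity" for g n i
    using pderivative_affine[OF smooth_differentiable[OF C0_infinity_smooth[OF that]], of i 0 "1 / real (Suc n)"]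
    unfolding D_def[abs_def] by (intro ext) simp
  have sD: "smooth (D g n)" if "g \<in> C0_infinity" for g n by (rule C0_infinity_smooth[OF DC[OF that]])
  have "\<exists>C. \<forall>n x. norm x ^ k * \<bar>iterated_pderivative \<alpha> (\<lambda>x. (D \<theta> n x - 1) * \<psi> x) x\<bar> \<le> C * (1 / real (Suc n))"
  proof (rule iterated_product_rate[where P=P, OF _ _ _ _ \<psi>])
    show "P (\<lambda>n x. D \<theta> n x - 1)" by (simp add: P_def)
  next
    fix F i assume "P F"
    then consider "F = (\<lambda>n x. D \<theta> n x - 1)"
      | c g C where "g \<in> C0_infinity" "\<forall>n. \<bar>c n\<bar> \<le> C * (1 / real (Suc n))" "F = (\<lambda>n x. c n * D g n x)"
      unfolding P_def by blast
    then show "P (\<lambda>n. pderivative i (F n))"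
    proof cases
      case 1
      have "pderivative i (F n) = (\<lambda>x. (1 / real (Suc n)) * D (pderivative i \<theta>) n x)" for n
      proof
        fix x
        show "pderivative i (F n) x = (1 / real (Suc n)) * D (pderivative i \<theta>) n x"
          unfolding 1 diff_conv_add_uminus
          by (subst pderivative_add[OF smooth_differentiable[OF sD[OF \<theta>(1)]] differentiable_const])
            (simp add: pD[OF \<theta>(1)])
      qed
      then show ?thesis unfolding P_def
        by (intro disjI2 exI[of _ "\<lambda>n. 1 / real (Suc n)"] exI[of _ "pderivative i \<theta>"] exI[of _ 1])
          (simp add: C0_infinity_pderivative \<theta>)
    next
      case 2
      have "pderivative i (F n) = (\<lambda>x. (c n * (1 / real (Suc n))) * D (pderivative i g) n x)" for n
        unfolding 2(3) by (intro ext, subst pderivative_cmult[OF smooth_differentiable[OF sD[OF 2(1)]]])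
          (simp add: pD[OF 2(1)])
      moreover have "\<bar>c n * (1 / real (Suc n))\<bar> \<le> C * (1 / real (Suc n))" for n
      proof -
        have "\<bar>c n * (1 / real (Suc n))\<bar> \<le> \<bar>c n\<bar> * 1" unfolding abs_mult by (intro mult_left_mono) auto
        also have "\<dots> \<le> C * (1 / real (Suc n))" using 2(2) by simp
        finally show ?thesis .
      qed
      ultimately show ?thesis unfolding P_def
        by (intro disjI2 exI[of _ "\<lambda>n. c n * (1 / real (Suc n))"] exI[of _ "pderivative i g"] exI[of _ C])
          (simp add: C0_infinity_pderivative 2 del: of_nat_Suc)
    qed
  next
    show "smooth (F n)" if "P F" for F n
      using that sD \<theta>(1) unfolding P_def by (auto intro: smooth_cmult smooth_diff smooth_const)
  next
    fix F assume "P F"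
    then consider "F = (\<lambda>n x. D \<theta> n x - 1)"
      | c g C where "g \<in> C0_infinity" "\<forall>n. \<bar>c n\<bar> \<le> C * (1 / real (Suc n))" "F = (\<lambda>n x. c n * D g n x)"
      unfolding P_def by blast
    then show "\<exists>C. \<forall>n x. \<bar>F n x\<bar> \<le> C * (1 / real (Suc n)) * (1 + norm x)"
    proof cases
      case 1
      obtain K where K: "0 \<le> K" "\<And>x. \<bar>\<theta> x - \<theta> 0\<bar> \<le> K * norm x" using \<theta>(1) by (rule lipschitz_C0_infinity) blast
      have "\<bar>D \<theta> n x - 1\<bar> \<le> K * (1 / real (Suc n)) * (1 + norm x)" for n x
      proof -
        have "\<bar>D \<theta> n x - 1\<bar> \<le> K * (1 / real (Suc n)) * norm x"
          using K(2)[of "(1 / real (Suc n)) *\<^sub>R x"] unfolding D_def \<theta>(2) by simp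
        moreover have "0 \<le> K * (1 / real (Suc n))" using K(1) by simp
        ultimately show ?thesis unfolding distrib_left by linarith
      qed
      then show ?thesis unfolding 1 by blast
    next
      case 2
      obtain B where B: "0 < B" "\<And>x. \<bar>g x\<bar> \<le> B" using 2(1) by (rule C0_infinity_bounded) blast
      have "\<bar>c n * D g n x\<bar> \<le> (C * B) * (1 / real (Suc n)) * (1 + norm x)" for n x
      proof -
        have "0 \<le> C * (1 / real (Suc n))" using 2(2)[rule_format, of n] abs_ge_zero[of "c n"] by linarith
        then have "0 \<le> C" by (simp add: zero_le_divide_iff)
        then have "\<bar>c n\<bar> * \<bar>D g n x\<bar> * 1 \<le> (C * (1 / real (Suc n))) * B * (1 + norm x)"
          using 2(2)[rule_format, of n] B by (intro mult_mono mult_nonneg_nonneg) (auto simp: D_def)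
        then show ?thesis by (simp add: abs_mult mult_ac)
      qed
      then show ?thesis unfolding 2(3) by blast
    qed
  qed
  then obtain C where "\<forall>n x. norm x ^ k * \<bar>iterated_pderivative \<alpha> (\<lambda>x. (D \<theta> n x - 1) * \<psi> x) x\<bar> \<le> C * (1 / real (Suc n))"
    by blast
  then show "\<exists>C. \<forall>\<^sub>F n in sequentially. \<forall>x. norm x ^ k *
     \<bar>iterated_pderivative \<alpha> (\<lambda>x. \<theta> ((1 / real (Suc n)) *\<^sub>R x) * \<psi> x - \<psi> x) x\<bar> \<le> C * (1 / real (Suc n))"
    unfolding D_def left_diff_distrib mult_1 by (intro exI[of _ C] always_eventually) blast
next
  show "(\<lambda>n. 1 / real (Suc n)) \<longlonglongrightarrow> 0" by (rule LIMSEQ_inverse_Suc)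
qed

section \<open>Translates of a Schwartz function\<close>

text \<open>Taylor's formula with a remainder that is quadratic in \<open>v\<close> uniformly with respect to the weight;
  the restriction to short vectors \<open>v\<close> keeps the intermediate point comparable with \<open>z\<close>.\<close>

lemma schwartz_taylor:
  fixes \<phi> :: "real^'n::finite \<Rightarrow> real"
  assumes \<phi>: "\<phi> \<in> schwartz"
  shows "\<exists>C. \<forall>v z. norm v \<le> 1 \<longrightarrow>
    norm z ^ k * \<bar>\<phi> (y + v + z) - \<phi> (y + z) - (\<Sum>i\<in>UNIV. v $ i * pderivative i \<phi> (y + z))\<bar> \<le> C * (norm v)\<^sup>2"
proof -
  let ?h = "\<lambda>i j. pderivative j (pderivative i \<phi>)"
  have "\<exists>C>0. \<forall>(x::real^'n) w. norm x \<le> 1 * norm w + (norm y + 1) \<longrightarrow> norm x ^ k * \<bar>?h i j w\<bar> \<le> C" for i j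
    using schwartz_weighted_bound[OF \<phi>, of 1 "norm y + 1" k "[j, i]"] by simp
  then have "\<exists>D. \<forall>p. 0 < D p \<and> (\<forall>(x::real^'n) w. norm x \<le> 1 * norm w + (norm y + 1)
      \<longrightarrow> norm x ^ k * \<bar>?h (fst p) (snd p) w\<bar> \<le> D p)"
    by (intro choice allI)
  then obtain D where D: "\<And>p. 0 < D p" "\<And>p (x::real^'n) w. norm x \<le> 1 * norm w + (norm y + 1)
      \<Longrightarrow> norm x ^ k * \<bar>?h (fst p) (snd p) w\<bar> \<le> D p" by blast
  define C where "C i j = D (i, j)" for i j
  have C: "0 < C i j" "norm x \<le> 1 * norm w + (norm y + 1) \<Longrightarrow> norm x ^ k * \<bar>?h i j w\<bar> \<le> C i j"
    for i j and x w :: "real^'n"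
    using D(1) D(2)[where p="(i, j)" and x=x and w=w] by (auto simp: C_def)
  define K where "K = (\<Sum>i\<in>UNIV. \<Sum>j\<in>UNIV. C i j)"
  have "norm z ^ k * \<bar>\<phi> (y + v + z) - \<phi> (y + z) - (\<Sum>i\<in>UNIV. v $ i * pderivative i \<phi> (y + z))\<bar> \<le> K * (norm v)\<^sup>2"
    if v: "norm v \<le> 1" for v z
  proof -
    define D where "D m t = (if m = 0 then \<phi> (y + z + t *\<^sub>R v)
       else if m = 1 then (\<Sum>i\<in>UNIV. v $ i * pderivative i \<phi> (y + z + t *\<^sub>R v))
       else (\<Sum>i\<in>UNIV. v $ i * (\<Sum>j\<in>UNIV. v $ j * ?h i j (y + z + t *\<^sub>R v))))" for m :: nat and t
    have der: "\<forall>m t. m < 2 \<and> 0 \<le> t \<and> t \<le> 1 \<longrightarrow> (D m has_real_derivative D (Suc m) t) (at t)"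
    proof (intro allI impI)
      fix m :: nat and t :: real assume "m < 2 \<and> 0 \<le> t \<and> t \<le> 1"
      then consider "m = 0" | "m = 1" by linarith
      then show "(D m has_real_derivative D (Suc m) t) (at t)"
      proof cases
        case 1 then show ?thesis unfolding D_def[abs_def]
          using smooth_derivative_along_line[OF schwartz_smooth[OF \<phi>], of "y + z" v t] by simp
      next
        case 2 then show ?thesis unfolding D_def[abs_def]
          using smooth_derivative_along_line[OF schwartz_smooth[OF schwartz_pderivative[OF \<phi>]], of _ "y + z" v t]
          by (auto intro!: DERIV_sum DERIV_cmult)
      qed
    qed
    obtain t where t: "0 < t" "t < 1" "D 0 1 = (\<Sum>m<2. D m 0 / fact m * 1 ^ m) + D 2 t / fact 2 * 1 ^ 2"
      using Maclaurin[of 1 2 D "D 0", OF _ _ refl der] by auto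
    have eq: "\<phi> (y + v + z) - \<phi> (y + z) - (\<Sum>i\<in>UNIV. v $ i * pderivative i \<phi> (y + z)) = D 2 t / 2"
      using t(3) by (simp add: D_def numeral_2_eq_2 add_ac)
    moreover have "norm z ^ k * \<bar>D 2 t\<bar> \<le> K * (norm v)\<^sup>2"
    proof -
      have "norm z \<le> norm (y + z + t *\<^sub>R v) + norm (y + t *\<^sub>R v)"
        by (metis add.commute add.left_commute add_diff_cancel_left' norm_triangle_ineq4 add.assoc)
      also have "norm (y + t *\<^sub>R v) \<le> norm y + \<bar>t\<bar> * norm v"
        by (metis norm_scaleR norm_triangle_ineq)
      also have "\<bar>t\<bar> * norm v \<le> 1 * 1" using t v by (intro mult_mono) auto
      finally have z: "norm z \<le> 1 * norm (y + z + t *\<^sub>R v) + (norm y + 1)" by simp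
      have "norm z ^ k * \<bar>D 2 t\<bar> \<le> norm z ^ k * (\<Sum>i\<in>UNIV. \<Sum>j\<in>UNIV. \<bar>v $ i * (v $ j * ?h i j (y + z + t *\<^sub>R v))\<bar>)"
        unfolding D_def
        by (intro mult_left_mono) (auto simp: sum_distrib_left intro!: order_trans[OF sum_abs] sum_mono sum_abs)
      also have "\<dots> = (\<Sum>i\<in>UNIV. \<Sum>j\<in>UNIV. (\<bar>v $ i\<bar> * \<bar>v $ j\<bar>) * (norm z ^ k * \<bar>?h i j (y + z + t *\<^sub>R v)\<bar>))"
        by (simp add: sum_distrib_left abs_mult mult_ac)
      also have "\<dots> \<le> (\<Sum>i\<in>UNIV. \<Sum>j\<in>UNIV. (norm v)\<^sup>2 * C i j)"
        unfolding power2_eq_square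
        using C(2)[OF z] by (intro sum_mono mult_mono component_le_norm_cart) auto
      also have "\<dots> = K * (norm v)\<^sup>2" by (simp add: K_def sum_distrib_left sum_distrib_right mult.commute)
      finally show ?thesis .
    qed
    moreover have "0 \<le> norm z ^ k * \<bar>D 2 t\<bar>" by simp
    ultimately have "norm z ^ k * \<bar>D 2 t\<bar> / 2 \<le> K * (norm v)\<^sup>2" by linarith
    then show ?thesis unfolding eq by (simp add: abs_divide)
  qed
  then show ?thesis by blast
qed

text \<open>The difference quotients of the translates converge in the Schwartz topology, so a derivative may
  be taken under the functional. Both the regularised pressure and the mollification of test functions
  are of this form and are therefore smooth.\<close>

lemma translate_has_derivative:
  fixes \<phi> :: "real^'n::finite \<Rightarrow> real"
  assumes L: "seq_tempered L" and \<phi>: "\<phi> \<in> schwartz"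
  shows "((\<lambda>y. L (\<lambda>z. \<phi> (y + z))) has_derivative
     (\<lambda>v. \<Sum>i\<in>UNIV. v $ i * L (\<lambda>z. pderivative i \<phi> (y + z)))) (at y)"
  unfolding has_derivative_iff_norm
proof
  let ?u = "\<lambda>y. L (\<lambda>z. \<phi> (y + z))"
  let ?D = "\<lambda>v. \<Sum>i\<in>UNIV. v $ i * L (\<lambda>z. pderivative i \<phi> (y + z))"
  show "bounded_linear ?D"
    by (intro bounded_linear_sum bounded_linear_mult_const bounded_linear_vec_nth)
  show "((\<lambda>x. norm (?u x - ?u y - ?D (x - y)) / norm (x - y)) \<longlongrightarrow> 0) (at y)"
    unfolding tendsto_at_iff_sequentially
  proof (intro allI impI)
    fix X assume X: "\<forall>n. X n \<in> UNIV - {y}" "X \<longlonglongrightarrow> y"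
    define v where "v n = X n - y" for n
    have v0: "v n \<noteq> 0" for n using X(1)[rule_format, of n] by (simp add: v_def)
    have vl: "(\<lambda>n. norm (v n)) \<longlonglongrightarrow> 0" unfolding v_def using X(2) by (simp add: LIM_zero tendsto_norm_zero)
    have sch: "(\<lambda>z. \<psi> (a + z)) \<in> schwartz" if "\<psi> \<in> schwartz" for \<psi> :: "real^'n \<Rightarrow> real" and a
      using schwartz_affine[OF that, of 1 a] by simp
    define c where "c n = 1 / norm (v n)" for n
    define e where "e n z = c n *
      (\<phi> (y + v n + z) - \<phi> (y + z) - (\<Sum>i\<in>UNIV. v n $ i * pderivative i \<phi> (y + z)))" for n z
    have it: "iterated_pderivative \<alpha> (\<lambda>z. \<psi> (a + z)) = (\<lambda>z. iterated_pderivative \<alpha> \<psi> (a + z))"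
      if "\<psi> \<in> schwartz" for \<psi> :: "real^'n \<Rightarrow> real" and a \<alpha>
      using iterated_pderivative_affine[OF schwartz_smooth[OF that], of \<alpha> a 1] by simp
    note sm = schwartz_smooth[OF sch]
    have "schwartz_null e"
    proof (rule schwartz_nullI[OF _ _ vl])
      show "e n \<in> schwartz" for n
        unfolding e_def by (intro schwartz_cmult schwartz_diff schwartz_sum sch \<phi> schwartz_pderivative)
      fix k \<alpha>
      let ?g = "iterated_pderivative \<alpha> \<phi>"
      have g: "?g \<in> schwartz" by (rule schwartz_iterated[OF \<phi>])
      have De: "iterated_pderivative \<alpha> (e n) = (\<lambda>z. c n *
          (?g (y + v n + z) - ?g (y + z) - (\<Sum>i\<in>UNIV. v n $ i * pderivative i ?g (y + z))))" for n
        unfolding e_def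
        by (simp add: iterated_pderivative_cmult iterated_pderivative_diff iterated_pderivative_sum
            smooth_cmult smooth_diff smooth_sum sm \<phi> schwartz_pderivative it
            iterated_pderivative_commute schwartz_smooth)
      obtain C where C: "\<And>v z. norm v \<le> 1 \<Longrightarrow>
         norm z ^ k * \<bar>?g (y + v + z) - ?g (y + z) - (\<Sum>i\<in>UNIV. v $ i * pderivative i ?g (y + z))\<bar> \<le> C * (norm v)\<^sup>2"
        using schwartz_taylor[OF g, of k y] by blast
      have "\<forall>\<^sub>F n in sequentially. norm (v n) < 1" using vl by (rule order_tendstoD) simp
      then have "\<forall>\<^sub>F n in sequentially. \<forall>x. norm x ^ k * \<bar>iterated_pderivative \<alpha> (e n) x\<bar> \<le> C * norm (v n)"
      proof eventually_elim
        case (elim n)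
        show ?case
        proof
          fix z
          have "(1 / norm (v n)) * (norm z ^ k * \<bar>?g (y + v n + z) - ?g (y + z) - (\<Sum>i\<in>UNIV. v n $ i * pderivative i ?g (y + z))\<bar>)
            \<le> (1 / norm (v n)) * (C * (norm (v n))\<^sup>2)"
            by (intro mult_left_mono C) (use elim in auto)
          also have "\<dots> = C * norm (v n)" using v0[of n] by (simp add: power2_eq_square)
          finally show "norm z ^ k * \<bar>iterated_pderivative \<alpha> (e n) z\<bar> \<le> C * norm (v n)"
            unfolding De abs_mult by (simp add: mult_ac c_def)
        qed
      qed
      then show "\<exists>C. \<forall>\<^sub>F n in sequentially. \<forall>x. norm x ^ k * \<bar>iterated_pderivative \<alpha> (e n) x\<bar> \<le> C * norm (v n)"
        by blast
    qed
    then have lim: "(\<lambda>n. L (e n)) \<longlonglongrightarrow> 0" by (rule seq_tempered_null[OF L])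
    have "L (e n) = (?u (X n) - ?u y - ?D (X n - y)) / norm (X n - y)" for n
    proof -
      have "L (e n) = c n * (L (\<lambda>z. \<phi> (y + v n + z)) - L (\<lambda>z. \<phi> (y + z))
         - (\<Sum>i\<in>UNIV. v n $ i * L (\<lambda>z. pderivative i \<phi> (y + z))))"
        unfolding e_def
        by (simp add: seq_tempered_cmult[OF L] seq_tempered_diff[OF L] seq_tempered_sum[OF L]
            schwartz_cmult schwartz_diff schwartz_sum sch \<phi> schwartz_pderivative)
      then show ?thesis by (simp add: v_def c_def)
    qed
    then show "((\<lambda>x. norm (?u x - ?u y - ?D (x - y)) / norm (x - y)) \<circ> X) \<longlonglongrightarrow> 0"
      using tendsto_norm[OF lim] by (simp add: o_def)
  qed
qed

lemma pderivative_translate: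
  assumes L: "seq_tempered L" and \<phi>: "\<phi> \<in> schwartz"
  shows "pderivative i (\<lambda>y. L (\<lambda>z. \<phi> (y + z))) = (\<lambda>y. L (\<lambda>z. pderivative i \<phi> (y + z)))"
  by (rule ext, subst pderivative_eqI[OF translate_has_derivative[OF assms]]) (rule sum_axis_mult)

lemma smooth_translate:
  assumes L: "seq_tempered L" and \<phi>: "\<phi> \<in> schwartz"
  shows "smooth (\<lambda>y. L (\<lambda>z. \<phi> (y + z)))"
proof (rule smooth_coinduct[where P="\<lambda>u. \<exists>\<phi>\<in>schwartz. u = (\<lambda>y. L (\<lambda>z. \<phi> (y + z)))"])
  show "\<exists>\<phi>'\<in>schwartz. (\<lambda>y. L (\<lambda>z. \<phi> (y + z))) = (\<lambda>y. L (\<lambda>z. \<phi>' (y + z)))" using \<phi> by blast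
next
  fix u assume "\<exists>\<phi>\<in>schwartz. u = (\<lambda>y. L (\<lambda>z. \<phi> (y + z)))"
  then obtain \<phi> where \<phi>: "\<phi> \<in> schwartz" and u: "u = (\<lambda>y. L (\<lambda>z. \<phi> (y + z)))" by blast
  have "u differentiable (at y)" for y
    unfolding u using translate_has_derivative[OF L \<phi>] differentiable_def by blast
  moreover have "pderivative i u = (\<lambda>y. L (\<lambda>z. pderivative i \<phi> (y + z)))" for i
    unfolding u by (rule pderivative_translate[OF L \<phi>])
  ultimately show "(\<forall>x. u differentiable (at x)) \<and>
     (\<forall>i. \<exists>\<phi>\<in>schwartz. pderivative i u = (\<lambda>y. L (\<lambda>z. \<phi> (y + z))))"
    using schwartz_pderivative[OF \<phi>] by blast
qed

section \<open>Mean value inequality and a Hardy-Littlewood bound\<close>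

lemma integral_pos_of_ball:
  fixes f :: "real^'n::finite \<Rightarrow> real"
  assumes f: "integrable lborel f" "\<And>x. 0 \<le> f x" and s: "0 < s" "\<And>x. x \<in> ball a s \<Longrightarrow> 0 < f x"
  shows "0 < (LINT x|lborel. f x)"
proof (rule ccontr)
  assume "\<not> 0 < (LINT x|lborel. f x)"
  moreover have "0 \<le> (LINT x|lborel. f x)" using f(2) by simp
  ultimately have "(LINT x|lborel. f x) = 0" by simp
  then have "AE x in lborel. f x = 0"
    using integral_nonneg_eq_0_iff_AE[OF f(1)] f(2) by simp
  then have "AE x in lborel. x \<notin> ball a s"
    by eventually_elim (use s(2) in fastforce)
  then have "ball a s \<in> null_sets lborel"
    by (subst AE_iff_null_sets) auto
  then have "negligible (ball a s)"
    by (simp add: negligible_iff_null_sets null_sets_completionI)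
  then show False using s(1) open_not_negligible[OF open_ball, of a s] by simp
qed

text \<open>Turns the integral into a gauge integral over a fixed box, to which the Leibniz rule applies.\<close>

lemma lborel_integral_eq_cbox:
  fixes f :: "real^'n::finite \<Rightarrow> real"
  assumes "continuous_on UNIV f" "\<And>x. 1 < norm x \<Longrightarrow> f x = 0"
  shows "(LINT x|lborel. f x) = integral (cbox (\<chi> i. -1) (\<chi> i. 1)) f"
    and "f integrable_on cbox (\<chi> i. -1) (\<chi> i. 1)"
proof -
  let ?Q = "cbox (\<chi> i. -1) (\<chi> i. 1) :: (real^'n) set"
  have int: "integrable lborel f" by (rule integrable_continuous_compact_support[OF assms])
  have out: "f x = 0" if "x \<notin> ?Q" for x
  proof (rule assms(2))
    obtain i where "\<not> (- 1 \<le> x $ i \<and> x $ i \<le> 1)" using \<open>x \<notin> ?Q\<close> by (auto simp: mem_box_cart)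
    then have "1 < \<bar>x $ i\<bar>" by linarith
    then show "1 < norm x" using component_le_norm_cart[of x i] by linarith
  qed
  then have eq: "(\<lambda>x. indicator ?Q x *\<^sub>R f x) = f" using out by (auto simp: indicator_def fun_eq_iff)
  have si: "set_integrable lborel ?Q f" unfolding set_integrable_def eq by (rule int)
  from set_borel_integral_eq_integral[OF si]
  show "(LINT x|lborel. f x) = integral ?Q f" "f integrable_on ?Q"
    unfolding set_lebesgue_integral_def eq by auto
qed

text \<open>The weight \<open>y bump 2 y\<close> that appears in the radial derivative of the averages is a gradient, and an
  integration by parts leaves only the Laplacian of \<open>u\<close>.\<close>

lemma dilated_average_derivative:
  fixes u :: "real^'n::finite \<Rightarrow> real"
  assumes u: "smooth u"
  shows "((\<lambda>s. LINT y|lborel. u (x + s *\<^sub>R y) * bump 2 y) has_real_derivative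
     (s / 2) * (LINT y|lborel. laplacian u (x + s *\<^sub>R y) * bump 0 y)) (at s)"
proof -
  let ?Q = "cbox (\<chi> i. -1) (\<chi> i. 1) :: (real^'n) set"
  let ?fx = "\<lambda>s y. (\<Sum>i\<in>UNIV. y $ i * pderivative i u (x + s *\<^sub>R y)) * bump 2 y"
  have cb: "continuous_on A (bump j :: real^'n \<Rightarrow> real)" for A j by (rule smooth_continuous[OF smooth_bump])
  have cu: "continuous_on UNIV (\<lambda>y. h (x + s *\<^sub>R y))" if "smooth h" for h :: "real^'n \<Rightarrow> real" and s
    by (rule smooth_continuous[OF smooth_affine[OF that]])
  have eq: "(LINT y|lborel. u (x + s *\<^sub>R y) * bump 2 y) = integral ?Q (\<lambda>y. u (x + s *\<^sub>R y) * bump 2 y)"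
    "(\<lambda>y. u (x + s *\<^sub>R y) * bump 2 y) integrable_on ?Q" for s
    by (rule lborel_integral_eq_cbox; auto intro!: continuous_on_mult cu u cb simp: bump_eq_0)+
  have eq': "(LINT y|lborel. ?fx s y) = integral ?Q (?fx s)"
    by (rule lborel_integral_eq_cbox)
      (auto intro!: continuous_on_mult continuous_on_sum cu u cb smooth_pderivative continuous_intros simp: bump_eq_0)
  have "((\<lambda>s. integral ?Q (\<lambda>y. u (x + s *\<^sub>R y) * bump 2 y)) has_field_derivative integral ?Q (?fx s)) (at s within UNIV)"
  proof (rule leibniz_rule_field_derivative)
    show "((\<lambda>s. u (x + s *\<^sub>R y) * bump 2 y) has_field_derivative ?fx s y) (at s within UNIV)" for s y
      using DERIV_cmult_right[OF smooth_derivative_along_line[OF u, of x y s]] by simp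
    have comp: "continuous_on (UNIV \<times> ?Q) (\<lambda>z. h (x + fst z *\<^sub>R snd z))" if "smooth h" for h
      by (rule continuous_on_compose2[OF smooth_continuous[OF that, of UNIV]]) (auto intro!: continuous_intros)
    have "continuous_on (UNIV \<times> ?Q) (\<lambda>z. ?fx (fst z) (snd z))"
      by (intro continuous_on_mult continuous_on_sum comp smooth_pderivative u
          continuous_on_compose2[OF cb[of UNIV]] continuous_intros) auto
    then show "continuous_on (UNIV \<times> ?Q) (\<lambda>(s, y). ?fx s y)" by (simp add: case_prod_beta')
  qed (use eq in auto)
  moreover have "(LINT y|lborel. ?fx s y) = (s / 2) * (LINT y|lborel. laplacian u (x + s *\<^sub>R y) * bump 0 y)"
  proof -
    let ?g = "\<lambda>i y. pderivative i u (x + s *\<^sub>R y)"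
    have g: "smooth (?g i)" for i by (intro smooth_affine smooth_pderivative u)
    have dg: "pderivative i (?g i) = (\<lambda>y. s * pderivative i (pderivative i u) (x + s *\<^sub>R y))" for i
      by (rule ext, rule pderivative_affine) (intro smooth_differentiable smooth_pderivative u)
    have i1: "integrable lborel (\<lambda>y. ?g i y * pderivative i (bump 0) y)" for i
      by (rule C0_infinity_integrable[OF C0_infinity_mult[OF g C0_infinity_pderivative[OF bump_C0_infinity]]])
    have i2: "integrable lborel (\<lambda>y. pderivative i (pderivative i u) (x + s *\<^sub>R y) * bump 0 y)" for i
      by (rule C0_infinity_integrable, rule C0_infinity_mult[OF _ bump_C0_infinity])
        (intro smooth_affine smooth_pderivative u)
    have "?fx s y = (\<Sum>i\<in>UNIV. (- 1 / 2) * (?g i y * pderivative i (bump 0) y))" for y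
      unfolding pderivative_bump(2) by (simp add: sum_distrib_left sum_distrib_right mult_ac numeral_2_eq_2)
    then have "(LINT y|lborel. ?fx s y) = (\<Sum>i\<in>UNIV. (- 1 / 2) * (LINT y|lborel. ?g i y * pderivative i (bump 0) y))"
      using i1 by (simp add: Bochner_Integration.integral_sum)
    also have "\<dots> = (\<Sum>i\<in>UNIV. (s / 2) * (LINT y|lborel. pderivative i (pderivative i u) (x + s *\<^sub>R y) * bump 0 y))"
      unfolding integral_by_parts[OF g bump_C0_infinity] dg
      by (simp add: mult.assoc)
    also have "\<dots> = (s / 2) * (LINT y|lborel. laplacian u (x + s *\<^sub>R y) * bump 0 y)"
      unfolding laplacian_def sum_distrib_right using i2 by (simp add: sum_distrib_left)
    finally show ?thesis .
  qed
  ultimately show ?thesis by (simp only: eq eq')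
qed

text \<open>The weighted average of \<open>u\<close> over the ball of radius \<open>\<rho>\<close> differs from a multiple of \<open>u x\<close> by the integral
  of the radial derivative, which is of order \<open>\<rho>\<^sup>2 K\<close>.\<close>

lemma mean_value_inequality:
  "\<exists>C>0. \<forall>(u :: real^'n::finite \<Rightarrow> real) x \<rho> K. smooth u \<longrightarrow> 0 < \<rho> \<longrightarrow> (\<forall>z. \<bar>laplacian u z\<bar> \<le> K) \<longrightarrow>
     \<bar>u x\<bar> \<le> C * ((LINT z|lborel. indicator (ball x \<rho>) z * \<bar>u z\<bar>) / \<rho> ^ CARD('n) + \<rho>\<^sup>2 * K)"
proof -
  obtain B where B: "0 < B" "\<And>x. \<bar>bump 2 (x :: real^'n)\<bar> \<le> B"
    using C0_infinity_bounded[OF bump_C0_infinity] by blast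
  define c0 where "c0 = (LINT y|lborel. bump 2 (y :: real^'n))"
  define c1 where "c1 = (LINT y|lborel. bump 0 (y :: real^'n))"
  have ib: "integrable lborel (bump j :: real^'n \<Rightarrow> real)" for j
    by (rule C0_infinity_integrable[OF bump_C0_infinity])
  have c0: "0 < c0" unfolding c0_def
    by (rule integral_pos_of_ball[OF ib bump_nonneg zero_less_one, where a=0]) (simp add: bump_pos)
  have c1: "0 \<le> c1" unfolding c1_def by (simp add: bump_nonneg)
  define C where "C = (B + c1) / c0"
  have C: "0 < C" using B c0 c1 by (simp add: C_def)
  have "\<bar>u x\<bar> \<le> C * ((LINT z|lborel. indicator (ball x \<rho>) z * \<bar>u z\<bar>) / \<rho> ^ CARD('n) + \<rho>\<^sup>2 * K)"
    if u: "smooth u" and \<rho>: "0 < \<rho>" and K: "\<And>z. \<bar>laplacian u z\<bar> \<le> K" for u :: "real^'n \<Rightarrow> real" and x \<rho> K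
  proof -
    define m where "m s = (LINT y|lborel. u (x + s *\<^sub>R y) * bump 2 y)" for s
    have K0: "0 \<le> K" using K[of 0] by (meson abs_ge_zero order_trans)
    have lap: "\<bar>LINT y|lborel. laplacian u (x + s *\<^sub>R y) * bump 0 y\<bar> \<le> K * c1" for s
    proof -
      have i: "integrable lborel (\<lambda>y. laplacian u (x + s *\<^sub>R y) * bump 0 y)"
        by (rule C0_infinity_integrable[OF C0_infinity_mult[OF smooth_affine[OF laplacian_smooth[OF u]] bump_C0_infinity]])
      have "\<bar>LINT y|lborel. laplacian u (x + s *\<^sub>R y) * bump 0 y\<bar>
        \<le> (LINT y|lborel. \<bar>laplacian u (x + s *\<^sub>R y) * bump 0 y\<bar>)" by (rule integral_abs_bound)
      also have "\<dots> \<le> (LINT y|lborel. K * bump 0 (y :: real^'n))"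
        using K by (intro integral_mono integrable_abs[OF i] integrable_mult_right[OF ib])
          (auto simp: abs_mult bump_nonneg intro: mult_right_mono)
      finally show ?thesis by (simp add: c1_def)
    qed
    obtain s where s: "0 < s" "s < \<rho>" "m \<rho> - m 0 = (\<rho> - 0) * ((s / 2) * (LINT y|lborel. laplacian u (x + s *\<^sub>R y) * bump 0 y))"
      using MVT2[OF \<rho> dilated_average_derivative[OF u, of x]] unfolding m_def by blast
    have "\<bar>m \<rho> - m 0\<bar> = \<rho> * (s / 2) * \<bar>LINT y|lborel. laplacian u (x + s *\<^sub>R y) * bump 0 y\<bar>"
      unfolding s(3) using s(1) \<rho> by (simp add: abs_mult)
    also have "\<dots> \<le> (\<rho> * \<rho>) * (K * c1)"
      using s \<rho> lap by (intro mult_mono) auto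
    finally have d: "\<bar>m \<rho> - m 0\<bar> \<le> \<rho>\<^sup>2 * K * c1" by (simp add: power2_eq_square)
    define J where "J = (LINT z|lborel. indicator (ball x \<rho>) z * \<bar>u z\<bar>)"
    have "m 0 = u x * c0" by (simp add: m_def c0_def)
    moreover have "\<bar>m \<rho>\<bar> \<le> B * (J / \<rho> ^ CARD('n))"
    proof -
      have um[measurable]: "u \<in> borel_measurable borel" by (rule smooth_measurable[OF u])
      have cont: "continuous_on UNIV (\<lambda>y. u (x + \<rho> *\<^sub>R y))" by (rule smooth_continuous[OF smooth_affine[OF u]])
      have i: "integrable lborel (\<lambda>y. u (x + \<rho> *\<^sub>R y) * bump 2 y)"
        by (rule C0_infinity_integrable[OF C0_infinity_mult[OF smooth_affine[OF u] bump_C0_infinity]])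
      have ind: "indicator (ball x \<rho>) (x + \<rho> *\<^sub>R y) = (indicator (ball 0 1) y :: real)" for y
        using \<rho> by (auto simp: indicator_def dist_norm)
      have i2: "integrable lborel (\<lambda>y. indicator (ball 0 1) y * \<bar>u (x + \<rho> *\<^sub>R y)\<bar>)"
      proof (rule Bochner_Integration.integrable_bound)
        show "integrable lborel (\<lambda>y. indicator (cball 0 1) y *\<^sub>R \<bar>u (x + \<rho> *\<^sub>R y)\<bar>)"
          by (rule borel_integrable_compact) (auto intro!: continuous_intros continuous_on_subset[OF cont])
      qed (auto simp: indicator_def)
      have "\<bar>m \<rho>\<bar> \<le> (LINT y|lborel. \<bar>u (x + \<rho> *\<^sub>R y) * bump 2 y\<bar>)"
        unfolding m_def by (rule integral_abs_bound)
      also have "\<dots> \<le> (LINT y|lborel. B * (indicator (ball 0 1) y * \<bar>u (x + \<rho> *\<^sub>R y)\<bar>))"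
      proof (rule integral_mono)
        show "\<bar>u (x + \<rho> *\<^sub>R y) * bump 2 y\<bar> \<le> B * (indicator (ball 0 1) y * \<bar>u (x + \<rho> *\<^sub>R y)\<bar>)" for y
          using mult_left_mono[OF B(2)[of y], of "\<bar>u (x + \<rho> *\<^sub>R y)\<bar>"] bump_eq_0[of y 2]
          by (cases "norm y < 1") (auto simp: abs_mult mult.commute not_less)
      qed (use i i2 in auto)
      also have "\<dots> = B * (LINT y|lborel. indicator (ball 0 1) y * \<bar>u (x + \<rho> *\<^sub>R y)\<bar>)" by simp
      also have "(LINT y|lborel. indicator (ball 0 1) y * \<bar>u (x + \<rho> *\<^sub>R y)\<bar>) = J / \<rho> ^ CARD('n)"
      proof -
        have mm: "(\<lambda>z. indicator (ball x \<rho>) z * \<bar>u z\<bar>) \<in> borel_measurable borel"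
          by (intro borel_measurable_times borel_measurable_indicator borel_measurable_abs um) auto
        show ?thesis
          unfolding J_def using lborel_integral_affine[OF mm, of \<rho> x] \<rho> by (simp add: ind)
      qed
      finally show ?thesis .
    qed
    ultimately have "\<bar>u x\<bar> * c0 \<le> B * (J / \<rho> ^ CARD('n)) + \<rho>\<^sup>2 * K * c1"
      using d c0 by (simp add: abs_if split: if_splits)
    also have "\<dots> \<le> (B + c1) * (J / \<rho> ^ CARD('n)) + (B + c1) * (\<rho>\<^sup>2 * K)"
    proof -
      have "0 \<le> J" by (simp add: J_def)
      then have "B * (J / \<rho> ^ CARD('n)) \<le> (B + c1) * (J / \<rho> ^ CARD('n))"
        using c1 \<rho> by (intro mult_right_mono) auto
      moreover have "\<rho>\<^sup>2 * K * c1 \<le> (B + c1) * (\<rho>\<^sup>2 * K)"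
        using B K0 by (simp add: algebra_simps)
      ultimately show ?thesis by simp
    qed
    finally show ?thesis using c0 unfolding C_def J_def[symmetric] by (simp add: field_simps)
  qed
  then show ?thesis using C by blast
qed

lemma power_le_split_powr:
  fixes a M q :: real
  assumes "0 \<le> a" "a \<le> M" "0 < q" "q \<le> 1"
  shows "a \<le> M powr (1 - q) * a powr q"
proof (cases "a = 0")
  case False
  then have "a = a powr (1 - q) * a powr q" using assms by (simp flip: powr_add)
  also have "\<dots> \<le> M powr (1 - q) * a powr q"
    using assms by (intro mult_right_mono powr_mono2) auto
  finally show ?thesis .
qed (use assms in simp)

lemma integrable_indicator_continuous:
  fixes f :: "real^'n::finite \<Rightarrow> real"
  assumes "continuous_on UNIV f"
  shows "integrable lborel (\<lambda>z. indicator (ball x \<rho>) z * f z)"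
proof (rule Bochner_Integration.integrable_bound)
  show "integrable lborel (\<lambda>y. indicator (cball x \<rho>) y *\<^sub>R f y)"
    by (rule borel_integrable_compact) (auto intro!: continuous_on_subset[OF assms])
  show "(\<lambda>z. indicator (ball x \<rho>) z * f z) \<in> borel_measurable lborel"
    using borel_measurable_continuous_onI[OF assms]
    by (intro borel_measurable_times borel_measurable_indicator) auto
qed (auto simp: indicator_def)

lemma continuous_on_abs_powr:
  fixes f :: "'a::topological_space \<Rightarrow> real"
  assumes "continuous_on A f" "0 < q"
  shows "continuous_on A (\<lambda>x. \<bar>f x\<bar> powr q)"
  by (rule continuous_on_powr') (auto intro!: continuous_intros assms)

text \<open>For subharmonic functions and exponents below one this goes back to Hardy and Littlewood. At a maximum
  point \<open>y\<close> of \<open>d(x)\<^sup>p |u(x)|\<close>, where \<open>d\<close> is the distance to the boundary of the ball, one has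
  \<open>|u| \<le> 2\<^sup>p |u(y)|\<close> on the ball of radius \<open>d(y)/2\<close> around \<open>y\<close>. Splitting \<open>|u| = |u|\<^sup>1\<^sup>-\<^sup>q |u|\<^sup>q\<close> in the mean
  value inequality on this ball then gives a bound for \<open>|u(y)|\<^sup>q\<close>, unless the Laplacian term dominates
  and bounds \<open>|u(y)|\<close> directly.\<close>

lemma hardy_littlewood_bound:
  fixes x0 :: "real^'n::finite" and q r K I :: real
  assumes q: "0 < q" "q \<le> 1" and r: "0 < r"
  shows "\<exists>M>0. \<forall>u :: real^'n \<Rightarrow> real. smooth u \<longrightarrow> (\<forall>z. \<bar>laplacian u z\<bar> \<le> K) \<longrightarrow>
     (LINT z|lborel. indicator (ball x0 r) z * \<bar>u z\<bar> powr q) \<le> I \<longrightarrow>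
     (\<forall>x\<in>ball x0 (r / 2). \<bar>u x\<bar> \<le> M)"
proof -
  let ?N = "CARD('n)"
  obtain C where C: "0 < C" "\<forall>(u :: real^'n \<Rightarrow> real) x \<rho> K. smooth u \<longrightarrow> 0 < \<rho> \<longrightarrow> (\<forall>z. \<bar>laplacian u z\<bar> \<le> K) \<longrightarrow>
     \<bar>u x\<bar> \<le> C * ((LINT z|lborel. indicator (ball x \<rho>) z * \<bar>u z\<bar>) / \<rho> ^ ?N + \<rho>\<^sup>2 * K)"
    using mean_value_inequality by blast
  \<comment> \<open>a natural exponent keeps the weight continuous up to the boundary; \<open>p q \<ge> N\<close> beats the factor \<open>d\<^sup>-\<^sup>N\<close> below\<close>
  obtain p :: nat where p: "real ?N / q \<le> real p" using real_arch_simple by blast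
  then have p': "real ?N \<le> real p * q" using q by (simp add: field_simps)
  define A where "A = 2 * C * 2 ^ ?N * (2 ^ p) powr (1 - q) * \<bar>I\<bar>"
  have A: "0 \<le> A" using C by (simp add: A_def)
  define S where "S = r ^ p * (2 * C * r\<^sup>2 * \<bar>K\<bar>) + (A * r powr (real p * q - ?N)) powr (1 / q) + 1"
  have S: "0 < S" using C r by (auto simp: S_def intro!: add_nonneg_pos)
  have main: "\<bar>u x\<bar> \<le> S / (r / 2) ^ p"
    if u: "smooth u" and K: "\<And>z. \<bar>laplacian u z\<bar> \<le> K"
      and I: "(LINT z|lborel. indicator (ball x0 r) z * \<bar>u z\<bar> powr q) \<le> I"
      and x: "x \<in> ball x0 (r / 2)" for u :: "real^'n \<Rightarrow> real" and x
  proof -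
    have cu: "continuous_on B u" for B by (rule smooth_continuous[OF u])
    define d where "d y = r - dist x0 y" for y
    define s where "s y = d y ^ p * \<bar>u y\<bar>" for y
    have "continuous_on (cball x0 r) s" unfolding s_def d_def by (intro continuous_intros cu)
    then obtain y where y: "y \<in> cball x0 r" "\<And>z. z \<in> cball x0 r \<Longrightarrow> s z \<le> s y"
      using continuous_attains_sup[of "cball x0 r" s] r by auto
    have "s y \<le> S"
    proof (cases "s y \<le> 0")
      case False
      define U where "U = \<bar>u y\<bar>"
      define \<rho> where "\<rho> = d y / 2"
      have dy: "0 \<le> d y" "d y \<le> r" using y(1) by (auto simp: d_def)
      have U: "0 < U" using False dy by (auto simp: s_def U_def zero_less_mult_iff)
      have dpos: "0 < d y"
      proof (rule ccontr)
        assume "\<not> 0 < d y"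
        then have d0: "d y = 0" using dy by simp
        have "0 < real p * q" using p' by (metis of_nat_0_less_iff less_le_trans zero_less_card_finite)
        then have "p \<noteq> 0" by (cases p) auto
        then show False using False d0 by (simp add: s_def power_0_left)
      qed
      have \<rho>: "0 < \<rho>" using dpos by (simp add: \<rho>_def)
      have sub: "ball y \<rho> \<subseteq> ball x0 r"
      proof
        fix z assume "z \<in> ball y \<rho>"
        then have "dist x0 z < dist x0 y + \<rho>" using dist_triangle[of x0 z y] by simp
        then show "z \<in> ball x0 r" using dpos by (simp add: \<rho>_def d_def field_simps)
      qed
      have loc: "\<bar>u z\<bar> \<le> 2 ^ p * U" if z: "z \<in> ball y \<rho>" for z
      proof -
        have "dist x0 z \<le> dist x0 y + \<rho>" using z dist_triangle[of x0 z y] by simp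
        then have dz: "\<rho> \<le> d z" by (simp add: \<rho>_def d_def field_simps)
        have "\<rho> ^ p * \<bar>u z\<bar> \<le> d z ^ p * \<bar>u z\<bar>"
          using \<rho> dz by (intro mult_right_mono power_mono) auto
        also have "\<dots> \<le> d y ^ p * U"
          using y(2)[of z] z sub by (auto simp: s_def U_def)
        also have "\<dots> = \<rho> ^ p * (2 ^ p * U)" by (simp add: \<rho>_def power_divide)
        finally show ?thesis using \<rho> by simp
      qed
      define J where "J = (LINT z|lborel. indicator (ball y \<rho>) z * \<bar>u z\<bar>)"
      have J: "J \<le> (2 ^ p * U) powr (1 - q) * \<bar>I\<bar>"
      proof -
        have "J \<le> (LINT z|lborel. (2 ^ p * U) powr (1 - q) * (indicator (ball x0 r) z * \<bar>u z\<bar> powr q))"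
          unfolding J_def
        proof (rule integral_mono)
          show "integrable lborel (\<lambda>z. indicator (ball y \<rho>) z * \<bar>u z\<bar>)"
            by (intro integrable_indicator_continuous continuous_intros cu)
          show "integrable lborel (\<lambda>z. (2 ^ p * U) powr (1 - q) * (indicator (ball x0 r) z * \<bar>u z\<bar> powr q))"
            by (intro integrable_mult_right integrable_indicator_continuous continuous_on_abs_powr cu q)
          show "indicator (ball y \<rho>) z * \<bar>u z\<bar> \<le> (2 ^ p * U) powr (1 - q) * (indicator (ball x0 r) z * \<bar>u z\<bar> powr q)" for z
            using power_le_split_powr[OF abs_ge_zero loc q, of z] sub by (auto simp: indicator_def)
        qed
        also have "\<dots> = (2 ^ p * U) powr (1 - q) * (LINT z|lborel. indicator (ball x0 r) z * \<bar>u z\<bar> powr q)" by simp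
        also have "\<dots> \<le> (2 ^ p * U) powr (1 - q) * \<bar>I\<bar>"
          using I by (intro mult_left_mono) auto
        finally show ?thesis .
      qed
      have mv: "U \<le> C * (J / \<rho> ^ ?N + \<rho>\<^sup>2 * K)"
        unfolding U_def J_def using C(2)[rule_format, OF u \<rho> K] .
      have K0: "0 \<le> K" using K[of 0] by (meson abs_ge_zero order_trans)
      have sy: "s y = d y ^ p * U" by (simp add: s_def U_def)
      show ?thesis
      proof (cases "U \<le> 2 * C * (\<rho>\<^sup>2 * K)")
        case True
        then have "U \<le> 2 * C * (\<rho>\<^sup>2 * K)" .
        also have "\<dots> \<le> 2 * C * (r\<^sup>2 * K)"
          using C K0 \<rho> dy by (intro mult_left_mono mult_right_mono power_mono) (auto simp: \<rho>_def)
        finally have "d y ^ p * U \<le> r ^ p * (2 * C * (r\<^sup>2 * K))"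
          using dy U r by (intro mult_mono power_mono) auto
        moreover have "0 \<le> (A * r powr (real p * q - ?N)) powr (1 / q)" by simp
        moreover have "S = r ^ p * (2 * C * (r\<^sup>2 * K)) + (A * r powr (real p * q - ?N)) powr (1 / q) + 1"
          using K0 by (simp add: S_def mult.assoc)
        ultimately show ?thesis unfolding sy by linarith
      next
        case False
        then have "U \<le> 2 * C * (J / \<rho> ^ ?N)" using mv unfolding distrib_left mult.assoc by linarith
        also have "\<dots> \<le> 2 * C * (((2 ^ p * U) powr (1 - q) * \<bar>I\<bar>) / \<rho> ^ ?N)"
          using C J \<rho> by (intro mult_left_mono divide_right_mono) auto
        also have "\<dots> = A / d y ^ ?N * U powr (1 - q)"
          using U dpos by (simp add: A_def \<rho>_def powr_mult power_divide field_simps)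
        finally have "U powr q * U powr (1 - q) \<le> A / d y ^ ?N * U powr (1 - q)"
          using U by (simp flip: powr_add)
        then have Uq: "U powr q \<le> A / d y ^ ?N"
          using U by (simp only: mult_le_cancel_right_pos powr_gt_zero)
        have "(s y) powr q = (d y ^ p) powr q * U powr q"
          unfolding sy using dpos U by (simp add: powr_mult)
        also have "(d y ^ p) powr q = d y powr (real p * q)"
          using dpos by (simp add: powr_realpow[symmetric] powr_powr)
        also have "d y powr (real p * q) * U powr q \<le> d y powr (real p * q) * (A / d y ^ ?N)"
          using Uq by (intro mult_left_mono) auto
        also have "\<dots> = A * d y powr (real p * q - ?N)"
          using dpos by (simp add: powr_diff powr_realpow)
        also have "\<dots> \<le> A * r powr (real p * q - ?N)"
          using A dy p' by (intro mult_left_mono powr_mono2) auto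
        finally have le: "(s y) powr q \<le> A * r powr (real p * q - ?N)" .
        have "s y = ((s y) powr q) powr (1 / q)"
          using \<open>\<not> s y \<le> 0\<close> q by (simp add: powr_powr)
        also have "\<dots> \<le> (A * r powr (real p * q - ?N)) powr (1 / q)"
          using le q by (intro powr_mono2) auto
        finally have "s y \<le> (A * r powr (real p * q - ?N)) powr (1 / q)" .
        moreover have "0 \<le> r ^ p * (2 * C * r\<^sup>2 * \<bar>K\<bar>)" using C r by auto
        ultimately show ?thesis unfolding S_def by linarith
      qed
    qed (use S in simp)
    then have "s x \<le> S" using y(2)[of x] x r by force
    moreover have "(r / 2) ^ p * \<bar>u x\<bar> \<le> s x"
      unfolding s_def using x r by (intro mult_right_mono power_mono) (auto simp: d_def)
    ultimately have "(r / 2) ^ p * \<bar>u x\<bar> \<le> S" by linarith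
    then show ?thesis using r by (simp add: pos_le_divide_eq mult.commute)
  qed
  show ?thesis
    using main S r by (intro exI[of _ "S / (r / 2) ^ p"]) auto
qed

text \<open>The Hardy-Littlewood bound turns smallness in \<open>L\<^sup>q\<close> into smallness in \<open>L\<^sup>1\<close> on a smaller ball. The Laplacians
  then tend to zero in the sense of distributions there, so their pointwise limit vanishes as well.\<close>

lemma laplacian_limit_vanishes:
  fixes w :: "nat \<Rightarrow> real^'n::finite \<Rightarrow> real" and q r K :: real
  assumes q: "0 < q" "q \<le> 1" and r: "0 < r"
    and w: "\<And>n. smooth (w n)" "\<And>n z. \<bar>laplacian (w n) z\<bar> \<le> K"
    and lim0: "(\<lambda>n. LINT z|lborel. indicator (ball x0 r) z * \<bar>w n z\<bar> powr q) \<longlonglongrightarrow> 0"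
    and lim: "\<And>z. (\<lambda>n. laplacian (w n) z) \<longlonglongrightarrow> h z"
    and h: "continuous_on UNIV h"
  shows "h x0 = 0"
proof (rule ccontr)
  assume nz: "h x0 \<noteq> 0"
  define W where "W n = (LINT z|lborel. indicator (ball x0 r) z * \<bar>w n z\<bar> powr q)" for n
  have "bounded (range W)" using lim0 convergent_imp_bounded unfolding W_def by blast
  then obtain I where "\<And>n. \<bar>W n\<bar> \<le> I" unfolding bounded_iff by auto
  then have I: "W n \<le> I" for n by (meson abs_le_D1)
  obtain M where M0: "0 < M" "\<forall>u :: real^'n \<Rightarrow> real. smooth u \<longrightarrow> (\<forall>z. \<bar>laplacian u z\<bar> \<le> K) \<longrightarrow>
     (LINT z|lborel. indicator (ball x0 r) z * \<bar>u z\<bar> powr q) \<le> I \<longrightarrow>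
     (\<forall>x\<in>ball x0 (r / 2). \<bar>u x\<bar> \<le> M)"
    using hardy_littlewood_bound[OF q r, where K=K and I=I and ?x0.0=x0] by blast
  have M: "0 < M" "\<bar>w n x\<bar> \<le> M" if "x \<in> ball x0 (r / 2)" for n x
    using M0(1) M0(2)[rule_format, OF w(1) w(2) I[unfolded W_def] that] by auto
  have "isCont h x0" using h by (simp add: continuous_on_eq_continuous_at)
  then obtain \<delta> where \<delta>: "0 < \<delta>" "\<And>z. dist z x0 < \<delta> \<Longrightarrow> dist (h z) (h x0) < \<bar>h x0\<bar>"
    using nz unfolding continuous_at_eps_delta by (meson zero_less_abs_iff)
  define \<sigma> where "\<sigma> = min \<delta> (r / 2)"
  have \<sigma>: "0 < \<sigma>" "\<sigma> \<le> r / 2" "\<sigma> \<le> \<delta>" using \<delta> r by (auto simp: \<sigma>_def)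
  \<comment> \<open>a bump at \<open>x0\<close> of radius \<open>\<sigma>\<close>, so small that \<open>h\<close> keeps its sign on the support\<close>
  define \<kappa> where "\<kappa> z = bump 0 ((- (1 / \<sigma>)) *\<^sub>R x0 + (1 / \<sigma>) *\<^sub>R z)" for z
  have \<kappa>: "\<kappa> \<in> C0_infinity" unfolding \<kappa>_def[abs_def]
    by (rule C0_infinity_affine[OF bump_C0_infinity]) (use \<sigma> in simp)
  have arg: "norm ((- (1 / \<sigma>)) *\<^sub>R x0 + (1 / \<sigma>) *\<^sub>R z) = dist z x0 / \<sigma>" for z
  proof -
    have "(- (1 / \<sigma>)) *\<^sub>R x0 + (1 / \<sigma>) *\<^sub>R z = (1 / \<sigma>) *\<^sub>R (z - x0)" by (simp add: algebra_simps)
    then show ?thesis using \<sigma> by (simp add: dist_norm)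
  qed
  have \<kappa>0: "\<kappa> z = 0" if "\<sigma> \<le> dist z x0" for z
    unfolding \<kappa>_def using that \<sigma> by (intro bump_eq_0) (simp only: arg, simp)
  have \<kappa>pos: "0 < \<kappa> z" if "dist z x0 < \<sigma>" for z
    unfolding \<kappa>_def using that \<sigma> by (intro bump_pos) (simp only: arg, simp)
  have \<kappa>nn: "0 \<le> \<kappa> z" for z by (simp add: \<kappa>_def bump_nonneg)
  have lap0: "laplacian \<kappa> z = 0" if "\<sigma> < dist z x0" for z
  proof -
    have loc: "pderivative i f z = 0" if "\<And>z. \<sigma> < dist z x0 \<Longrightarrow> f z = 0" "\<sigma> < dist z x0" for f :: "real^'n \<Rightarrow> real" and i z
      by (rule pderivative_zero_on_open[of "{z. \<sigma> < dist z x0}"])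
        (use that in \<open>auto intro!: open_Collect_less continuous_intros\<close>)
    then show ?thesis unfolding laplacian_def using that \<kappa>0 by (intro sum.neutral ballI loc) auto
  qed
  obtain B where B: "0 < B" "\<And>z. \<bar>laplacian \<kappa> z\<bar> \<le> B"
    using C0_infinity_bounded[OF laplacian_C0_infinity[OF \<kappa>]] by blast
  have ik: "integrable lborel \<kappa>" by (rule C0_infinity_integrable[OF \<kappa>])
  have "(\<lambda>n. LINT z|lborel. laplacian (w n) z * \<kappa> z) \<longlonglongrightarrow> (LINT z|lborel. h z * \<kappa> z)"
  proof (rule integral_dominated_convergence[where w="\<lambda>z. K * \<kappa> z"])
    show "integrable lborel (\<lambda>z. K * \<kappa> z)" using ik by simp
    have m: "\<kappa> \<in> borel_measurable borel" by (rule smooth_measurable[OF C0_infinity_smooth[OF \<kappa>]])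
    show "(\<lambda>z. h z * \<kappa> z) \<in> borel_measurable lborel"
      using borel_measurable_continuous_onI[OF h] m by simp
    show "(\<lambda>z. laplacian (w n) z * \<kappa> z) \<in> borel_measurable lborel" for n
      using smooth_measurable[OF laplacian_smooth[OF w(1)]] m by simp
    show "AE z in lborel. (\<lambda>n. laplacian (w n) z * \<kappa> z) \<longlonglongrightarrow> h z * \<kappa> z"
      by (intro AE_I2 tendsto_intros lim)
    show "AE z in lborel. norm (laplacian (w n) z * \<kappa> z) \<le> K * \<kappa> z" for n
      using w(2) \<kappa>nn by (intro AE_I2) (simp add: abs_mult mult_right_mono)
  qed
  moreover have "(\<lambda>n. LINT z|lborel. laplacian (w n) z * \<kappa> z) \<longlonglongrightarrow> 0"
  proof (rule Lim_null_comparison)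
    show "(\<lambda>n. (B * M powr (1 - q)) * W n) \<longlonglongrightarrow> 0"
      using tendsto_mult_left[OF lim0, of "B * M powr (1 - q)"] unfolding W_def by simp
    show "\<forall>\<^sub>F n in sequentially. norm (LINT z|lborel. laplacian (w n) z * \<kappa> z) \<le> (B * M powr (1 - q)) * W n"
    proof (intro always_eventually allI)
      fix n
      have cw: "continuous_on UNIV (w n)" by (rule smooth_continuous[OF w(1)])
      have "\<bar>LINT z|lborel. laplacian (w n) z * \<kappa> z\<bar> = \<bar>LINT z|lborel. w n z * laplacian \<kappa> z\<bar>"
        by (simp add: laplacian_symmetric[OF w(1) \<kappa>])
      also have "\<dots> \<le> (LINT z|lborel. \<bar>w n z * laplacian \<kappa> z\<bar>)" by (rule integral_abs_bound)
      also have "\<dots> \<le> (LINT z|lborel. (B * M powr (1 - q)) * (indicator (ball x0 r) z * \<bar>w n z\<bar> powr q))"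
      proof (rule integral_mono)
        show "integrable lborel (\<lambda>z. \<bar>w n z * laplacian \<kappa> z\<bar>)"
          by (intro integrable_abs C0_infinity_integrable C0_infinity_mult w(1) laplacian_C0_infinity \<kappa>)
        show "integrable lborel (\<lambda>z. (B * M powr (1 - q)) * (indicator (ball x0 r) z * \<bar>w n z\<bar> powr q))"
          by (intro integrable_mult_right integrable_indicator_continuous continuous_on_abs_powr cw q)
        fix z
        show "\<bar>w n z * laplacian \<kappa> z\<bar> \<le> (B * M powr (1 - q)) * (indicator (ball x0 r) z * \<bar>w n z\<bar> powr q)"
        proof (cases "\<sigma> < dist z x0")
          case False
          then have z: "dist z x0 \<le> r / 2" using \<sigma> by simp
          have "\<bar>w n z\<bar> \<le> M"
          proof -
            have "closure (ball x0 (r / 2)) \<subseteq> {z. \<bar>w n z\<bar> \<le> M}"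
              using M(2) by (intro closure_minimal closed_Collect_le continuous_intros cw) auto
            then show ?thesis using z r by (auto simp: dist_commute subset_eq)
          qed
          then have "\<bar>w n z\<bar> \<le> M powr (1 - q) * \<bar>w n z\<bar> powr q"
            by (intro power_le_split_powr q) auto
          then have "\<bar>w n z\<bar> * \<bar>laplacian \<kappa> z\<bar> \<le> (M powr (1 - q) * \<bar>w n z\<bar> powr q) * B"
            using B by (intro mult_mono) auto
          moreover have "z \<in> ball x0 r" using z r by (simp add: dist_commute)
          ultimately show ?thesis by (simp add: abs_mult mult_ac)
        qed (use lap0 B in simp)
      qed
      also have "\<dots> = (B * M powr (1 - q)) * W n" by (simp add: W_def)
      finally show "norm (LINT z|lborel. laplacian (w n) z * \<kappa> z) \<le> (B * M powr (1 - q)) * W n" by simp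
    qed
  qed
  ultimately have zero: "(LINT z|lborel. h z * \<kappa> z) = 0" by (rule LIMSEQ_unique)
  have c: "continuous_on UNIV (\<lambda>z. h x0 * (h z * \<kappa> z))"
    by (intro continuous_intros h smooth_continuous C0_infinity_smooth \<kappa>)
  have sgn: "0 < h x0 * h z" if "dist z x0 < \<sigma>" for z
    using \<delta>(2)[of z] that \<sigma> by (auto simp: dist_real_def zero_less_mult_iff)
  have "0 < (LINT z|lborel. h x0 * (h z * \<kappa> z))"
  proof (rule integral_pos_of_ball[OF _ _ \<sigma>(1)])
    obtain R where "\<And>z. R < norm z \<Longrightarrow> \<kappa> z = 0" using \<kappa> by (rule C0_infinityE) blast
    then show "integrable lborel (\<lambda>z. h x0 * (h z * \<kappa> z))"
      by (intro integrable_continuous_compact_support[OF c]) auto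
    show "0 \<le> h x0 * (h z * \<kappa> z)" for z
      using sgn[of z] \<kappa>0[of z] \<kappa>nn[of z] by (cases "dist z x0 < \<sigma>") (auto simp flip: mult.assoc)
    show "0 < h x0 * (h z * \<kappa> z)" if "z \<in> ball x0 \<sigma>" for z
      using sgn[of z] \<kappa>pos[of z] that by (auto simp: dist_commute simp flip: mult.assoc)
  qed
  then show False using zero by simp
qed

section \<open>The balance of stresses at a fixed time\<close>

lemma seq_tempered_comp:
  assumes L: "seq_tempered L"
    and T: "\<And>\<psi>. \<psi> \<in> schwartz \<Longrightarrow> T \<psi> \<in> schwartz"
    and add: "\<And>\<psi> \<eta>. \<psi> \<in> schwartz \<Longrightarrow> \<eta> \<in> schwartz \<Longrightarrow> T (\<lambda>x. \<psi> x + \<eta> x) = (\<lambda>x. T \<psi> x + T \<eta> x)"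
    and cmult: "\<And>c \<psi>. \<psi> \<in> schwartz \<Longrightarrow> T (\<lambda>x. c * \<psi> x) = (\<lambda>x. c * T \<psi> x)"
    and null: "\<And>e. schwartz_null e \<Longrightarrow> schwartz_null (\<lambda>n. T (e n))"
  shows "seq_tempered (\<lambda>\<psi>. L (T \<psi>))"
  unfolding seq_tempered_def
proof (intro conjI ballI allI impI)
  show "L (T (\<lambda>x. \<psi> x + \<eta> x)) = L (T \<psi>) + L (T \<eta>)" if "\<psi> \<in> schwartz" "\<eta> \<in> schwartz" for \<psi> \<eta>
    unfolding add[OF that] by (intro seq_tempered_add L T that)
  show "L (T (\<lambda>x. c * \<psi> x)) = c * L (T \<psi>)" if "\<psi> \<in> schwartz" for c \<psi>
    unfolding cmult[OF that] by (intro seq_tempered_cmult L T that)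
  show "(\<lambda>n. L (T (e n))) \<longlonglongrightarrow> 0" if "schwartz_null e" for e
    by (intro seq_tempered_null[OF L] null that)
qed

lemma seq_tempered_pderivative:
  assumes "seq_tempered L" shows "seq_tempered (\<lambda>\<psi>. L (pderivative i \<psi>))"
  by (rule seq_tempered_comp[OF assms])
    (auto intro: schwartz_pderivative schwartz_null_pderivative
       intro!: pderivative_add pderivative_cmult smooth_differentiable schwartz_smooth)

lemma pderivative_smooth_add:
  "smooth f \<Longrightarrow> smooth g \<Longrightarrow> pderivative i (\<lambda>x. f x + g x) = (\<lambda>x. pderivative i f x + pderivative i g x)"
  by (intro ext pderivative_add smooth_differentiable)

lemma pderivative_smooth_cmult:
  "smooth f \<Longrightarrow> pderivative i (\<lambda>x. c * f x) = (\<lambda>x. c * pderivative i f x)"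
  by (intro ext pderivative_cmult smooth_differentiable)

lemma pderivative_smooth_mult:
  "smooth f \<Longrightarrow> smooth g \<Longrightarrow>
    pderivative i (\<lambda>x. f x * g x) = (\<lambda>x. f x * pderivative i g x + pderivative i f x * g x)"
  by (intro ext pderivative_mult smooth_differentiable)

lemma pderivative_smooth_affine:
  "smooth f \<Longrightarrow> pderivative i (\<lambda>x. f (a + c *\<^sub>R x)) = (\<lambda>x. c * pderivative i f (a + c *\<^sub>R x))"
  by (intro ext pderivative_affine smooth_differentiable)

lemma pderivative_smooth_sum:
  assumes "\<And>k. k \<in> I \<Longrightarrow> smooth (f k)"
  shows "pderivative i (\<lambda>x. \<Sum>k\<in>I. f k x) = (\<lambda>x. \<Sum>k\<in>I. pderivative i (f k) x)"
  using iterated_pderivative_sum[OF assms, where \<alpha>="[i]"] by simp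

lemma seq_tempered_laplacian:
  assumes "seq_tempered L" shows "seq_tempered (\<lambda>\<psi>. L (laplacian \<psi>))"
  by (rule seq_tempered_comp[OF assms laplacian_schwartz _ _ schwartz_null_laplacian])
    (auto simp: laplacian_def[abs_def] pderivative_smooth_add pderivative_smooth_cmult smooth_pderivative
         schwartz_smooth sum.distrib sum_distrib_left)

lemma seq_tempered_plus:
  assumes "seq_tempered L" "seq_tempered M" shows "seq_tempered (\<lambda>\<psi>. L \<psi> + M \<psi>)"
  using assms unfolding seq_tempered_def
  by (auto simp: distrib_left intro!: tendsto_add_zero)

lemma seq_tempered_const_zero: "seq_tempered (\<lambda>\<psi>. 0)"
  by (simp add: seq_tempered_def)

lemma seq_tempered_sum_functional:
  "(\<And>i. i \<in> I \<Longrightarrow> seq_tempered (L i)) \<Longrightarrow> seq_tempered (\<lambda>\<psi>. \<Sum>i\<in>I. L i \<psi>)"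
  by (induction I rule: infinite_finite_induct) (auto intro: seq_tempered_const_zero seq_tempered_plus)

text \<open>This functional vanishes on test functions exactly if \<open>\<Delta>p + \<Sum>\<^sub>i\<^sub>j \<partial>\<^sub>i \<partial>\<^sub>j F\<^sub>i\<^sub>j = 0\<close> in the sense of
  distributions.\<close>

definition balance ::
    "'n::finite functional \<Rightarrow> ('n \<Rightarrow> 'n \<Rightarrow> real^'n \<Rightarrow> real) \<Rightarrow> 'n functional" where
  "balance p F \<psi> = p (laplacian \<psi>)
     + (\<Sum>i\<in>UNIV. \<Sum>j\<in>UNIV. LINT x|lebesgue. F i j x * pderivative i (pderivative j \<psi>) x)"

lemma seq_tempered_balance:
  assumes "seq_tempered p" "\<And>i j. integrable lebesgue (F i j)"
  shows "seq_tempered (balance p F)"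
  unfolding balance_def[abs_def]
  by (intro seq_tempered_plus seq_tempered_laplacian seq_tempered_sum_functional assms(1)
      seq_tempered_pderivative[OF seq_tempered_pderivative[OF seq_tempered_integral[OF assms(2)]]])

definition unit_bump :: "real^'n::finite \<Rightarrow> real" where
  "unit_bump x = exp 1 * bump 0 x"

lemma unit_bump: "unit_bump \<in> C0_infinity" "unit_bump 0 = 1"
proof -
  show "unit_bump \<in> C0_infinity" unfolding unit_bump_def[abs_def]
    by (rule C0_infinity_mult[OF smooth_const bump_C0_infinity])
  show "unit_bump 0 = 1" by (simp add: unit_bump_def bump_def exp_inv_def flip: exp_add)
qed

definition bumped_square :: "'n::finite \<Rightarrow> real^'n \<Rightarrow> real" where
  "bumped_square k x = (x $ k * x $ k / 2) * unit_bump x"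

lemma bumped_square_C0_infinity: "bumped_square k \<in> C0_infinity"
proof -
  have "smooth (\<lambda>x::real^'a. (1 / 2) * (x $ k * x $ k))"
    by (intro smooth_cmult smooth_mult smooth_coordinate)
  from C0_infinity_mult[OF this unit_bump(1)] show ?thesis
    by (simp add: bumped_square_def[abs_def])
qed

lemma bumped_square_hessian:
  "pderivative i (pderivative j (bumped_square k)) 0 = (if i = k \<and> j = k then 1 else 0)"
proof -
  define q where "q = (\<lambda>x::real^'a. (1 / 2) * (x $ k * x $ k))"
  define l where "l m = (\<lambda>x::real^'a. x $ k * (if m = k then 1 else 0))" for m
  have sl: "smooth (l m)" for m unfolding l_def by (intro smooth_mult smooth_coordinate smooth_const)
  have sq: "smooth q" unfolding q_def by (intro smooth_cmult smooth_mult smooth_coordinate)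
  have sb: "smooth unit_bump" by (rule C0_infinity_smooth[OF unit_bump(1)])
  have eq: "bumped_square k = (\<lambda>x. q x * unit_bump x)"
    by (simp add: bumped_square_def[abs_def] q_def)
  have dq: "pderivative m q = l m" for m
    unfolding q_def l_def
    by (subst pderivative_smooth_cmult) (auto simp: pderivative_smooth_mult smooth_mult smooth_coordinate pderivative_coordinate)
  have dl: "pderivative n (l m) = (\<lambda>x. (if n = k then 1 else 0) * (if m = k then 1 else 0))" for n m
    unfolding l_def
    by (simp add: pderivative_smooth_mult smooth_coordinate smooth_const pderivative_coordinate)
  have "pderivative i (pderivative j (bumped_square k)) =
    (\<lambda>x. (q x * pderivative i (pderivative j unit_bump) x + l i x * pderivative j unit_bump x)
      + (l j x * pderivative i unit_bump x + (if i = k then 1 else 0) * (if j = k then 1 else 0) * unit_bump x))"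
    unfolding eq
    by (simp add: pderivative_smooth_mult pderivative_smooth_add smooth_mult sq sb sl smooth_pderivative dq dl)
  then show ?thesis by (simp add: q_def l_def unit_bump(2))
qed

text \<open>The scaling leaves the Hessian bounded and makes it converge pointwise to its value at the origin,
  the matrix \<open>e\<^sub>k \<otimes> e\<^sub>k\<close>.\<close>

definition quadratic_test :: "'n::finite \<Rightarrow> nat \<Rightarrow> real^'n \<Rightarrow> real" where
  "quadratic_test k m x = (real (Suc m))\<^sup>2 * bumped_square k ((1 / real (Suc m)) *\<^sub>R x)"

lemma quadratic_test_C0_infinity: "quadratic_test k m \<in> C0_infinity"
proof -
  have "(\<lambda>x. bumped_square k (0 + (1 / real (Suc m)) *\<^sub>R x)) \<in> C0_infinity"
    by (rule C0_infinity_affine[OF bumped_square_C0_infinity]) simp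
  from C0_infinity_mult[OF smooth_const this, of "(real (Suc m))\<^sup>2"] show ?thesis
    unfolding quadratic_test_def[abs_def] by simp
qed

lemma quadratic_test_hessian:
  "pderivative i (pderivative j (quadratic_test k m))
    = (\<lambda>x. pderivative i (pderivative j (bumped_square k)) ((1 / real (Suc m)) *\<^sub>R x))"
proof -
  define c where "c = 1 / real (Suc m)"
  have c: "(real (Suc m))\<^sup>2 * (c * c) = 1" by (simp add: c_def power2_eq_square)
  have s: "smooth (bumped_square k)" by (rule C0_infinity_smooth[OF bumped_square_C0_infinity])
  have aff: "pderivative n (\<lambda>x. f (c *\<^sub>R x)) = (\<lambda>x. c * pderivative n f (c *\<^sub>R x))" if "smooth f" for f n
    using pderivative_smooth_affine[OF that, of n 0 c] by simp
  have sc: "smooth (\<lambda>x. f (c *\<^sub>R x))" if "smooth f" for f :: "real^'a \<Rightarrow> real"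
    using smooth_affine[OF that, of 0 c] by simp
  show ?thesis
    unfolding quadratic_test_def[abs_def] c_def[symmetric]
    by (simp only: pderivative_smooth_cmult aff sc s smooth_pderivative smooth_cmult mult.assoc[symmetric])
      (simp only: mult.assoc c, simp)
qed

lemma quadratic_test_limit:
  fixes G :: "real^'n::finite \<Rightarrow> real"
  assumes G: "integrable lebesgue G"
  shows "(\<lambda>m. LINT x|lebesgue. G x * pderivative i (pderivative j (quadratic_test k m)) x)
    \<longlonglongrightarrow> (if i = k \<and> j = k then 1 else 0) * (LINT x|lebesgue. G x)"
proof -
  let ?g = "pderivative i (pderivative j (bumped_square k))"
  have g: "?g \<in> C0_infinity" by (intro C0_infinity_pderivative bumped_square_C0_infinity)
  obtain B where "\<And>x. \<bar>?g x\<bar> \<le> B" using C0_infinity_bounded[OF g] by blast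
  from integral_dilation_limit[OF G smooth_continuous[OF C0_infinity_smooth[OF g]] this LIMSEQ_inverse_Suc, of 0]
  show ?thesis by (simp add: quadratic_test_hessian bumped_square_hessian mult.commute)
qed

lemma sum_delta_mult: "(\<Sum>j\<in>UNIV. (if j = k then 1 else 0) * g j) = (g (k::'a::finite) :: real)"
proof -
  have "(\<Sum>j\<in>UNIV. (if j = k then 1 else 0) * g j) = (\<Sum>j\<in>UNIV. if j = k then g j else 0)"
    by (intro sum.cong) auto
  then show ?thesis by simp
qed

lemma integral_quadratic_test_limit:
  fixes F :: "'n::finite \<Rightarrow> 'n \<Rightarrow> real^'n \<Rightarrow> real"
  assumes F: "\<And>i j. integrable lebesgue (F i j)"
  shows "(\<lambda>m. \<Sum>i\<in>UNIV. \<Sum>j\<in>UNIV. LINT x|lebesgue. F i j x * pderivative i (pderivative j (quadratic_test k m)) x)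
    \<longlonglongrightarrow> (LINT x|lebesgue. F k k x)"
proof -
  have "(\<Sum>i\<in>UNIV. \<Sum>j\<in>UNIV. (if i = k \<and> j = k then 1 else 0) * (LINT x|lebesgue. F i j x))
      = (\<Sum>i\<in>UNIV. (if i = k then 1 else 0) * (\<Sum>j\<in>UNIV. (if j = k then 1 else 0) * (LINT x|lebesgue. F i j x)))"
    by (intro sum.cong refl) simp
  also have "\<dots> = (LINT x|lebesgue. F k k x)" unfolding sum_delta_mult ..
  finally have eq: "(\<Sum>i\<in>UNIV. \<Sum>j\<in>UNIV. (if i = k \<and> j = k then 1 else 0) * (LINT x|lebesgue. F i j x))
      = (LINT x|lebesgue. F k k x)" .
  show ?thesis unfolding eq[symmetric] by (intro tendsto_sum quadratic_test_limit F)
qed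

text \<open>Along the quadratic test functions \<open>\<langle>p, \<Delta>\<psi>\<^sub>m\<rangle>\<close> tends to the integral of \<open>f\<close>, since \<open>\<Delta>\<psi>\<^sub>m\<close> tends boundedly to one.\<close>

lemma balance_integrable_pressure:
  fixes F :: "'n::finite \<Rightarrow> 'n \<Rightarrow> real^'n \<Rightarrow> real"
  assumes F: "\<And>i j. integrable lebesgue (F i j)" and f: "integrable lebesgue f"
    and p: "\<And>\<psi>. \<psi> \<in> schwartz \<Longrightarrow> p \<psi> = (LINT x|lebesgue. f x * \<psi> x)"
    and bal: "\<And>m. balance p F (quadratic_test k m) = 0"
  shows "(LINT x|lebesgue. F k k x) = - (LINT x|lebesgue. f x)"
proof -
  have int: "integrable lebesgue (\<lambda>x. f x * pderivative i (pderivative i (quadratic_test k m)) x)" for i m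
  proof -
    have g: "pderivative i (pderivative i (quadratic_test k m)) \<in> C0_infinity"
      by (intro C0_infinity_pderivative quadratic_test_C0_infinity)
    show ?thesis
      by (rule C0_infinity_bounded[OF g])
        (rule integrable_mult_bounded_continuous[OF f smooth_continuous[OF C0_infinity_smooth[OF g]]])
  qed
  have "p (laplacian (quadratic_test k m))
      = (\<Sum>i\<in>UNIV. LINT x|lebesgue. f x * pderivative i (pderivative i (quadratic_test k m)) x)" for m
  proof -
    have "laplacian (quadratic_test k m) \<in> schwartz"
      by (intro C0_infinity_schwartz laplacian_C0_infinity quadratic_test_C0_infinity)
    then have "p (laplacian (quadratic_test k m)) = (LINT x|lebesgue. f x * laplacian (quadratic_test k m) x)"
      by (rule p)
    then show ?thesis unfolding laplacian_def sum_distrib_left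
      using int by (simp add: Bochner_Integration.integral_sum)
  qed
  moreover have "(\<Sum>i\<in>UNIV. (if i = k \<and> i = k then 1 else 0) * (LINT x|lebesgue. f x)) = (LINT x|lebesgue. f x)"
    using sum_delta_mult[of k "\<lambda>i. LINT x|lebesgue. f x"] by simp
  moreover have "(\<lambda>m. \<Sum>i\<in>UNIV. LINT x|lebesgue. f x * pderivative i (pderivative i (quadratic_test k m)) x)
      \<longlonglongrightarrow> (\<Sum>i\<in>UNIV. (if i = k \<and> i = k then 1 else 0) * (LINT x|lebesgue. f x))"
    by (intro tendsto_sum quadratic_test_limit f)
  ultimately have "(\<lambda>m. p (laplacian (quadratic_test k m))) \<longlonglongrightarrow> (LINT x|lebesgue. f x)"
    by simp
  from tendsto_add[OF this integral_quadratic_test_limit[where F=F and k=k, OF F]]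
  have "(\<lambda>m. 0) \<longlonglongrightarrow> (LINT x|lebesgue. f x) + (LINT x|lebesgue. F k k x)"
    using bal by (simp add: balance_def)
  then show ?thesis by (simp add: LIMSEQ_const_iff)
qed

text \<open>Compactly supported approximations of the kernels \<open>\<phi>(y - x/n)\<close>, whose pairings with the pressure are its
  rescaled regularisations.\<close>

definition cutoff_test :: "(real^'n::finite \<Rightarrow> real) \<Rightarrow> nat \<Rightarrow> nat \<Rightarrow> real^'n \<Rightarrow> real^'n \<Rightarrow> real" where
  "cutoff_test \<phi> n m y x = unit_bump ((1 / real (Suc m)) *\<^sub>R x) * \<phi> (y + (- (1 / real (Suc n))) *\<^sub>R x)"

lemma cutoff_test_C0_infinity: "\<phi> \<in> schwartz \<Longrightarrow> cutoff_test \<phi> n m y \<in> C0_infinity"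
  unfolding cutoff_test_def[abs_def]
  using C0_infinity_affine[OF unit_bump(1), of "1 / real (Suc m)" 0]
  by (intro C0_infinity_mult' smooth_affine schwartz_smooth) auto

lemma laplacian_translate:
  assumes L: "seq_tempered L" and \<phi>: "\<phi> \<in> schwartz"
  shows "laplacian (\<lambda>y. L (\<lambda>z. \<phi> (y + z))) = (\<lambda>y. L (\<lambda>z. laplacian \<phi> (y + z)))"
proof
  fix y
  have "(\<lambda>z. pderivative i (pderivative i \<phi>) (y + z)) \<in> schwartz" for i
    using schwartz_affine[OF schwartz_pderivative[OF schwartz_pderivative[OF \<phi>]], of 1 i i y] by simp
  then show "laplacian (\<lambda>y. L (\<lambda>z. \<phi> (y + z))) y = L (\<lambda>z. laplacian \<phi> (y + z))"
    unfolding laplacian_def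
    by (simp add: seq_tempered_sum[OF L] pderivative_translate[OF L] schwartz_pderivative \<phi>)
qed

lemma laplacian_affine:
  assumes "smooth f"
  shows "laplacian (\<lambda>x. f (a + c *\<^sub>R x)) = (\<lambda>x. c\<^sup>2 * laplacian f (a + c *\<^sub>R x))"
  unfolding laplacian_def[abs_def] using assms
  by (simp add: pderivative_smooth_affine pderivative_smooth_cmult smooth_affine smooth_pderivative
      sum_distrib_left power2_eq_square mult.assoc)

text \<open>The cutoffs converge in the Schwartz class, and the limit depends continuously on \<open>y\<close>. Hence the
  balance for all kernels follows from countably many test functions. This matters because the null
  set of exceptional times depends on the test function.\<close>

lemma balance_dilated_kernel:
  fixes F :: "'n::finite \<Rightarrow> 'n \<Rightarrow> real^'n \<Rightarrow> real"
  assumes p: "seq_tempered p" and F: "\<And>i j. integrable lebesgue (F i j)" and \<phi>: "\<phi> \<in> schwartz"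
    and D: "closure D = UNIV" and bal: "\<And>m y. y \<in> D \<Longrightarrow> balance p F (cutoff_test \<phi> n m y) = 0"
  shows "balance p F (\<lambda>x. \<phi> (y + (- (1 / real (Suc n))) *\<^sub>R x)) = 0"
proof -
  let ?c = "- (1 / real (Suc n))"
  have c: "?c \<noteq> 0" by simp
  note L = seq_tempered_balance[OF p F]
  let ?u = "\<lambda>y. balance p F (\<lambda>x. \<phi> (y + ?c *\<^sub>R x))"
  have sch: "(\<lambda>x. \<phi> (y + ?c *\<^sub>R x)) \<in> schwartz" for y by (rule schwartz_affine[OF \<phi> c])
  have "?u y = 0" if "y \<in> D" for y
  proof -
    have "(\<lambda>m. balance p F (cutoff_test \<phi> n m y)) \<longlonglongrightarrow> ?u y"
    proof (rule seq_tempered_LIMSEQ[OF L sch])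
      show "cutoff_test \<phi> n m y \<in> schwartz" for m
        by (intro C0_infinity_schwartz cutoff_test_C0_infinity \<phi>)
      show "schwartz_null (\<lambda>m x. cutoff_test \<phi> n m y x - \<phi> (y + ?c *\<^sub>R x))"
        unfolding cutoff_test_def by (rule cutoff_converges[OF unit_bump sch])
    qed
    then show ?thesis using bal[OF that] by (simp add: LIMSEQ_const_iff)
  qed
  moreover have "continuous_on UNIV ?u"
    by (rule smooth_continuous[OF smooth_translate[OF seq_tempered_scale[OF L c] \<phi>]])
  then have "closed {y. ?u y = 0}" by (intro closed_Collect_eq) auto
  ultimately have "closure D \<subseteq> {y. ?u y = 0}" by (intro closure_minimal) auto
  then show ?thesis using D by blast
qed

text \<open>The Laplacian in \<open>y\<close> and the Laplacian of the kernel in \<open>x\<close> differ by the factor \<open>n\<^sup>2\<close>, so the balance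
  expresses \<open>\<Delta>w\<close> by the stress alone.\<close>

lemma balance_laplacian:
  fixes F :: "'n::finite \<Rightarrow> 'n \<Rightarrow> real^'n \<Rightarrow> real"
  assumes p: "seq_tempered p" and \<phi>: "\<phi> \<in> schwartz"
    and bal: "\<And>y. balance p F (\<lambda>x. \<phi> (y + (- (1 / real (Suc n))) *\<^sub>R x)) = 0"
  defines "w \<equiv> \<lambda>y. p (\<lambda>z. \<phi> (y + (- (1 / real (Suc n))) *\<^sub>R z))"
  shows "smooth w"
    and "laplacian w y = - (\<Sum>i\<in>UNIV. \<Sum>j\<in>UNIV. LINT x|lebesgue. F i j x *
      pderivative i (pderivative j \<phi>) (y + (- (1 / real (Suc n))) *\<^sub>R x))"
proof -
  define c where "c = - (1 / real (Suc n))"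
  have c: "c \<noteq> 0" by (simp add: c_def)
  note L = seq_tempered_scale[OF p c]
  show "smooth w" unfolding w_def c_def[symmetric] by (rule smooth_translate[OF L \<phi>])
  have lw: "laplacian w y = p (\<lambda>z. laplacian \<phi> (y + c *\<^sub>R z))"
    unfolding w_def c_def[symmetric] by (simp only: laplacian_translate[OF L \<phi>])
  have sch: "(\<lambda>z. laplacian \<phi> (y + c *\<^sub>R z)) \<in> schwartz"
    by (rule schwartz_affine[OF laplacian_schwartz[OF \<phi>] c])
  have hess: "pderivative i (pderivative j (\<lambda>x. \<phi> (y + c *\<^sub>R x)))
     = (\<lambda>x. c\<^sup>2 * pderivative i (pderivative j \<phi>) (y + c *\<^sub>R x))" for i j
    using schwartz_smooth[OF \<phi>]
    by (simp add: pderivative_smooth_affine pderivative_smooth_cmult smooth_affine smooth_pderivative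
      power2_eq_square mult.assoc)
  have "0 = c\<^sup>2 * laplacian w y + (\<Sum>i\<in>UNIV. \<Sum>j\<in>UNIV. c\<^sup>2 * (LINT x|lebesgue. F i j x *
      pderivative i (pderivative j \<phi>) (y + c *\<^sub>R x)))"
    using bal[of y] unfolding balance_def c_def[symmetric]
    by (simp add: hess laplacian_affine schwartz_smooth \<phi> seq_tempered_cmult[OF p sch] lw mult.left_commute[of _ "c\<^sup>2"])
  also have "\<dots> = c\<^sup>2 * (laplacian w y + (\<Sum>i\<in>UNIV. \<Sum>j\<in>UNIV. LINT x|lebesgue. F i j x *
      pderivative i (pderivative j \<phi>) (y + c *\<^sub>R x)))"
    by (simp add: sum_distrib_left distrib_left)
  finally show "laplacian w y = - (\<Sum>i\<in>UNIV. \<Sum>j\<in>UNIV. LINT x|lebesgue. F i j x *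
      pderivative i (pderivative j \<phi>) (y + (- (1 / real (Suc n))) *\<^sub>R x))"
    using c unfolding c_def[symmetric] by simp
qed

lemma dilated_kernel_limit:
  fixes G g :: "real^'n::finite \<Rightarrow> real"
  assumes G: "integrable lebesgue G" and g: "g \<in> schwartz"
  shows "(\<lambda>n. LINT x|lebesgue. G x * g (y + (- (1 / real (Suc n))) *\<^sub>R x)) \<longlonglongrightarrow> (LINT x|lebesgue. G x) * g y"
    and "\<exists>B. \<forall>n y. \<bar>LINT x|lebesgue. G x * g (y + (- (1 / real (Suc n))) *\<^sub>R x)\<bar> \<le> B"
proof -
  obtain B where B: "0 < B" "\<And>x. \<bar>g x\<bar> \<le> B" using schwartz_bounded[OF g] by blast
  have sg: "smooth g" by (rule schwartz_smooth[OF g])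
  show "(\<lambda>n. LINT x|lebesgue. G x * g (y + (- (1 / real (Suc n))) *\<^sub>R x)) \<longlonglongrightarrow> (LINT x|lebesgue. G x) * g y"
    using tendsto_minus[OF LIMSEQ_inverse_Suc]
    by (intro integral_dilation_limit[OF G smooth_continuous[OF sg] B(2)]) simp
  show "\<exists>B. \<forall>n y. \<bar>LINT x|lebesgue. G x * g (y + (- (1 / real (Suc n))) *\<^sub>R x)\<bar> \<le> B"
    using integral_mult_bounded_le[OF G smooth_continuous[OF smooth_affine[OF sg]] B(2)] by blast
qed

section \<open>Pressures in a Hardy space\<close>

lemma ennreal_powr_mono_real:
  assumes "ennreal a \<le> M" "0 \<le> a" "0 < q"
  shows "ennreal (a powr q) \<le> ennreal_powr M q"
proof (cases "M = \<infinity>")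
  case False
  then have "a \<le> enn2real M" using assms
    by (metis enn2real_ennreal enn2real_mono ennreal_less_top infinity_ennreal_def less_top)
  then show ?thesis using assms False by (auto simp: ennreal_powr_def intro!: ennreal_leI powr_mono2)
qed (simp add: ennreal_powr_def)

text \<open>Since \<open>w\<^sub>n(y) = n\<^sup>N (p * \<phi>\<^sub>n)(ny)\<close>, a change of variables bounds the integral of \<open>|w\<^sub>n|\<^sup>q\<close> over a ball that
  avoids the origin by \<open>n\<^sup>N\<^sup>q\<^sup>-\<^sup>N\<close> times the integral of \<open>M\<^sup>q\<close> over \<open>|x| \<ge> n |x0|/2\<close>, where \<open>M\<close> is the maximal
  function of \<open>p\<close>.\<close>

lemma hardy_decay:
  fixes p :: "'n::finite functional" and \<phi> :: "real^'n \<Rightarrow> real"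
  assumes q: "0 < q" "q \<le> 1" and \<phi>: "\<phi> \<in> schwartz"
    and p: "p \<in> hardy \<phi> q" and x0: "x0 \<noteq> 0"
  defines "w \<equiv> \<lambda>n y. p (\<lambda>z. \<phi> (y + (- (1 / real (Suc n))) *\<^sub>R z))"
  assumes w: "\<And>n. continuous_on UNIV (w n)"
  shows "(\<lambda>n. LINT z|lborel. indicator (ball x0 (norm x0 / 2)) z * \<bar>w n z\<bar> powr q) \<longlonglongrightarrow> 0"
proof -
  let ?N = "CARD('n)"
  let ?B = "ball x0 (norm x0 / 2)"
  have tp: "seq_tempered p" using p by (auto simp: hardy_def intro: tempered_seq_tempered)
  define M where "M = maximal_function \<phi> p"
  define Q where "Q x = ennreal_powr (M x) q" for x
  have M[measurable]: "M \<in> borel_measurable lebesgue" using p by (simp add: hardy_def M_def)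
  have Qm: "Q \<in> borel_measurable lebesgue"
    unfolding Q_def ennreal_powr_def by measurable
  have Qfin: "(\<integral>\<^sup>+x. Q x \<partial>lebesgue) < \<infinity>"
    using p unfolding hardy_def hardy_norm_def Q_def M_def
    by (auto simp: ennreal_powr_def less_top split: if_splits)
  define g where "g n x = \<bar>w n ((1 / real (Suc n)) *\<^sub>R x) / real (Suc n) ^ ?N\<bar> powr q" for n x
  have gQ: "ennreal (g n x) \<le> Q x" for n x
  proof -
    have "dilate \<phi> (real (Suc n)) (x - z) = (1 / real (Suc n) ^ ?N) *
        \<phi> ((1 / real (Suc n)) *\<^sub>R x + (- (1 / real (Suc n))) *\<^sub>R z)" for z
      unfolding dilate_def by (simp add: scaleR_diff_right)
    then have "convolution p (dilate \<phi> (real (Suc n))) x = p (\<lambda>z. (1 / real (Suc n) ^ ?N) *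
        \<phi> ((1 / real (Suc n)) *\<^sub>R x + (- (1 / real (Suc n))) *\<^sub>R z))"
      unfolding convolution_def by presburger
    also have "\<dots> = (1 / real (Suc n) ^ ?N) * w n ((1 / real (Suc n)) *\<^sub>R x)"
      unfolding w_def by (intro seq_tempered_cmult[OF tp] schwartz_affine[OF \<phi>]) simp
    finally have conv: "convolution p (dilate \<phi> (real (Suc n))) x = w n ((1 / real (Suc n)) *\<^sub>R x) / real (Suc n) ^ ?N"
      by simp
    have "ennreal \<bar>convolution p (dilate \<phi> (real (Suc n))) x\<bar> \<le> M x"
      unfolding M_def maximal_function_def by (intro SUP_upper) simp
    then show ?thesis unfolding g_def Q_def conv[symmetric] by (intro ennreal_powr_mono_real q) auto
  qed
  define b where "b n = (\<integral>\<^sup>+x. indicator {x. real (Suc n) * (norm x0 / 2) \<le> norm x} x * Q x \<partial>lebesgue)" for n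
  have le: "ennreal (LINT z|lborel. indicator ?B z * \<bar>w n z\<bar> powr q) \<le> b n" for n
  proof -
    define N where "N = real (Suc n)"
    have N: "1 \<le> N" by (simp add: N_def)
    define f where "f x = indicator ?B ((1 / N) *\<^sub>R x) * g n x" for x
    have ind: "indicator ?B ((1 / N) *\<^sub>R x) = (indicator (ball (N *\<^sub>R x0) (N * (norm x0 / 2))) x :: real)" for x
    proof -
      have "x0 - (1 / N) *\<^sub>R x = (1 / N) *\<^sub>R (N *\<^sub>R x0 - x)" using N by (simp add: scaleR_diff_right)
      then have "dist x0 ((1 / N) *\<^sub>R x) = dist (N *\<^sub>R x0) x / N" using N by (simp add: dist_norm)
      moreover have "dist (N *\<^sub>R x0) x / N < norm x0 / 2 \<longleftrightarrow> dist (N *\<^sub>R x0) x < N * (norm x0 / 2)"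
        using N by (simp add: field_simps)
      ultimately show ?thesis by (simp add: indicator_def)
    qed
    have "continuous_on UNIV (\<lambda>x. w n ((1 / N) *\<^sub>R x) / N ^ ?N)"
      by (intro continuous_intros continuous_on_compose2[OF w]) (use N in auto)
    then have cg: "continuous_on UNIV (g n)"
      unfolding g_def N_def[symmetric] by (intro continuous_on_abs_powr q)
    have fi: "integrable lborel f" unfolding f_def ind by (rule integrable_indicator_continuous[OF cg])
    have fm: "f \<in> borel_measurable borel" using fi by simp
    have pt: "indicator ?B z * \<bar>w n z\<bar> powr q = (N ^ ?N) powr q * f (0 + N *\<^sub>R z)" for z
      unfolding f_def g_def N_def[symmetric] using N by (simp add: abs_divide powr_divide)
    have "(LINT z|lborel. indicator ?B z * \<bar>w n z\<bar> powr q) = (N ^ ?N) powr q * ((LINT x|lborel. f x) / N ^ ?N)"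
      unfolding pt using lborel_integral_affine[OF fm, of N 0] N by simp
    also have "\<dots> = ((N ^ ?N) powr q / N ^ ?N) * (LINT x|lborel. f x)" by simp
    also have "\<dots> \<le> 1 * (LINT x|lborel. f x)"
    proof (rule mult_right_mono)
      \<comment> \<open>the scaling is favourable precisely for exponents \<open>q \<le> 1\<close>\<close>
      have "(N ^ ?N) powr q \<le> (N ^ ?N) powr 1" using N q by (intro powr_mono) auto
      then show "(N ^ ?N) powr q / N ^ ?N \<le> 1" using N by simp
      show "0 \<le> (LINT x|lborel. f x)" by (intro Bochner_Integration.integral_nonneg) (auto simp: f_def g_def)
    qed
    finally have "ennreal (LINT z|lborel. indicator ?B z * \<bar>w n z\<bar> powr q) \<le> ennreal (LINT x|lborel. f x)"
      by (simp add: ennreal_leI)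
    also have "\<dots> = (\<integral>\<^sup>+x. ennreal (f x) \<partial>lborel)"
      by (rule nn_integral_eq_integral[symmetric, OF fi]) (auto simp: f_def g_def)
    also have "\<dots> = (\<integral>\<^sup>+x. ennreal (f x) \<partial>lebesgue)" by (rule nn_integral_completion[symmetric])
    also have "\<dots> \<le> b n" unfolding b_def
    proof (rule nn_integral_mono)
      fix x
      show "ennreal (f x) \<le> indicator {x. real (Suc n) * (norm x0 / 2) \<le> norm x} x * Q x"
      proof (cases "x \<in> ball (N *\<^sub>R x0) (N * (norm x0 / 2))")
        case True
        have "norm (N *\<^sub>R x0) \<le> norm x + norm (N *\<^sub>R x0 - x)"
          by (metis add.commute diff_add_cancel norm_triangle_ineq)
        then have "N * (norm x0 / 2) \<le> norm x" using True N by (simp add: dist_norm)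
        then show ?thesis unfolding f_def ind N_def[symmetric] using gQ[of n x] True by simp
      qed (simp add: f_def ind)
    qed
    finally show ?thesis .
  qed
  have "b \<longlonglongrightarrow> (\<integral>\<^sup>+x. 0 \<partial>(lebesgue :: (real^'n) measure))"
    unfolding b_def
  proof (rule nn_integral_dominated_convergence[where w=Q])
    show "(\<lambda>x. indicator {x. real (Suc n) * (norm x0 / 2) \<le> norm x} x * Q x) \<in> borel_measurable lebesgue" for n
    proof (intro borel_measurable_times_ennreal Qm borel_measurable_indicator)
      have "closed {x::real^'n. real (Suc n) * (norm x0 / 2) \<le> norm x}"
        by (intro closed_Collect_le continuous_intros)
      then show "{x::real^'n. real (Suc n) * (norm x0 / 2) \<le> norm x} \<in> sets lebesgue" by simp
    qed
    show "AE x in lebesgue. (\<lambda>n. indicator {x. real (Suc n) * (norm x0 / 2) \<le> norm x} x * Q x) \<longlonglongrightarrow> 0"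
    proof (intro AE_I2)
      fix x :: "real^'n"
      have "\<forall>\<^sub>F n in sequentially. norm x / (norm x0 / 2) < real n" 
        using filterlim_real_sequentially by (simp add: filterlim_at_top_dense)
      then have "\<forall>\<^sub>F n in sequentially. indicator {x. real (Suc n) * (norm x0 / 2) \<le> norm x} x * Q x = 0"
      proof eventually_elim
        case (elim n)
        then have "norm x < real n * (norm x0 / 2)" using x0 by (simp add: pos_divide_less_eq)
        also have "\<dots> \<le> real (Suc n) * (norm x0 / 2)" by (intro mult_right_mono) auto
        finally show ?case by simp
      qed
      then show "(\<lambda>n. indicator {x. real (Suc n) * (norm x0 / 2) \<le> norm x} x * Q x) \<longlonglongrightarrow> 0"
        by (rule tendsto_eventually)
    qed
  qed (use Qm Qfin in \<open>auto simp: indicator_def\<close>)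
  then have b0: "b \<longlonglongrightarrow> ennreal 0" by simp
  have "(\<lambda>n. ennreal (LINT z|lborel. indicator ?B z * \<bar>w n z\<bar> powr q)) \<longlonglongrightarrow> ennreal 0"
    by (rule tendsto_sandwich[OF always_eventually always_eventually tendsto_const b0])
      (intro allI, simp, intro allI le)
  then show ?thesis
    by (rule tendsto_ennrealD) (auto intro!: always_eventually Bochner_Integration.integral_nonneg)
qed

text \<open>The Laplacians of the rescaled pressures \<open>w\<^sub>n\<close> converge boundedly to \<open>-H\<close> with \<open>H = A : D\<^sup>2\<phi>\<close>, while \<open>w\<^sub>n\<close>
  becomes small in \<open>L\<^sup>q\<close> away from the origin. Hence \<open>H = 0\<close>, and moving the derivatives from \<open>\<phi>\<close> to the
  quadratic test functions isolates \<open>A\<^sub>k\<^sub>k \<integral> \<phi>\<close>.\<close>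

lemma balance_hardy_pressure:
  fixes F :: "'n::finite \<Rightarrow> 'n \<Rightarrow> real^'n \<Rightarrow> real" and p :: "'n functional"
  assumes q: "0 < q" "q \<le> 1" and \<phi>: "\<phi> \<in> schwartz" "(LINT x|lebesgue. \<phi> x) \<noteq> 0"
    and p: "p \<in> hardy \<phi> q" and F: "\<And>i j. integrable lebesgue (F i j)"
    and D: "closure D = UNIV"
    and bal: "\<And>n m y. y \<in> D \<Longrightarrow> balance p F (cutoff_test \<phi> n m y) = 0"
  shows "(LINT x|lebesgue. F k k x) = 0"
proof -
  define A where "A i j = (LINT x|lebesgue. F i j x)" for i j
  have tp: "seq_tempered p" using p by (auto simp: hardy_def intro: tempered_seq_tempered)
  define w where "w n y = p (\<lambda>z. \<phi> (y + (- (1 / real (Suc n))) *\<^sub>R z))" for n y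
  let ?h = "\<lambda>i j. pderivative i (pderivative j \<phi>)"
  let ?I = "\<lambda>i j n y. LINT x|lebesgue. F i j x * ?h i j (y + (- (1 / real (Suc n))) *\<^sub>R x)"
  have bal': "balance p F (\<lambda>x. \<phi> (y + (- (1 / real (Suc n))) *\<^sub>R x)) = 0" for n y
    by (rule balance_dilated_kernel[OF tp F \<phi>(1) D bal])
  have sw: "smooth (w n)" for n
    unfolding w_def using balance_laplacian(1)[OF tp \<phi>(1) bal'] .
  have lw: "laplacian (w n) y = - (\<Sum>i\<in>UNIV. \<Sum>j\<in>UNIV. ?I i j n y)" for n y
    unfolding w_def using balance_laplacian(2)[OF tp \<phi>(1) bal'] .
  have h: "?h i j \<in> schwartz" for i j by (intro schwartz_pderivative \<phi>)
  define H where "H y = (\<Sum>i\<in>UNIV. \<Sum>j\<in>UNIV. A i j * ?h i j y)" for y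
  have cH: "continuous_on UNIV H" unfolding H_def
    by (intro continuous_intros smooth_continuous schwartz_smooth h)
  have lim: "(\<lambda>n. laplacian (w n) y) \<longlonglongrightarrow> - H y" for y
    unfolding lw H_def A_def
    by (intro tendsto_minus tendsto_sum dilated_kernel_limit(1) F h)
  have "\<forall>p. \<exists>B. \<forall>n y. \<bar>?I (fst p) (snd p) n y\<bar> \<le> B"
    by (intro allI dilated_kernel_limit(2) F h)
  then have "\<exists>B. \<forall>p. \<forall>n y. \<bar>?I (fst p) (snd p) n y\<bar> \<le> B p" by (rule choice)
  then obtain B where B0: "\<forall>p. \<forall>n y. \<bar>?I (fst p) (snd p) n y\<bar> \<le> B p" ..
  have B: "\<bar>?I i j n y\<bar> \<le> B (i, j)" for i j n y using B0[THEN spec, of "(i, j)", THEN spec, of n, THEN spec, of y] by simp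
  have bd: "\<bar>laplacian (w n) y\<bar> \<le> (\<Sum>i\<in>UNIV. \<Sum>j\<in>UNIV. B (i, j))" for n y
    unfolding lw abs_minus_cancel by (intro order_trans[OF sum_abs] sum_mono B)
  have "H y = 0" if "y \<noteq> 0" for y
  proof -
    have "- H y = 0"
    proof (rule laplacian_limit_vanishes[OF q _ sw bd _ lim])
      show "0 < norm y / 2" using that by simp
      show "(\<lambda>n. LINT z|lborel. indicator (ball y (norm y / 2)) z * \<bar>w n z\<bar> powr q) \<longlonglongrightarrow> 0"
        unfolding w_def
        by (rule hardy_decay[OF q \<phi>(1) p that]) (use smooth_continuous[OF sw] in \<open>simp add: w_def\<close>)
      show "continuous_on UNIV (\<lambda>y. - H y)" by (intro continuous_intros cH)
    qed
    then show ?thesis by simp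
  qed
  then have "- {0} \<subseteq> {y. H y = 0}" by auto
  then have "closure (- {0}) \<subseteq> {y. H y = 0}"
    by (intro closure_minimal closed_Collect_eq cH continuous_on_const)
  then have H0: "H y = 0" for y by (auto simp: closure_complement)
  have i\<phi>: "integrable lebesgue \<phi>" using \<phi>(2) not_integrable_integral_eq by blast
  let ?T = "quadratic_test k"
  have T: "?T m \<in> C0_infinity" for m by (rule quadratic_test_C0_infinity)
  have sm: "smooth (?h i j)" for i j by (intro schwartz_smooth h)
  have "(\<Sum>i\<in>UNIV. \<Sum>j\<in>UNIV. A i j * (LINT x|lebesgue. \<phi> x * pderivative i (pderivative j (?T m)) x)) = 0" for m
  proof -
    have ii: "integrable lborel (\<lambda>x. ?h i j x * ?T m x)" for i j
      by (rule C0_infinity_integrable[OF C0_infinity_mult[OF sm T]])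
    have "(LINT x|lebesgue. \<phi> x * pderivative i (pderivative j (?T m)) x) = (LINT x|lborel. ?h i j x * ?T m x)" for i j
    proof -
      have "pderivative i (pderivative j (?T m)) \<in> C0_infinity" by (intro C0_infinity_pderivative T)
      then have "integrable lborel (\<lambda>x. \<phi> x * pderivative i (pderivative j (?T m)) x)"
        by (rule C0_infinity_integrable[OF C0_infinity_mult[OF schwartz_smooth[OF \<phi>(1)]]])
      then have "(LINT x|lebesgue. \<phi> x * pderivative i (pderivative j (?T m)) x)
          = (LINT x|lborel. \<phi> x * pderivative i (pderivative j (?T m)) x)"
        by (intro integral_completion) auto
      then show ?thesis
        using integral_by_parts_twice[OF schwartz_smooth[OF \<phi>(1)] T]
        by (simp add: pderivative_commute[OF schwartz_smooth[OF \<phi>(1)], of j i])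
    qed
    then have "(\<Sum>i\<in>UNIV. \<Sum>j\<in>UNIV. A i j * (LINT x|lebesgue. \<phi> x * pderivative i (pderivative j (?T m)) x))
       = (LINT x|lborel. (\<Sum>i\<in>UNIV. \<Sum>j\<in>UNIV. A i j * (?h i j x * ?T m x)))"
      using ii by (simp add: Bochner_Integration.integral_sum)
    also have "\<dots> = (LINT x|lborel. H x * ?T m x)"
      by (simp add: H_def sum_distrib_right mult.assoc)
    finally show ?thesis by (simp add: H0)
  qed
  moreover have "(\<lambda>m. \<Sum>i\<in>UNIV. \<Sum>j\<in>UNIV. LINT x|lebesgue. (A i j * \<phi> x) * pderivative i (pderivative j (?T m)) x)
      \<longlonglongrightarrow> (LINT x|lebesgue. A k k * \<phi> x)"
    by (rule integral_quadratic_test_limit[where F="\<lambda>i j x. A i j * \<phi> x"]) (simp add: i\<phi>)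
  ultimately have "(\<lambda>m::nat. 0) \<longlonglongrightarrow> A k k * (LINT x|lebesgue. \<phi> x)"
    by (simp add: mult.assoc)
  then show ?thesis using \<phi>(2) by (simp add: LIMSEQ_const_iff A_def)
qed

section \<open>Fubini on the space-time strip\<close>

lemma time_set: "{0<..<T::real} \<inter> space lebesgue \<in> sets lebesgue"
  by simp

lemma strip_set: "({0<..<T::real} \<times> (UNIV :: (real^'n::finite) set)) \<inter> space lebesgue \<in> sets lebesgue"
proof -
  have "open ({0<..<T} \<times> (UNIV :: (real^'n) set))" by (intro open_Times) auto
  then show ?thesis by simp
qed

text \<open>Lebesgue measure on space-time is the completion of a product measure; Tonelli's theorem applies to
  a Borel representative.\<close>

lemma nn_integral_strip:
  fixes G :: "real \<times> (real^'n::finite) \<Rightarrow> ennreal"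
  assumes G: "G \<in> borel_measurable (strip T)"
  shows "(\<integral>\<^sup>+z. G z \<partial>strip T) = (\<integral>\<^sup>+t. (\<integral>\<^sup>+x. G (t, x) \<partial>lebesgue) \<partial>time_measure T)"
proof -
  let ?S = "{0<..<T} \<times> (UNIV :: (real^'n) set)"
  have "(\<lambda>z. G z * indicator ?S z) \<in> borel_measurable lebesgue"
    using G unfolding strip_def borel_measurable_restrict_space_iff_ennreal[OF strip_set] .
  then obtain H where H: "H \<in> borel_measurable lborel" "AE z in lborel. G z * indicator ?S z = H z"
    using completion_ex_borel_measurable by blast
  have Hm: "H \<in> borel_measurable (lborel \<Otimes>\<^sub>M lborel)" using H(1) by (simp add: lborel_prod)
  have ae: "AE t in lborel. AE x in lborel. G (t, x) * indicator ?S (t, x) = H (t, x)"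
    using H(2) unfolding lborel_prod[symmetric] by (rule lborel_pair.AE_pair)
  have "(\<integral>\<^sup>+z. G z \<partial>strip T) = (\<integral>\<^sup>+z. H z \<partial>lborel)"
    unfolding strip_def nn_integral_restrict_space[OF strip_set] nn_integral_completion
    using H(2) by (rule nn_integral_cong_AE)
  also have "\<dots> = (\<integral>\<^sup>+t. (\<integral>\<^sup>+x. H (t, x) \<partial>lborel) \<partial>lborel)"
    unfolding lborel_prod[symmetric] by (rule lborel.nn_integral_fst[OF Hm, symmetric])
  also have "\<dots> = (\<integral>\<^sup>+t. (\<integral>\<^sup>+x. G (t, x) * indicator ?S (t, x) \<partial>lborel) \<partial>lborel)"
  proof (rule nn_integral_cong_AE)
    show "AE t in lborel. (\<integral>\<^sup>+x. H (t, x) \<partial>lborel) = (\<integral>\<^sup>+x. G (t, x) * indicator ?S (t, x) \<partial>lborel)"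
      using ae
    proof eventually_elim
      case (elim t)
      show ?case by (rule nn_integral_cong_AE) (use elim in \<open>eventually_elim, simp\<close>)
    qed
  qed
  also have "\<dots> = (\<integral>\<^sup>+t. (\<integral>\<^sup>+x. G (t, x) \<partial>lborel) * indicator {0<..<T} t \<partial>lborel)"
    by (intro nn_integral_cong) (auto simp: indicator_def)
  also have "\<dots> = (\<integral>\<^sup>+t. (\<integral>\<^sup>+x. G (t, x) \<partial>lebesgue) \<partial>time_measure T)"
    unfolding nn_integral_restrict_space[OF time_set] nn_integral_completion ..
  finally show ?thesis .
qed

text \<open>Fubini's theorem for the completed measure. For a function that is merely Lebesgue measurable, the
  sections are measurable only for almost every time.\<close>

lemma integrable_strip_sections:
  fixes f :: "real \<times> (real^'n::finite) \<Rightarrow> real"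
  assumes f: "integrable (strip T) f"
  shows "AE t in time_measure T. integrable lebesgue (\<lambda>x. f (t, x))"
    and "integrable (time_measure T) (\<lambda>t. LINT x|lebesgue. f (t, x))"
    and "(LINT z|strip T. f z) = (LINT t|time_measure T. LINT x|lebesgue. f (t, x))"
proof -
  let ?S = "{0<..<T} \<times> (UNIV :: (real^'n) set)"
  have fS: "integrable lebesgue (\<lambda>z. indicator ?S z *\<^sub>R f z)"
    using f unfolding strip_def integrable_restrict_space[OF strip_set] .
  from completion_ex_borel_measurable_real[OF borel_measurable_integrable[OF fS]]
  obtain h where h: "h \<in> borel_measurable lborel" "AE z in lborel. indicator ?S z *\<^sub>R f z = h z"
    by blast
  have ae': "AE z in lebesgue. indicator ?S z *\<^sub>R f z = h z" using h(2) by (rule AE_completion)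
  have "integrable lebesgue h"
    by (rule integrable_cong_AE_imp[OF fS measurable_completion[OF h(1)] ae'])
  then have "integrable lborel h" using h(1) by (simp add: integrable_completion)
  then have hi: "integrable (lborel \<Otimes>\<^sub>M lborel) h" by (simp add: lborel_prod)
  have ae: "AE t in lborel. AE x in lborel. indicator ?S (t, x) *\<^sub>R f (t, x) = h (t, x)"
    using h(2) unfolding lborel_prod[symmetric] by (rule lborel_pair.AE_pair)
  have "AE t in lborel. t \<in> {0<..<T} \<longrightarrow> integrable lebesgue (\<lambda>x. f (t, x))"
    using ae lborel_pair.AE_integrable_fst'[OF hi]
  proof eventually_elim
    case (elim t)
    show ?case
    proof
      assume t: "t \<in> {0<..<T}"
      have 1: "AE x in lebesgue. h (t, x) = f (t, x)" 
        using AE_completion[OF elim(1)] by eventually_elim (use t in simp)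
      have 2: "integrable lebesgue (\<lambda>x. h (t, x))"
        using elim(2) by (simp add: integrable_completion borel_measurable_integrable)
      have 3: "(\<lambda>x. f (t, x)) \<in> borel_measurable lebesgue"
        by (rule borel_measurable_AE[OF borel_measurable_integrable[OF 2] 1])
      show "integrable lebesgue (\<lambda>x. f (t, x))"
        by (rule integrable_cong_AE_imp[OF 2 3]) (use 1 in \<open>eventually_elim, simp\<close>)
    qed
  qed
  then show sec: "AE t in time_measure T. integrable lebesgue (\<lambda>x. f (t, x))"
    unfolding AE_restrict_space_iff[OF time_set] AE_completion_iff .
  have eqt: "AE t in lborel. indicator {0<..<T} t *\<^sub>R (LINT x|lebesgue. f (t, x)) = (LINT x|lborel. h (t, x))"
    using ae lborel_pair.AE_integrable_fst'[OF hi]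
      \<open>AE t in lborel. t \<in> {0<..<T} \<longrightarrow> integrable lebesgue (\<lambda>x. f (t, x))\<close>
  proof eventually_elim
    case (elim t)
    have hm: "(\<lambda>x. h (t, x)) \<in> borel_measurable lborel" using elim(2) by simp
    have h2: "(LINT x|lborel. h (t, x)) = (LINT x|lebesgue. h (t, x))"
      by (rule integral_completion[OF hm, symmetric])
    show ?case
    proof (cases "t \<in> {0<..<T}")
      case True
      have "AE x in lebesgue. f (t, x) = h (t, x)"
        using AE_completion[OF elim(1)] by eventually_elim (use True in simp)
      then have "(LINT x|lebesgue. f (t, x)) = (LINT x|lebesgue. h (t, x))"
        using elim(3) True hm by (intro integral_cong_AE) (auto intro: measurable_completion)
      then show ?thesis using True by (simp add: h2)
    next
      case False
      have "AE x in lborel. h (t, x) = 0" using elim(1) by eventually_elim (use False in simp)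
      then have "(LINT x|lborel. h (t, x)) = 0" by (rule integral_eq_zero_AE)
      then show ?thesis using False by simp
    qed
  qed
  have hint: "integrable lebesgue (\<lambda>t. LINT x|lborel. h (t, x))"
    using lborel_pair.integrable_fst'[OF hi] by (simp add: integrable_completion borel_measurable_integrable)
  have eqt': "AE t in lebesgue. (LINT x|lborel. h (t, x)) = indicator {0<..<T} t *\<^sub>R (LINT x|lebesgue. f (t, x))"
    using AE_completion[OF eqt] by eventually_elim simp
  have fm: "(\<lambda>t. indicator {0<..<T} t *\<^sub>R (LINT x|lebesgue. f (t, x))) \<in> borel_measurable lebesgue"
    by (rule borel_measurable_AE[OF borel_measurable_integrable[OF hint] eqt'])
  have "integrable lebesgue (\<lambda>t. indicator {0<..<T} t *\<^sub>R (LINT x|lebesgue. f (t, x)))"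
    by (rule integrable_cong_AE_imp[OF hint fm]) (use eqt' in \<open>eventually_elim, simp\<close>)
  then show "integrable (time_measure T) (\<lambda>t. LINT x|lebesgue. f (t, x))"
    unfolding integrable_restrict_space[OF time_set] .
  have "(LINT z|strip T. f z) = (LINT z|lebesgue. h z)"
    unfolding strip_def integral_restrict_space[OF strip_set]
    using ae' fS h(1) by (intro integral_cong_AE) (auto intro: measurable_completion)
  also have "\<dots> = (LINT z|lborel. h z)" by (rule integral_completion[OF h(1)])
  also have "\<dots> = (LINT t|lborel. LINT x|lborel. h (t, x))"
    using lborel_pair.integral_fst'[OF hi] by (simp add: lborel_prod)
  also have "\<dots> = (LINT t|lebesgue. LINT x|lborel. h (t, x))"
    using lborel_pair.integrable_fst'[OF hi] by (intro integral_completion[symmetric]) auto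
  also have "\<dots> = (LINT t|lebesgue. indicator {0<..<T} t *\<^sub>R (LINT x|lebesgue. f (t, x)))"
    by (rule integral_cong_AE[OF _ fm eqt']) (rule borel_measurable_integrable[OF hint])
  also have "\<dots> = (LINT t|time_measure T. LINT x|lebesgue. f (t, x))"
    unfolding integral_restrict_space[OF time_set] ..
  finally show "(LINT z|strip T. f z) = (LINT t|time_measure T. LINT x|lebesgue. f (t, x))" .
qed

section \<open>Localisation in time\<close>

lemma C0_1_timeI:
  assumes "0 < s" "s < r" "r < T" "\<And>t. (\<xi> has_real_derivative D t) (at t)" "continuous_on UNIV D"
    "\<And>t. t \<notin> {s<..<r} \<Longrightarrow> \<xi> t = 0"
  shows "\<xi> \<in> C0_1_time T"
proof -
  have "{t. \<xi> t \<noteq> 0} \<subseteq> {s<..<r}" using assms(6) by blast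
  then have "{t. \<xi> t \<noteq> 0} \<subseteq> {s..r}" by (rule order_trans) auto
  then have cl: "closure {t. \<xi> t \<noteq> 0} \<subseteq> {s..r}" by (intro closure_minimal) auto
  then have "compact (closure {t. \<xi> t \<noteq> 0})"
    using compact_Icc[of s r] by (metis closed_closure compact_Int_closed inf.absorb_iff2)
  moreover have "\<xi> C1_differentiable_on UNIV"
    unfolding C1_differentiable_on_def using assms(4,5)
    by (auto simp: has_real_derivative_iff_has_vector_derivative)
  ultimately show ?thesis using cl assms(1-3) by (auto simp: C0_1_time_def compact_support_def)
qed

text \<open>A continuously differentiable function that is positive exactly on the interval between \<open>s\<close> and \<open>r\<close>.\<close>

definition hat :: "real \<Rightarrow> real \<Rightarrow> real \<Rightarrow> real" where
  "hat s r t = exp_inv 0 (t - s) * exp_inv 0 (r - t)"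

lemma continuous_exp_inv: "continuous_on A (exp_inv j)"
  by (rule DERIV_continuous_on[OF has_field_derivative_at_within[OF exp_inv_derivative]])

lemma hat_derivative:
  obtains D where "\<And>t. (hat s r has_real_derivative D t) (at t)" "continuous_on UNIV D"
proof -
  let ?D = "\<lambda>t. exp_inv 0 (t - s) * (exp_inv 2 (r - t) * - 1) + exp_inv 2 (t - s) * 1 * exp_inv 0 (r - t)"
  have e: "(exp_inv 0 has_real_derivative exp_inv 2 t) (at t)" for t
    using exp_inv_derivative[of 0 t] by (simp add: numeral_2_eq_2)
  have "((\<lambda>t. t - s) has_real_derivative 1) (at t)" "((\<lambda>t. r - t) has_real_derivative - 1) (at t)" for t
    by (auto intro!: derivative_eq_intros)
  from DERIV_chain2[OF e this(1)] DERIV_chain2[OF e this(2)]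
  have 1: "(hat s r has_real_derivative ?D t) (at t)" for t
    unfolding hat_def[abs_def] by (rule DERIV_mult')
  have 2: "continuous_on UNIV ?D"
    by (intro continuous_intros continuous_on_compose2[OF continuous_exp_inv[of UNIV]]) auto
  show ?thesis by (rule that[OF 1 2])
qed

lemma hat_continuous: "continuous_on A (hat s r)"
  unfolding hat_def[abs_def]
  by (intro continuous_intros continuous_on_compose2[OF continuous_exp_inv[of UNIV]]) auto

lemma hat_nonneg: "0 \<le> hat s r t"
  by (simp add: hat_def exp_inv_nonneg)

lemma hat_pos: "0 < hat s r t \<longleftrightarrow> t \<in> {s<..<r}"
  by (auto simp: hat_def exp_inv_def)

lemma hat_zero: "t \<notin> {s<..<r} \<Longrightarrow> hat s r t = 0"
  by (auto simp: hat_def exp_inv_def)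

text \<open>Multiplying \<open>g\<close> by a fixed test function makes it integrable. Test functions \<open>\<eta>\<^sub>n\<close> that increase to the
  indicator of a short interval show that its integral over every such interval vanishes, and
  Lebesgue's differentiation theorem recovers the function from these integrals.\<close>

lemma fundamental_lemma_time:
  fixes g :: "real \<Rightarrow> real"
  assumes int: "\<And>\<xi>. \<xi> \<in> C0_1_time T \<Longrightarrow> integrable (time_measure T) (\<lambda>t. g t * \<xi> t)"
    and zero: "\<And>\<xi>. \<xi> \<in> C0_1_time T \<Longrightarrow> (LINT t|time_measure T. g t * \<xi> t) = 0"
  shows "AE t in time_measure T. g t = 0"
proof -
  have main: "AE t in lebesgue. t \<in> {\<delta><..<T - \<delta>} \<longrightarrow> g t = 0" if \<delta>: "0 < \<delta>" for \<delta>
  proof (cases "\<delta> < T - \<delta>")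
    case True
    have hat_test: "hat \<delta> (T - \<delta>) \<in> C0_1_time T"
      using hat_derivative[of \<delta> "T - \<delta>"] \<delta> True hat_zero by (metis C0_1_timeI diff_less_eq less_add_same_cancel1)
    define f where "f t = indicator {0<..<T} t * (g t * hat \<delta> (T - \<delta>) t)" for t
    have fi: "integrable lebesgue f"
      using int[OF hat_test] unfolding integrable_restrict_space[OF time_set] f_def by simp
    have f_on: "f integrable_on cbox a b" for a b
      using integrable_on_lebesgue_on[of "cbox a b" f] fi
      by (metis integrable_restrict_space integrable_mult_indicator lmeasurable_cbox fmeasurableD sets.Int_space_eq2)
    obtain N where N: "negligible N" "\<And>x e. x \<notin> N \<Longrightarrow> 0 < e \<Longrightarrow>
        \<exists>d>0. \<forall>h. 0 < h \<and> h < d \<longrightarrow> norm (integral (cbox x (x + h *\<^sub>R One)) f /\<^sub>R h ^ DIM(real) - f x) < e"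
      using integrable_ccontinuous_explicit[of f] f_on by blast
    have seg: "integral {x..x + h} f = 0" if "\<delta> < x" "0 < h" "x + h < T - \<delta>" for x h
    proof -
      define \<eta> where "\<eta> n t = hat x (x + h) t / (1 / real (Suc n) + hat x (x + h) t)" for n t
      have den: "0 < 1 / real (Suc n) + hat x (x + h) t" for n t
        using hat_nonneg[of x "x + h" t] by (intro add_pos_nonneg) auto
      have \<eta>: "0 \<le> \<eta> n t" "\<eta> n t \<le> 1" for n t
        using den[of n t] hat_nonneg[of x "x + h" t] by (auto simp: \<eta>_def)
      have test: "(\<lambda>t. hat \<delta> (T - \<delta>) t * \<eta> n t) \<in> C0_1_time T" for n
      proof -
        obtain D1 where D1: "\<And>t. (hat \<delta> (T - \<delta>) has_real_derivative D1 t) (at t)" "continuous_on UNIV D1"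
          using hat_derivative by blast
        obtain D2 where D2: "\<And>t. (hat x (x + h) has_real_derivative D2 t) (at t)" "continuous_on UNIV D2"
          using hat_derivative by blast
        have c: "continuous_on UNIV (hat s r)" for s r by (rule hat_continuous)
        let ?k = "\<lambda>t. 1 / real (Suc n) + hat x (x + h) t"
        let ?D = "\<lambda>t. hat \<delta> (T - \<delta>) t * ((D2 t * ?k t - hat x (x + h) t * D2 t) / (?k t * ?k t)) + D1 t * \<eta> n t"
        have k: "?k t \<noteq> 0" for t using den[of n t] by linarith
        show ?thesis
        proof (rule C0_1_timeI)
          show "0 < x" "x < x + h" "x + h < T" using that \<delta> by auto
          have "(?k has_real_derivative D2 t) (at t)" for t
            using DERIV_add[OF DERIV_const D2(1), of "1 / real (Suc n)" t] by simp
          then have "(\<eta> n has_real_derivative (D2 t * ?k t - hat x (x + h) t * D2 t) / (?k t * ?k t)) (at t)" for t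
            unfolding \<eta>_def[abs_def] by (intro DERIV_divide D2 k)
          then show "((\<lambda>t. hat \<delta> (T - \<delta>) t * \<eta> n t) has_real_derivative ?D t) (at t)" for t
            by (rule DERIV_mult'[OF D1(1)])
          have "continuous_on UNIV (\<eta> n)" unfolding \<eta>_def[abs_def] using k by (intro continuous_intros c) auto
          then show "continuous_on UNIV ?D" using k by (intro continuous_intros c D1 D2) auto
          show "hat \<delta> (T - \<delta>) t * \<eta> n t = 0" if "t \<notin> {x<..<x + h}" for t
            using hat_zero[OF that] by (simp add: \<eta>_def)
        qed
      qed
      have lim: "(\<lambda>n. \<eta> n t) \<longlonglongrightarrow> indicator {x<..<x + h} t" for t
      proof (cases "t \<in> {x<..<x + h}")
        case True
        then have p: "0 < hat x (x + h) t" by (simp add: hat_pos)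
        have "(\<lambda>n. \<eta> n t) \<longlonglongrightarrow> hat x (x + h) t / (0 + hat x (x + h) t)"
          unfolding \<eta>_def by (intro tendsto_intros LIMSEQ_Suc[OF lim_1_over_n]) (use p in auto)
        then show ?thesis using p True by simp
      next
        case False
        then show ?thesis using hat_zero[OF False] by (simp add: \<eta>_def)
      qed
      have fm: "f \<in> borel_measurable lebesgue" using fi by simp
      have \<eta>m: "\<eta> n \<in> borel_measurable lebesgue" for n
      proof -
        have "hat x (x + h) \<in> borel_measurable borel"
          by (intro borel_measurable_continuous_onI hat_continuous)
        then have "\<eta> n \<in> borel_measurable borel" unfolding \<eta>_def[abs_def] by measurable
        then show ?thesis by (intro measurable_completion) simp
      qed
      have "(\<lambda>n. LINT t|lebesgue. f t * \<eta> n t) \<longlonglongrightarrow> (LINT t|lebesgue. f t * indicator {x<..<x + h} t)"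
      proof (rule integral_dominated_convergence[where w="\<lambda>t. \<bar>f t\<bar>"])
        show "integrable lebesgue (\<lambda>t. \<bar>f t\<bar>)" using fi by simp
        show "(\<lambda>t. f t * indicator {x<..<x + h} t) \<in> borel_measurable lebesgue"
          using fm by (intro borel_measurable_times borel_measurable_indicator) auto
        show "(\<lambda>t. f t * \<eta> n t) \<in> borel_measurable lebesgue" for n
          using fm \<eta>m by (intro borel_measurable_times)
        show "AE t in lebesgue. (\<lambda>n. f t * \<eta> n t) \<longlonglongrightarrow> f t * indicator {x<..<x + h} t"
          by (intro AE_I2 tendsto_intros lim)
        show "AE t in lebesgue. norm (f t * \<eta> n t) \<le> \<bar>f t\<bar>" for n
          using \<eta>[of n] by (intro AE_I2) (simp add: abs_mult mult_left_le)
      qed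
      moreover have "(LINT t|lebesgue. f t * \<eta> n t) = 0" for n
        using zero[OF test[of n]] unfolding integral_restrict_space[OF time_set] f_def
        by (simp add: mult_ac)
      ultimately have z: "(LINT t|lebesgue. f t * indicator {x<..<x + h} t) = 0"
        by (simp add: LIMSEQ_const_iff)
      have si: "integrable lebesgue (\<lambda>t. indicator {x<..<x + h} t *\<^sub>R f t)"
        by (intro integrable_mult_indicator fi) auto
      have "integral {x..x + h} f = integral {x<..<x + h} f"
        using integral_open_interval_real[of x "x + h" f] by simp
      also have "\<dots> = (LINT t:{x<..<x + h}|lebesgue. f t)"
        using set_lebesgue_integral_eq_integral(2)[of "{x<..<x + h}" f] si by (simp add: set_integrable_def)
      also have "\<dots> = 0" using z by (simp add: set_lebesgue_integral_def mult.commute)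
      finally show ?thesis .
    qed
    have f0: "f x = 0" if x: "x \<in> {\<delta><..<T - \<delta>}" "x \<notin> N" for x
    proof (rule ccontr)
      assume "f x \<noteq> 0"
      then obtain d where d: "0 < d" "\<forall>h. 0 < h \<and> h < d \<longrightarrow>
          norm (integral (cbox x (x + h *\<^sub>R One)) f /\<^sub>R h ^ DIM(real) - f x) < \<bar>f x\<bar>"
        using N(2)[OF x(2), of "\<bar>f x\<bar>"] by auto
      define h where "h = min d (T - \<delta> - x) / 2"
      have h: "0 < h" "h < d" "x + h < T - \<delta>" using d x by (auto simp: h_def min_def field_simps)
      have "integral (cbox x (x + h *\<^sub>R One)) f = 0"
        using seg[of x h] h x by simp
      then show False using d(2) h by auto
    qed
    have "AE t in lebesgue. t \<notin> N"
      using N(1) by (simp add: negligible_iff_null_sets AE_not_in)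
    then show ?thesis
    proof eventually_elim
      case (elim t)
      show ?case
      proof
        assume t: "t \<in> {\<delta><..<T - \<delta>}"
        then have "0 < hat \<delta> (T - \<delta>) t" by (simp only: hat_pos)
        moreover have "t \<in> {0<..<T}" using t \<delta> by auto
        ultimately show "g t = 0" using f0[OF t elim] by (simp add: f_def)
      qed
    qed
  qed (auto intro!: AE_I2)
  have "AE t in lebesgue. \<forall>n::nat. t \<in> {1 / real (Suc n)<..<T - 1 / real (Suc n)} \<longrightarrow> g t = 0"
    unfolding AE_all_countable by (intro allI main) simp
  then have "AE t in lebesgue. t \<in> {0<..<T} \<longrightarrow> g t = 0"
  proof eventually_elim
    case (elim t)
    show ?case
    proof
      assume t: "t \<in> {0<..<T}"
      then have "0 < min t (T - t)" by simp
      then obtain n where "inverse (real (Suc n)) < min t (T - t)"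
        using reals_Archimedean by blast
      then have "t \<in> {1 / real (Suc n)<..<T - 1 / real (Suc n)}" by (auto simp: inverse_eq_divide)
      then show "g t = 0" using elim by blast
    qed
  qed
  then show ?thesis unfolding AE_restrict_space_iff[OF time_set] .
qed

section \<open>Gradient test fields\<close>

lemma gradient_vector_fields: "\<psi> \<in> C0_infinity \<Longrightarrow> gradient \<psi> \<in> vector_fields C0_infinity"
  by (simp add: vector_fields_def gradient_def C0_infinity_pderivative)

lemma divergence_gradient: "divergence (gradient \<psi>) = laplacian \<psi>"
  by (simp add: divergence_def[abs_def] gradient_def laplacian_def[abs_def])

lemma jacobian_gradient: "jacobian (gradient \<psi>) x $ i $ j = pderivative i (pderivative j \<psi>) x"
  by (simp add: jacobian_def gradient_def)

lemma vector_laplacian_gradient: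
  assumes "smooth \<psi>"
  shows "vector_laplacian (gradient \<psi>) = gradient (laplacian \<psi>)"
proof -
  have "laplacian (pderivative j \<psi>) x = pderivative j (laplacian \<psi>) x" for j x
    unfolding laplacian_def[abs_def]
    using assms by (simp add: pderivative_smooth_sum smooth_pderivative pderivative_commute[of "pderivative _ \<psi>" j]
        pderivative_commute[OF assms, of j])
  then show ?thesis
    by (simp add: fun_eq_iff vec_eq_iff vector_laplacian_def gradient_def)
qed

section \<open>The stress tensor\<close>

text \<open>The momentum flux of the system, with the magnetic pressure included.\<close>

definition stress :: "(real^'n::finite \<Rightarrow> real^'n) \<Rightarrow> (real^'n \<Rightarrow> real^'n) \<Rightarrow> 'n \<Rightarrow> 'n \<Rightarrow> real^'n \<Rightarrow> real" where
  "stress v b i j x = v x $ i * v x $ j - b x $ i * b x $ j + (if i = j then (norm (b x))\<^sup>2 / 2 else 0)"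

lemma integrable_component_product:
  fixes u :: "real^'n::finite \<Rightarrow> real^'n"
  assumes u: "u \<in> borel_measurable lebesgue" "integrable lebesgue (\<lambda>x. (norm (u x))\<^sup>2)"
  shows "integrable lebesgue (\<lambda>x. u x $ i * u x $ j)"
proof (rule Bochner_Integration.integrable_bound[OF u(2)])
  have "(\<lambda>x. u x $ k) \<in> borel_measurable lebesgue" for k
    using borel_measurable_inner[OF u(1) borel_measurable_const[of "axis k 1"]] by (simp add: inner_axis)
  then show "(\<lambda>x. u x $ i * u x $ j) \<in> borel_measurable lebesgue" by (intro borel_measurable_times)
  show "AE x in lebesgue. norm (u x $ i * u x $ j) \<le> norm ((norm (u x))\<^sup>2)"
    by (intro AE_I2) (auto simp: abs_mult power2_eq_square intro!: mult_mono component_le_norm_cart)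
qed

lemma integrable_stress:
  assumes "v \<in> borel_measurable lebesgue" "integrable lebesgue (\<lambda>x. (norm (v x))\<^sup>2)"
    and "b \<in> borel_measurable lebesgue" "integrable lebesgue (\<lambda>x. (norm (b x))\<^sup>2)"
  shows "integrable lebesgue (stress v b i j)"
  unfolding stress_def[abs_def] using assms
  by (intro Bochner_Integration.integrable_add Bochner_Integration.integrable_diff integrable_component_product)
    (cases "i = j"; simp)+

lemma L2_sigmaD:
  assumes "u \<in> L2_sigma"
  shows "u \<in> borel_measurable lebesgue" "integrable lebesgue (\<lambda>x. (norm (u x))\<^sup>2)"
    "\<psi> \<in> C0_infinity \<Longrightarrow> (LINT x|lebesgue. u x \<bullet> gradient \<psi> x) = 0"
  using assms by (auto simp: L2_sigma_def)

lemma balance_stress: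
  assumes v: "v \<in> L2_sigma" and b: "b \<in> L2_sigma" and \<psi>: "\<psi> \<in> C0_infinity"
  shows "balance p (stress v b) \<psi> = p (laplacian \<psi>)
     + (LINT x|lebesgue. frobenius (tensor (v x) (v x)) (jacobian (gradient \<psi>) x))
     - (LINT x|lebesgue. frobenius (tensor (b x) (b x)) (jacobian (gradient \<psi>) x))
     + 1 / 2 * (LINT x|lebesgue. (norm (b x))\<^sup>2 * laplacian \<psi> x)"
proof -
  let ?h = "\<lambda>i j. pderivative i (pderivative j \<psi>)"
  have ih: "integrable lebesgue (\<lambda>x. G x * ?h i j x)" if "integrable lebesgue G" for G i j
  proof -
    have h: "?h i j \<in> C0_infinity" by (intro C0_infinity_pderivative \<psi>)
    obtain B where "\<And>x. \<bar>?h i j x\<bar> \<le> B" using C0_infinity_bounded[OF h] by blast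
    then show ?thesis
      by (rule integrable_mult_bounded_continuous[OF that smooth_continuous[OF C0_infinity_smooth[OF h]]])
  qed
  have pr: "integrable lebesgue (\<lambda>x. u x $ i * u x $ j * ?h i j x)" if "u \<in> L2_sigma" for u i j
    by (intro ih integrable_component_product L2_sigmaD that)
  have nb: "integrable lebesgue (\<lambda>x. (norm (b x))\<^sup>2 * ?h i j x)" for i j
    by (intro ih L2_sigmaD b)
  have fr: "(LINT x|lebesgue. frobenius (tensor (u x) (u x)) (jacobian (gradient \<psi>) x))
      = (\<Sum>i\<in>UNIV. \<Sum>j\<in>UNIV. LINT x|lebesgue. u x $ i * u x $ j * ?h i j x)" if "u \<in> L2_sigma" for u
    unfolding frobenius_def tensor_def jacobian_gradient
    using pr[OF that] by (simp add: Bochner_Integration.integral_sum Bochner_Integration.integrable_sum)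
  have lap: "(LINT x|lebesgue. (norm (b x))\<^sup>2 * laplacian \<psi> x)
      = (\<Sum>i\<in>UNIV. LINT x|lebesgue. (norm (b x))\<^sup>2 * ?h i i x)"
    unfolding laplacian_def sum_distrib_left using nb by (simp add: Bochner_Integration.integral_sum)
  have "(LINT x|lebesgue. stress v b i j x * ?h i j x)
      = (LINT x|lebesgue. v x $ i * v x $ j * ?h i j x) - (LINT x|lebesgue. b x $ i * b x $ j * ?h i j x)
        + (if i = j then 1 / 2 * (LINT x|lebesgue. (norm (b x))\<^sup>2 * ?h i j x) else 0)" for i j
  proof (cases "i = j")
    case True
    have "(\<lambda>x. stress v b i j x * ?h i j x) = (\<lambda>x. v x $ i * v x $ j * ?h i j x - b x $ i * b x $ j * ?h i j x
        + 1 / 2 * ((norm (b x))\<^sup>2 * ?h i j x))"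
      using True by (simp add: stress_def algebra_simps fun_eq_iff)
    then show ?thesis using True pr[OF v] pr[OF b] nb by simp
  next
    case False
    have "(\<lambda>x. stress v b i j x * ?h i j x) = (\<lambda>x. v x $ i * v x $ j * ?h i j x - b x $ i * b x $ j * ?h i j x)"
      using False by (simp add: stress_def algebra_simps fun_eq_iff)
    then show ?thesis using False pr[OF v] pr[OF b] by simp
  qed
  then have "(\<Sum>i\<in>UNIV. \<Sum>j\<in>UNIV. LINT x|lebesgue. stress v b i j x * ?h i j x)
     = (\<Sum>i\<in>UNIV. \<Sum>j\<in>UNIV. LINT x|lebesgue. v x $ i * v x $ j * ?h i j x)
       - (\<Sum>i\<in>UNIV. \<Sum>j\<in>UNIV. LINT x|lebesgue. b x $ i * b x $ j * ?h i j x)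
       + (\<Sum>i\<in>UNIV. 1 / 2 * (LINT x|lebesgue. (norm (b x))\<^sup>2 * ?h i i x))"
    by (simp add: sum.distrib sum_subtractf)
  then show ?thesis unfolding balance_def fr[OF v] fr[OF b] lap by (simp add: sum_distrib_left)
qed

text \<open>The momentum equation with the test field \<open>\<nabla>\<psi>\<close>: the terms with \<open>\<partial>\<^sub>t v\<close> and \<open>\<nu>\<Delta>v\<close> integrate to zero at almost
  every time because \<open>v\<close> is divergence free, and the remaining ones contain no derivative in time, so
  that the time-dependent factor \<open>\<xi>\<close> can be removed.\<close>

lemma mhd_balance:
  fixes v b :: "real \<Rightarrow> real^'n::finite \<Rightarrow> real^'n"
  assumes sol: "mhd_weak_solution \<mu> \<nu> T v b p" and \<psi>: "\<psi> \<in> C0_infinity"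
  shows "AE t in time_measure T. balance (p t) (stress (v t) (b t)) \<psi> = 0"
proof -
  let ?J = "jacobian (gradient \<psi>)"
  have v: "AE t in time_measure T. v t \<in> L2_sigma" and b: "AE t in time_measure T. b t \<in> L2_sigma"
    using sol by (auto simp: mhd_weak_solution_def L1_L2_sigma_def)
  define A where "A t = (LINT x|lebesgue. frobenius (tensor (v t x) (v t x)) (?J x))" for t
  define C where "C t = (LINT x|lebesgue. frobenius (tensor (b t x) (b t x)) (?J x))" for t
  define E where "E t = (LINT x|lebesgue. (norm (b t x))\<^sup>2 * laplacian \<psi> x)" for t
  define P where "P t = p t (laplacian \<psi>)" for t
  have grad0: "(LINT t|time_measure T. (LINT x|lebesgue. (v t x \<bullet> gradient \<eta> x) * w t)) = 0"
    if "\<eta> \<in> C0_infinity" for \<eta> w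
  proof (rule integral_eq_zero_AE)
    show "AE t in time_measure T. (LINT x|lebesgue. (v t x \<bullet> gradient \<eta> x) * w t) = 0"
      using v by eventually_elim (simp add: L2_sigmaD(3) that)
  qed
  have test: "integrable (time_measure T) (\<lambda>t. (P t + A t - C t + 1 / 2 * E t) * \<xi> t) \<and>
     (LINT t|time_measure T. (P t + A t - C t + 1 / 2 * E t) * \<xi> t) = 0"
    if \<xi>: "\<xi> \<in> C0_1_time T" for \<xi>
  proof -
    note w = sol[unfolded mhd_weak_solution_def, THEN conjunct2, THEN conjunct2, THEN conjunct2, THEN conjunct1,
        rule_format, OF \<xi> gradient_vector_fields[OF \<psi>],
        unfolded divergence_gradient vector_laplacian_gradient[OF C0_infinity_smooth[OF \<psi>]] strip_integrable_def strip_integral_def]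
    note w = w[unfolded P_def[symmetric]]
    have i1: "integrable (strip T) (\<lambda>(t, x). (v t x \<bullet> gradient \<psi> x) * deriv \<xi> t)"
      and i2: "integrable (strip T) (\<lambda>(t, x). frobenius (tensor (v t x) (v t x)) (?J x) * \<xi> t)"
      and i3: "integrable (strip T) (\<lambda>(t, x). frobenius (tensor (b t x) (b t x)) (?J x) * \<xi> t)"
      and i4: "integrable (time_measure T) (\<lambda>t. P t * \<xi> t)"
      and i5: "integrable (strip T) (\<lambda>(t, x). (norm (b t x))\<^sup>2 * laplacian \<psi> x * \<xi> t)"
      and i6: "integrable (strip T) (\<lambda>(t, x). (v t x \<bullet> gradient (laplacian \<psi>) x) * \<xi> t)"
      using w by blast+
    have e1: "(LINT z|strip T. (case z of (t, x) \<Rightarrow> (v t x \<bullet> gradient \<psi> x) * deriv \<xi> t)) = 0"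
      using integrable_strip_sections(3)[OF i1] grad0[OF \<psi>, of "deriv \<xi>"] by simp
    have e6: "(LINT z|strip T. (case z of (t, x) \<Rightarrow> (v t x \<bullet> gradient (laplacian \<psi>) x) * \<xi> t)) = 0"
      using integrable_strip_sections(3)[OF i6] grad0[OF laplacian_C0_infinity[OF \<psi>], of \<xi>] by simp
    have a: "integrable (time_measure T) (\<lambda>t. A t * \<xi> t)"
      "(LINT z|strip T. (case z of (t, x) \<Rightarrow> frobenius (tensor (v t x) (v t x)) (?J x) * \<xi> t)) = (LINT t|time_measure T. A t * \<xi> t)"
      using integrable_strip_sections(2,3)[OF i2] by (simp_all add: A_def)
    have c: "integrable (time_measure T) (\<lambda>t. C t * \<xi> t)"
      "(LINT z|strip T. (case z of (t, x) \<Rightarrow> frobenius (tensor (b t x) (b t x)) (?J x) * \<xi> t)) = (LINT t|time_measure T. C t * \<xi> t)"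
      using integrable_strip_sections(2,3)[OF i3] by (simp_all add: C_def)
    have e: "integrable (time_measure T) (\<lambda>t. E t * \<xi> t)"
      "(LINT z|strip T. (case z of (t, x) \<Rightarrow> (norm (b t x))\<^sup>2 * laplacian \<psi> x * \<xi> t)) = (LINT t|time_measure T. E t * \<xi> t)"
      using integrable_strip_sections(2,3)[OF i5] by (simp_all add: E_def)
    have "(LINT t|time_measure T. P t * \<xi> t) + (LINT t|time_measure T. A t * \<xi> t)
       - (LINT t|time_measure T. C t * \<xi> t) + 1 / 2 * (LINT t|time_measure T. E t * \<xi> t) = 0"
      using w unfolding e1 e6 a(2) c(2) e(2) by linarith
    moreover have "(\<lambda>t. (P t + A t - C t + 1 / 2 * E t) * \<xi> t)
       = (\<lambda>t. P t * \<xi> t + A t * \<xi> t - C t * \<xi> t + 1 / 2 * (E t * \<xi> t))"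
      by (simp add: algebra_simps fun_eq_iff)
    ultimately show ?thesis using i4 a(1) c(1) e(1) by simp
  qed
  have "AE t in time_measure T. P t + A t - C t + 1 / 2 * E t = 0"
    using test by (intro fundamental_lemma_time) auto
  then show ?thesis using v b
    by eventually_elim (simp add: balance_stress[OF _ _ \<psi>] A_def C_def E_def P_def)
qed

lemma countable_dense_vectors:
  obtains D :: "(real^'n::finite) set" where "countable D" "closure D = UNIV"
proof -
  obtain D :: "(real^'n) set" where D: "countable D" "\<And>X. open X \<Longrightarrow> X \<noteq> {} \<Longrightarrow> \<exists>d\<in>D. d \<in> X"
    using countable_dense_setE by blast
  have "- closure D = {}"
  proof (rule ccontr)
    assume "- closure D \<noteq> {}"
    then obtain d where "d \<in> D" "d \<in> - closure D" using D(2)[of "- closure D"] by auto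
    then show False using closure_subset by blast
  qed
  then have "closure D = UNIV" by blast
  then show ?thesis using that D(1) by blast
qed

text \<open>The fixed-time results need the balance only for countably many test functions, so that the
  exceptional times form a null set.\<close>

lemma mhd_stress_integral:
  fixes v b :: "real \<Rightarrow> real^'n::finite \<Rightarrow> real^'n"
  assumes \<phi>: "\<phi> \<in> schwartz" "(LINT x|lebesgue. \<phi> x) \<noteq> 0"
    and sol: "mhd_weak_solution \<mu> \<nu> T v b p"
    and pressure: "(\<exists>f. f \<in> L1_plus_L1 T \<and> represented_by T p f)
         \<or> (\<exists>q. 0 < q \<and> q \<le> 1 \<and> p \<in> L1_hardy T \<phi> q)"
  shows "AE t in time_measure T. v t \<in> L2_sigma \<and> b t \<in> L2_sigma \<and>
     (\<exists>s\<ge>0. \<forall>k. (LINT x|lebesgue. stress (v t) (b t) k k x) = - s)"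
proof -
  have v: "AE t in time_measure T. v t \<in> L2_sigma" and b: "AE t in time_measure T. b t \<in> L2_sigma"
    using sol by (auto simp: mhd_weak_solution_def L1_L2_sigma_def)
  obtain D :: "(real^'n) set" where D: "countable D" "closure D = UNIV" by (rule countable_dense_vectors)
  have quad: "AE t in time_measure T. \<forall>k m. balance (p t) (stress (v t) (b t)) (quadratic_test k m) = 0"
    unfolding AE_all_countable by (intro allI mhd_balance[OF sol] quadratic_test_C0_infinity)
  have cut: "AE t in time_measure T. \<forall>n m. \<forall>y\<in>D. balance (p t) (stress (v t) (b t)) (cutoff_test \<phi> n m y) = 0"
    unfolding AE_all_countable AE_ball_countable[OF D(1)]
    by (intro allI ballI mhd_balance[OF sol] cutoff_test_C0_infinity \<phi>)
  from pressure show ?thesis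
  proof (elim disjE exE conjE)
    fix f assume f: "f \<in> L1_plus_L1 T" "represented_by T p f"
    have 1: "AE t in time_measure T. integrable lebesgue (f t)"
      and 2: "AE t in time_measure T. 0 \<le> (LINT x|lebesgue. f t x)"
      using f(1) by (auto simp: L1_plus_L1_def L1_L1_def)
    have 3: "AE t in time_measure T. \<forall>\<psi>\<in>schwartz. p t \<psi> = (LINT x|lebesgue. f t x * \<psi> x)"
      using f(2) by (simp add: represented_by_def)
    show ?thesis using v b quad 1 2 3
    proof eventually_elim
      case (elim t)
      have "(LINT x|lebesgue. stress (v t) (b t) k k x) = - (LINT x|lebesgue. f t x)" for k
        using elim by (intro balance_integrable_pressure[where p="p t"] integrable_stress L2_sigmaD) auto
      then show ?case using elim by auto
    qed
  next
    fix q assume q: "0 < q" "q \<le> 1" "p \<in> L1_hardy T \<phi> q"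
    have "AE t in time_measure T. p t \<in> hardy \<phi> q" using q(3) by (simp add: L1_hardy_def)
    then show ?thesis using v b cut
    proof eventually_elim
      case (elim t)
      have "(LINT x|lebesgue. stress (v t) (b t) k k x) = 0" for k
        using elim by (intro balance_hardy_pressure[OF q(1,2) \<phi> _ _ D(2), where p="p t"] integrable_stress L2_sigmaD) auto
      then show ?case using elim by (auto intro!: exI[of _ 0])
    qed
  qed
qed

text \<open>The trace of the integrated stress is \<open>\<integral> |v|\<^sup>2 + (N/2 - 1) \<integral> |b|\<^sup>2\<close>. It is both nonnegative and equal to
  \<open>-N s\<close>, so every term in it vanishes; the diagonal entries then determine the norms of the
  components of \<open>b\<close>.\<close>

lemma stress_integral_consequences:
  fixes v b :: "real^'n::finite \<Rightarrow> real^'n"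
  assumes v: "v \<in> L2_sigma" and b: "b \<in> L2_sigma" and N: "2 \<le> CARD('n)"
    and s: "0 \<le> s" "\<And>k. (LINT x|lebesgue. stress v b k k x) = - s"
  shows "AE x in lebesgue. v x = 0"
    and "3 \<le> CARD('n) \<Longrightarrow> AE x in lebesgue. b x = 0"
    and "CARD('n) = 2 \<Longrightarrow> (LINT x|lebesgue. (b x $ i)\<^sup>2) = (LINT x|lebesgue. (b x $ j)\<^sup>2)"
proof -
  let ?N = "real CARD('n)"
  define V where "V = (LINT x|lebesgue. (norm (v x))\<^sup>2)"
  define B where "B = (LINT x|lebesgue. (norm (b x))\<^sup>2)"
  have sq: "integrable lebesgue (\<lambda>x. (u x $ k)\<^sup>2)" if "u \<in> L2_sigma" for u :: "real^'n \<Rightarrow> real^'n" and k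
    using integrable_component_product[OF L2_sigmaD(1,2)[OF that], of k k] by (simp add: power2_eq_square)
  have nsq: "(norm y)\<^sup>2 = (\<Sum>k\<in>UNIV. (y $ k)\<^sup>2)" for y :: "real^'n"
    unfolding power2_norm_eq_inner inner_vec_def by (simp add: power2_eq_square)
  have tot: "(LINT x|lebesgue. (norm (u x))\<^sup>2) = (\<Sum>k\<in>UNIV. LINT x|lebesgue. (u x $ k)\<^sup>2)"
    if "u \<in> L2_sigma" for u :: "real^'n \<Rightarrow> real^'n"
    unfolding nsq using sq[OF that] by (simp add: Bochner_Integration.integral_sum)
  have diag: "(LINT x|lebesgue. (v x $ k)\<^sup>2) - (LINT x|lebesgue. (b x $ k)\<^sup>2) + B / 2 = - s" for k
  proof -
    have "(\<lambda>x. stress v b k k x) = (\<lambda>x. (v x $ k)\<^sup>2 - (b x $ k)\<^sup>2 + (norm (b x))\<^sup>2 / 2)"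
      by (simp add: stress_def power2_eq_square)
    then show ?thesis using s(2)[of k] sq[OF v] sq[OF b] L2_sigmaD(2)[OF b] by (simp add: B_def)
  qed
  have "(\<Sum>k\<in>(UNIV :: 'n set). (LINT x|lebesgue. (v x $ k)\<^sup>2) - (LINT x|lebesgue. (b x $ k)\<^sup>2) + B / 2)
      = (\<Sum>k\<in>(UNIV :: 'n set). - s)" by (simp only: diag)
  then have sum: "V - B + ?N * (B / 2) = - (?N * s)"
    unfolding V_def B_def tot[OF v] tot[OF b] by (simp add: sum.distrib sum_subtractf)
  have nn: "0 \<le> V" "0 \<le> B" by (auto simp: V_def B_def)
  have "2 * (B / 2) \<le> ?N * (B / 2)" using N nn by (intro mult_right_mono) auto
  then have le: "B \<le> ?N * (B / 2)" by simp
  have "0 \<le> ?N * s" using s(1) by simp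
  then have V0: "V = 0" and Ns: "?N * s = 0" and BN: "?N * (B / 2) = B" using sum le nn by linarith+
  have s0: "s = 0" using Ns by simp
  have zero: "AE x in lebesgue. u x = 0" if "u \<in> L2_sigma" "(LINT x|lebesgue. (norm (u x))\<^sup>2) = 0"
    for u :: "real^'n \<Rightarrow> real^'n"
    using integral_nonneg_eq_0_iff_AE[OF L2_sigmaD(2)[OF that(1)]] that(2) by simp
  show v0: "AE x in lebesgue. v x = 0" using zero[OF v] V0 by (simp add: V_def)
  show "AE x in lebesgue. b x = 0" if "3 \<le> CARD('n)"
  proof -
    have "3 * (B / 2) \<le> ?N * (B / 2)" using that nn by (intro mult_right_mono) auto
    then have "B = 0" using BN nn by linarith
    then show ?thesis using zero[OF b] by (simp add: B_def)
  qed
  have "(LINT x|lebesgue. (v x $ k)\<^sup>2) = 0" for k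
    by (rule integral_eq_zero_AE) (use v0 in \<open>eventually_elim, simp\<close>)
  then have "(LINT x|lebesgue. (b x $ k)\<^sup>2) = B / 2" for k using diag[of k] s0 by simp
  then show "(LINT x|lebesgue. (b x $ i)\<^sup>2) = (LINT x|lebesgue. (b x $ j)\<^sup>2)" by (simp only:)
qed

lemma AE_strip_zeroI:
  fixes u :: "real \<Rightarrow> real^'n::finite \<Rightarrow> real^'n"
  assumes m: "(\<lambda>(t, x). u t x) \<in> borel_measurable (strip T)"
    and zero: "AE t in time_measure T. AE x in lebesgue. u t x = 0"
  shows "AE z in strip T. (case z of (t, x) \<Rightarrow> u t x = 0)"
proof -
  let ?G = "\<lambda>z. ennreal (norm (case z of (t, x) \<Rightarrow> u t x))"
  have G: "?G \<in> borel_measurable (strip T)" using m by measurable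
  have "(\<integral>\<^sup>+z. ?G z \<partial>strip T) = (\<integral>\<^sup>+t. 0 \<partial>time_measure T)"
    unfolding nn_integral_strip[OF G]
  proof (rule nn_integral_cong_AE)
    show "AE t in time_measure T. (\<integral>\<^sup>+x. ?G (t, x) \<partial>lebesgue) = 0"
      using zero
    proof eventually_elim
      case (elim t)
      have "(\<integral>\<^sup>+x. ?G (t, x) \<partial>lebesgue) = (\<integral>\<^sup>+x. 0 \<partial>(lebesgue :: (real^'n) measure))"
        by (rule nn_integral_cong_AE) (use elim in \<open>eventually_elim, simp\<close>)
      then show ?case by simp
    qed
  qed
  then have "AE z in strip T. ?G z = 0" using nn_integral_0_iff_AE[OF G] by simp
  then show ?thesis by eventually_elim (auto split: prod.splits)
qed

section \<open>Mollification\<close>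

definition mollifier :: "nat \<Rightarrow> real^'n::finite \<Rightarrow> real" where
  "mollifier n y = real (Suc n) ^ CARD('n) / (LINT x|lborel. bump 0 (x :: real^'n)) * bump 0 (real (Suc n) *\<^sub>R y)"

text \<open>The convolution of \<open>g\<close> and \<open>\<kappa>\<close>, written as a functional that is applied to the translates of \<open>\<kappa>\<close>. It is
  then an instance of \<open>smooth_translate\<close>.\<close>

definition mollify :: "(real^'n::finite \<Rightarrow> real) \<Rightarrow> (real^'n \<Rightarrow> real) \<Rightarrow> real^'n \<Rightarrow> real" where
  "mollify \<kappa> g y = (LINT z|lebesgue. g (- z) * \<kappa> (y + z))"

lemma bump_integral_pos: "0 < (LINT x|lborel. bump j (x :: real^'n::finite))"
  by (rule integral_pos_of_ball[OF C0_infinity_integrable[OF bump_C0_infinity] bump_nonneg zero_less_one, where a=0])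
    (simp add: bump_pos)

lemma mollifier_C0_infinity: "(mollifier n :: real^'a::finite \<Rightarrow> real) \<in> C0_infinity"
proof -
  have "(\<lambda>y. bump 0 (0 + real (Suc n) *\<^sub>R y)) \<in> C0_infinity"
    by (rule C0_infinity_affine[OF bump_C0_infinity]) simp
  from C0_infinity_mult[OF smooth_const this, of "real (Suc n) ^ CARD('a) / (LINT x|lborel. bump 0 (x :: real^'a))"]
  show ?thesis unfolding mollifier_def[abs_def] by (simp only: add_0_left)
qed

lemma integrable_reflected:
  fixes g :: "real^'n::finite \<Rightarrow> real"
  assumes g: "continuous_on UNIV g" "\<And>x. R < norm x \<Longrightarrow> g x = 0"
  shows "integrable lebesgue (\<lambda>z. g (- z))"
proof -
  have "integrable lborel (\<lambda>z. g (- z))"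
  proof (rule integrable_continuous_compact_support)
    show "continuous_on UNIV (\<lambda>z. g (- z))"
      by (rule continuous_on_compose2[OF g(1)]) (auto intro!: continuous_intros)
    show "g (- z) = 0" if "R < norm z" for z using g(2)[of "- z"] that by simp
  qed
  then show ?thesis by (simp add: integrable_completion borel_measurable_integrable)
qed

lemma smooth_mollify:
  fixes g \<kappa> :: "real^'n::finite \<Rightarrow> real"
  assumes g: "continuous_on UNIV g" "\<And>x. R < norm x \<Longrightarrow> g x = 0" and \<kappa>: "\<kappa> \<in> C0_infinity"
  shows "smooth (mollify \<kappa> g)"
    and "pderivative i (mollify \<kappa> g) = mollify (pderivative i \<kappa>) g"
proof -
  have L: "seq_tempered (\<lambda>\<psi>. LINT z|lebesgue. g (- z) * \<psi> z)"
    using integrable_reflected[OF g] by (rule seq_tempered_integral)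
  show "smooth (mollify \<kappa> g)" unfolding mollify_def[abs_def]
    by (rule smooth_translate[OF L C0_infinity_schwartz[OF \<kappa>]])
  show "pderivative i (mollify \<kappa> g) = mollify (pderivative i \<kappa>) g" unfolding mollify_def[abs_def]
    by (rule pderivative_translate[OF L C0_infinity_schwartz[OF \<kappa>]])
qed

lemma mollify_support:
  assumes g: "\<And>x. R < norm x \<Longrightarrow> g x = 0" and \<kappa>: "\<And>x. S < norm x \<Longrightarrow> \<kappa> x = 0" and y: "R + S < norm y"
  shows "mollify \<kappa> g y = 0"
proof -
  have "g (- z) * \<kappa> (y + z) = 0" for z
  proof (cases "R < norm z")
    case True then show ?thesis using g[of "- z"] by simp
  next
    case False
    have "norm y \<le> norm (y + z) + norm z" by (metis add_diff_cancel norm_triangle_ineq4)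
    then have "S < norm (y + z)" using y False by linarith
    then show ?thesis using \<kappa> by simp
  qed
  then show ?thesis by (simp only: mollify_def integral_zero)
qed

text \<open>The derivative of the kernel is moved to \<open>g\<close> by an integration by parts.\<close>

lemma mollify_pderivative:
  fixes g \<kappa> :: "real^'n::finite \<Rightarrow> real"
  assumes g: "Ck (Suc 0) g" "\<And>x. R < norm x \<Longrightarrow> g x = 0" and \<kappa>: "\<kappa> \<in> C0_infinity"
  shows "mollify (pderivative i \<kappa>) g = mollify \<kappa> (pderivative i g)"
proof
  fix y
  let ?f = "\<lambda>z. g (0 + (-1) *\<^sub>R z) * \<kappa> (y + 1 *\<^sub>R z)"
  have dg: "g differentiable (at x)" for x by (rule Ck_differentiable[OF g(1)])
  have s\<kappa>: "smooth \<kappa>" by (rule C0_infinity_smooth[OF \<kappa>])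
  have d1: "(\<lambda>z. g (0 + (-1) *\<^sub>R z)) differentiable (at z)" for z by (rule differentiable_affine[OF dg])
  have d2: "(\<lambda>z. \<kappa> (y + 1 *\<^sub>R z)) differentiable (at z)" for z
    by (rule differentiable_affine[OF smooth_differentiable[OF s\<kappa>]])
  have pd: "pderivative i ?f = (\<lambda>z. g (0 + (-1) *\<^sub>R z) * (1 * pderivative i \<kappa> (y + 1 *\<^sub>R z))
      + ((-1) * pderivative i g (0 + (-1) *\<^sub>R z)) * \<kappa> (y + 1 *\<^sub>R z))" for i
    by (rule ext, subst pderivative_mult[OF d1 d2])
      (simp only: pderivative_affine[OF dg] pderivative_affine[OF smooth_differentiable[OF s\<kappa>]])
  have cg: "continuous_on UNIV (\<lambda>z. g (0 + (-1) *\<^sub>R z))"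
    by (rule continuous_on_compose2[OF Ck_continuous[OF g(1)]]) (auto intro!: continuous_intros)
  have cpg: "continuous_on UNIV (\<lambda>z. pderivative i g (0 + (-1) *\<^sub>R z))" for i
    by (rule continuous_on_compose2[of UNIV "pderivative i g"]) (use g(1) in \<open>auto intro!: continuous_intros\<close>)
  have ck: "continuous_on UNIV (\<lambda>z. h (y + 1 *\<^sub>R z))" if "smooth h" for h :: "real^'n \<Rightarrow> real"
    by (rule smooth_continuous[OF smooth_affine[OF that]])
  have g0: "g (0 + (-1) *\<^sub>R z) = 0" if "R < norm z" for z using g(2)[of "- z"] that by simp
  have pg0: "pderivative i g (0 + (-1) *\<^sub>R z) = 0" if "R < norm z" for z
    using g(2) by (rule pderivative_local_zero) (use that in simp_all)
  have "Ck (Suc 0) ?f"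
  proof (rule Ck_SucI)
    show "?f differentiable (at x)" for x by (rule differentiable_mult[OF d1 d2])
    have "continuous_on UNIV (pderivative i ?f)" for i
      unfolding pd by (intro continuous_on_add continuous_on_mult cg cpg ck smooth_pderivative s\<kappa> continuous_on_const)
    then show "Ck 0 (pderivative i ?f)" for i by simp
  qed
  then have z: "(LINT z|lborel. pderivative i ?f z) = 0"
    by (rule integral_pderivative_zero[where R=R]) (use g0 in simp)
  have i1: "integrable lborel (\<lambda>z. g (0 + (-1) *\<^sub>R z) * pderivative i \<kappa> (y + 1 *\<^sub>R z))"
    by (rule integrable_continuous_compact_support[where R=R])
      (intro continuous_on_mult cg ck smooth_pderivative s\<kappa>, use g0 in simp)
  have i2: "integrable lborel (\<lambda>z. pderivative i g (0 + (-1) *\<^sub>R z) * \<kappa> (y + 1 *\<^sub>R z))"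
    by (rule integrable_continuous_compact_support[where R=R])
      (intro continuous_on_mult cpg ck s\<kappa>, use pg0 in simp)
  have eq: "(LINT z|lborel. g (0 + (-1) *\<^sub>R z) * pderivative i \<kappa> (y + 1 *\<^sub>R z))
      = (LINT z|lborel. pderivative i g (0 + (-1) *\<^sub>R z) * \<kappa> (y + 1 *\<^sub>R z))"
    using z i1 i2 unfolding pd by simp
  have c1: "(LINT z|lebesgue. g (0 + (-1) *\<^sub>R z) * pderivative i \<kappa> (y + 1 *\<^sub>R z))
      = (LINT z|lborel. g (0 + (-1) *\<^sub>R z) * pderivative i \<kappa> (y + 1 *\<^sub>R z))"
    by (rule integral_completion) (use i1 in blast)
  have c2: "(LINT z|lebesgue. pderivative i g (0 + (-1) *\<^sub>R z) * \<kappa> (y + 1 *\<^sub>R z))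
      = (LINT z|lborel. pderivative i g (0 + (-1) *\<^sub>R z) * \<kappa> (y + 1 *\<^sub>R z))"
    by (rule integral_completion) (use i2 in blast)
  show "mollify (pderivative i \<kappa>) g y = mollify \<kappa> (pderivative i g) y"
    using eq c1 c2 by (simp add: mollify_def)
qed

lemma mollify_mollifier:
  fixes g :: "real^'n::finite \<Rightarrow> real"
  assumes g: "continuous_on UNIV g"
  shows "mollify (mollifier n) g y =
    (LINT w|lebesgue. (bump 0 w / (LINT x|lborel. bump 0 (x :: real^'n))) * g (y + (- (1 / real (Suc n))) *\<^sub>R w))"
proof -
  define N where "N = real (Suc n)"
  have N: "0 < N" by (simp add: N_def)
  define c where "c = (LINT x|lborel. bump 0 (x :: real^'n))"
  have gm: "(\<lambda>z. g (- z)) \<in> borel_measurable borel"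
    by (intro borel_measurable_continuous_onI continuous_on_compose2[OF g]) (auto intro!: continuous_intros)
  have km: "(\<lambda>z. mollifier n (y + z)) \<in> borel_measurable borel"
    using smooth_measurable[OF smooth_affine[OF C0_infinity_smooth[OF mollifier_C0_infinity], where a=y and c=1]] by simp
  have m: "(\<lambda>z. g (- z) * mollifier n (y + z)) \<in> borel_measurable borel"
    using gm km by (rule borel_measurable_times)
  have "mollify (mollifier n) g y = (LINT z|lborel. g (- z) * mollifier n (y + z))"
    unfolding mollify_def by (rule integral_completion) (use m in simp)
  also have "\<dots> = \<bar>1 / N\<bar> ^ CARD('n) * (LINT w|lborel. g (- (- y + (1 / N) *\<^sub>R w)) * mollifier n (y + (- y + (1 / N) *\<^sub>R w)))"
    by (rule lborel_integral_affine[OF m]) (use N in simp)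
  also have "(\<lambda>w. g (- (- y + (1 / N) *\<^sub>R w)) * mollifier n (y + (- y + (1 / N) *\<^sub>R w)))
      = (\<lambda>w. N ^ CARD('n) * ((bump 0 w / c) * g (y + (- (1 / N)) *\<^sub>R w)))"
    using N unfolding mollifier_def N_def[symmetric] c_def[symmetric] by (simp add: fun_eq_iff)
  also have "\<bar>1 / N\<bar> ^ CARD('n) * (LINT w|lborel. N ^ CARD('n) * ((bump 0 w / c) * g (y + (- (1 / N)) *\<^sub>R w)))
      = (LINT w|lborel. (bump 0 w / c) * g (y + (- (1 / N)) *\<^sub>R w))"
    using N by (simp add: power_divide)
  also have "\<dots> = (LINT w|lebesgue. (bump 0 w / c) * g (y + (- (1 / N)) *\<^sub>R w))"
  proof (rule integral_completion[symmetric])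
    have "(\<lambda>w. g (y + (- (1 / N)) *\<^sub>R w)) \<in> borel_measurable borel"
      by (intro borel_measurable_continuous_onI continuous_on_compose2[OF g]) (auto intro!: continuous_intros)
    then show "(\<lambda>w. (bump 0 w / c) * g (y + (- (1 / N)) *\<^sub>R w)) \<in> borel_measurable lborel"
      using smooth_measurable[OF smooth_bump, of 0] by (intro borel_measurable_times borel_measurable_divide) auto
  qed
  finally show ?thesis unfolding N_def[symmetric] c_def[symmetric] .
qed

lemma mollify_bound_and_limit:
  fixes g :: "real^'n::finite \<Rightarrow> real"
  assumes g: "continuous_on UNIV g" "\<And>x. \<bar>g x\<bar> \<le> B"
  shows "\<bar>mollify (mollifier n) g y\<bar> \<le> B"
    and "(\<lambda>n. mollify (mollifier n) g y) \<longlonglongrightarrow> g y"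
proof -
  define c where "c = (LINT x|lborel. bump 0 (x :: real^'n))"
  have c: "0 < c" unfolding c_def by (rule bump_integral_pos)
  define k where "k w = bump 0 w / c" for w :: "real^'n"
  have ki: "integrable lborel k" unfolding k_def
    by (intro integrable_divide_zero C0_infinity_integrable bump_C0_infinity)
  then have k: "integrable lebesgue k" by (simp add: integrable_completion borel_measurable_integrable)
  have "(LINT w|lebesgue. k w) = (LINT w|lborel. k w)" by (rule integral_completion) (use ki in blast)
  then have k1: "(LINT w|lebesgue. k w) = 1" using c by (simp add: k_def c_def)
  have k0: "0 \<le> k w" for w using c by (simp add: k_def bump_nonneg)
  have "continuous_on UNIV (\<lambda>w. g (y + (- (1 / real (Suc n))) *\<^sub>R w))"
    by (rule continuous_on_compose2[OF g(1)]) (auto intro!: continuous_intros)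
  from integral_mult_bounded_le[OF k this g(2)]
  show "\<bar>mollify (mollifier n) g y\<bar> \<le> B"
    unfolding mollify_mollifier[OF g(1)] c_def[symmetric] k_def[symmetric] using k1 k0 by simp
  have "(\<lambda>n. - (1 / real (Suc n))) \<longlonglongrightarrow> 0" using tendsto_minus[OF LIMSEQ_inverse_Suc] by simp
  from integral_dilation_limit[OF k g this]
  show "(\<lambda>n. mollify (mollifier n) g y) \<longlonglongrightarrow> g y"
    unfolding mollify_mollifier[OF g(1)] c_def[symmetric] k_def[symmetric] using k1 by simp
qed

text \<open>The common bound with compact support is the domination needed for passing to the limit in
  space-time integrals.\<close>

definition laplacian_approximates ::
    "(nat \<Rightarrow> real^'n::finite \<Rightarrow> real) \<Rightarrow> (real^'n \<Rightarrow> real) \<Rightarrow> real \<Rightarrow> real \<Rightarrow> bool" where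
  "laplacian_approximates h g B R \<longleftrightarrow> (\<forall>n. h n \<in> C0_infinity) \<and>
     (\<forall>n x. \<bar>h n x\<bar> \<le> B * indicator (cball 0 R) x \<and> \<bar>laplacian (h n) x\<bar> \<le> B * indicator (cball 0 R) x) \<and>
     (\<forall>x. (\<lambda>n. h n x) \<longlonglongrightarrow> g x \<and> (\<lambda>n. laplacian (h n) x) \<longlonglongrightarrow> laplacian g x)"

lemma C0_2_approximation:
  fixes g :: "real^'n::finite \<Rightarrow> real"
  assumes g: "g \<in> C0_2"
  shows "\<exists>h B R. 0 < B \<and> laplacian_approximates h g B R"
proof -
  have C2: "Ck 2 g" using g by (simp add: C0_2_def)
  then have g1: "Ck (Suc 0) g" "\<And>i. Ck (Suc 0) (pderivative i g)"
    using Ck_Suc_imp[of "Suc 0" g] by (auto simp: numeral_2_eq_2)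
  obtain R where R: "0 < R" "\<And>x. R < norm x \<Longrightarrow> g x = 0"
    using g unfolding C0_2_def compact_support_bound by auto
  have R1: "pderivative i g x = 0" if "R < norm x" for i x using R(2) that by (rule pderivative_local_zero)
  have R2: "pderivative i (pderivative i g) x = 0" if "R < norm x" for i x
    using R1 that by (rule pderivative_local_zero)
  have Rl: "laplacian g x = 0" if "R < norm x" for x using R2[OF that] by (simp add: laplacian_def)
  have cp: "continuous_on UNIV (pderivative i (pderivative i g))" for i using g1(2)[of i] by simp
  have cl: "continuous_on UNIV (laplacian g)"
    unfolding laplacian_def[abs_def] by (intro continuous_on_sum cp)
  have cg: "continuous_on UNIV g" by (rule Ck_continuous[OF g1(1)])
  obtain B1 where B1: "0 < B1" "\<And>x. \<bar>g x\<bar> \<le> B1"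
    using bounded_if_continuous_compact_support[OF cg R(2)] by blast
  obtain B2 where B2: "0 < B2" "\<And>x. \<bar>laplacian g x\<bar> \<le> B2"
    using bounded_if_continuous_compact_support[OF cl Rl] by blast
  define h where "h n = mollify (mollifier n) g" for n
  have S: "mollifier n x = 0" if "1 < norm x" for n and x :: "real^'n"
  proof -
    have "1 * 1 \<le> real (Suc n) * norm x" using that by (intro mult_mono) auto
    then show ?thesis by (simp add: mollifier_def bump_eq_0 del: of_nat_Suc)
  qed
  have sm: "smooth (h n)" for n unfolding h_def using cg R(2) mollifier_C0_infinity by (rule smooth_mollify(1))
  have h0: "h n x = 0" if "R + 1 < norm x" for n x
    unfolding h_def using R(2) S that by (rule mollify_support)
  have hC: "h n \<in> C0_infinity" for n by (rule C0_infinityI[OF sm h0])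
  have p1: "pderivative i (mollify (mollifier n) g) = mollify (pderivative i (mollifier n)) g" for i n
    using cg R(2) mollifier_C0_infinity by (rule smooth_mollify(2))
  have p2: "pderivative j (mollify (mollifier n) (pderivative i g)) = mollify (pderivative j (mollifier n)) (pderivative i g)" for i j n
    using Ck_continuous[OF g1(2)] R1 mollifier_C0_infinity by (rule smooth_mollify(2))
  have m1: "mollify (pderivative i (mollifier n)) g = mollify (mollifier n) (pderivative i g)" for i n
    using g1(1) R(2) mollifier_C0_infinity by (rule mollify_pderivative)
  have m2: "mollify (pderivative j (mollifier n)) (pderivative i g) = mollify (mollifier n) (pderivative j (pderivative i g))" for i j n
    using g1(2) R1 mollifier_C0_infinity by (rule mollify_pderivative)
  have lap: "laplacian (h n) = mollify (mollifier n) (laplacian g)" for n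
  proof
    fix x
    have d: "pderivative i (pderivative i (h n)) = mollify (mollifier n) (pderivative i (pderivative i g))" for i
    proof -
      have "pderivative i (h n) = mollify (mollifier n) (pderivative i g)"
        unfolding h_def p1 by (rule m1)
      then show ?thesis by (simp only: p2 m2)
    qed
    have int: "integrable lebesgue (\<lambda>z. pderivative i (pderivative i g) (- z) * mollifier n (x + z))" for i
    proof -
      obtain C where "\<And>y. \<bar>mollifier n (y :: real^'n)\<bar> \<le> C"
        using C0_infinity_bounded[OF mollifier_C0_infinity] by blast
      then show ?thesis
        using smooth_continuous[OF smooth_affine[OF C0_infinity_smooth[OF mollifier_C0_infinity], where a=x and c=1]]
        by (intro integrable_mult_bounded_continuous[OF integrable_reflected[OF cp R2]]) auto
    qed
    show "laplacian (h n) x = mollify (mollifier n) (laplacian g) x"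
      unfolding laplacian_def d unfolding mollify_def sum_distrib_right
      by (rule Bochner_Integration.integral_sum[symmetric]) (rule int)
  qed
  have l0: "mollify (mollifier n) (laplacian g) x = 0" if "R + 1 < norm x" for n x
    using Rl S that by (rule mollify_support)
  have "laplacian_approximates h g (max B1 B2) (R + 1)"
    unfolding laplacian_approximates_def
  proof (intro conjI allI)
    show "h n \<in> C0_infinity" for n by (rule hC)
    show "\<bar>h n x\<bar> \<le> max B1 B2 * indicator (cball 0 (R + 1)) x" for n x
      using mollify_bound_and_limit(1)[OF cg B1(2), of n x] h0[of x n] by (cases "norm x \<le> R + 1") (auto simp: h_def)
    show "\<bar>laplacian (h n) x\<bar> \<le> max B1 B2 * indicator (cball 0 (R + 1)) x" for n x
      using mollify_bound_and_limit(1)[OF cl B2(2), of n x] l0[of x n]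
      by (cases "norm x \<le> R + 1") (auto simp: lap)
    show "(\<lambda>n. h n x) \<longlonglongrightarrow> g x" for x unfolding h_def by (rule mollify_bound_and_limit(2)[OF cg B1(2)])
    show "(\<lambda>n. laplacian (h n) x) \<longlonglongrightarrow> laplacian g x" for x unfolding lap by (rule mollify_bound_and_limit(2)[OF cl B2(2)])
  qed
  moreover have "0 < max B1 B2" using B1 by simp
  ultimately show ?thesis by blast
qed

section \<open>The heat equation\<close>

lemma measurable_strip:
  fixes f :: "real \<times> (real^'n::finite) \<Rightarrow> 'b::topological_space"
  assumes "f \<in> borel_measurable borel"
  shows "f \<in> borel_measurable (strip T)"
  unfolding strip_def using assms by (intro measurable_restrict_space1 measurable_completion) simp

text \<open>Young's inequality \<open>2 |u| \<le> |u|\<^sup>2/s + s\<close> with \<open>s\<close> the \<open>L\<^sup>2\<close> norm of \<open>u\<close> gives a bound that is linear in this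
  norm, and it is the norm, not its square, that is integrable in time.\<close>

lemma L2_local_integral_bound:
  fixes u :: "real^'n::finite \<Rightarrow> real^'n"
  assumes u: "u \<in> L2_sigma" and w: "\<bar>w\<bar> \<le> W"
  shows "(\<integral>\<^sup>+x. ennreal (norm (u x) * indicator (cball 0 R) x * \<bar>w\<bar>) \<partial>lebesgue)
    \<le> ennreal (W * (1 + measure lebesgue (cball (0 :: real^'n) R)) / 2 * sqrt (LINT x|lebesgue. (norm (u x))\<^sup>2))"
proof -
  define m where "m = measure lebesgue (cball (0 :: real^'n) R)"
  define s where "s = sqrt (LINT x|lebesgue. (norm (u x))\<^sup>2)"
  have W: "0 \<le> W" using w by (meson abs_ge_zero order_trans)
  have int: "0 \<le> (LINT x|lebesgue. (norm (u x))\<^sup>2)" by simp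
  have ui: "integrable lebesgue (\<lambda>x. (norm (u x))\<^sup>2)" by (rule L2_sigmaD(2)[OF u])
  show ?thesis
  proof (cases "s = 0")
    case True
    then have "(LINT x|lebesgue. (norm (u x))\<^sup>2) = 0" using int by (simp add: s_def)
    then have "AE x in lebesgue. u x = 0"
      using integral_nonneg_eq_0_iff_AE[OF ui] by simp
    then have "AE x in lebesgue. ennreal (norm (u x) * indicator (cball 0 R) x * \<bar>w\<bar>) = 0"
      by eventually_elim simp
    then have "(\<integral>\<^sup>+x. ennreal (norm (u x) * indicator (cball 0 R) x * \<bar>w\<bar>) \<partial>lebesgue) = (\<integral>\<^sup>+x. 0 \<partial>(lebesgue :: (real^'n) measure))"
      by (rule nn_integral_cong_AE)
    then show ?thesis by simp
  next
    case False
    then have s: "0 < s" using int by (simp add: s_def less_le)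
    let ?I = "indicator (cball (0 :: real^'n) R) :: real^'n \<Rightarrow> real"
    have ib: "integrable lebesgue ?I"
      using emeasure_bounded_finite[OF bounded_cball, of "0 :: real^'n" R]
      by (intro integrable_real_indicator) auto
    let ?f = "\<lambda>x. W * (((norm (u x))\<^sup>2 / s + s * ?I x) / 2)"
    have fi: "integrable lebesgue ?f" using ui ib by simp
    have "norm (u x) * ?I x * \<bar>w\<bar> \<le> ?f x" for x
    proof -
      have "0 \<le> (norm (u x) - s * ?I x)\<^sup>2" by simp
      also have "\<dots> = (norm (u x))\<^sup>2 + s * s * ?I x - 2 * (s * (norm (u x) * ?I x))"
        by (auto simp: power2_eq_square algebra_simps indicator_def)
      finally have "s * (norm (u x) * ?I x) \<le> s * (((norm (u x))\<^sup>2 / s + s * ?I x) / 2)"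
        using s by (simp add: distrib_left)
      then have "norm (u x) * ?I x \<le> ((norm (u x))\<^sup>2 / s + s * ?I x) / 2"
        using s by (simp only: mult_le_cancel_left_pos)
      then have "(norm (u x) * ?I x) * \<bar>w\<bar> \<le> ((norm (u x))\<^sup>2 / s + s * ?I x) / 2 * W"
        using w s by (intro mult_mono) auto
      then show ?thesis by (simp only: mult.commute)
    qed
    then have "(\<integral>\<^sup>+x. ennreal (norm (u x) * ?I x * \<bar>w\<bar>) \<partial>lebesgue) \<le> (\<integral>\<^sup>+x. ennreal (?f x) \<partial>lebesgue)"
      by (intro nn_integral_mono ennreal_leI)
    also have "\<dots> = ennreal (LINT x|lebesgue. ?f x)"
      using s W by (intro nn_integral_eq_integral[OF fi] AE_I2) auto
    also have "(LINT x|lebesgue. ?f x) = W * (((LINT x|lebesgue. (norm (u x))\<^sup>2) / s + s * m) / 2)"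
      using ui ib by (simp add: m_def)
    also have "(LINT x|lebesgue. (norm (u x))\<^sup>2) = s * s" using int by (simp add: s_def)
    also have "W * ((s * s / s + s * m) / 2) = W * (1 + m) / 2 * s" using s by (simp add: field_simps)
    finally show ?thesis by (simp add: m_def s_def)
  qed
qed

lemma integrable_strip_local:
  fixes b :: "real \<Rightarrow> real^'n::finite \<Rightarrow> real^'n"
  assumes b: "b \<in> L1_L2_sigma T" and w: "continuous_on UNIV w"
  shows "integrable (strip T) (\<lambda>(t, x). norm (b t x) * indicator (cball 0 R) x * \<bar>w t\<bar>)"
proof -
  let ?f = "\<lambda>(t, x). norm (b t x) * indicator (cball 0 R) x * \<bar>w t\<bar>"
  have bm: "(\<lambda>(t, x). b t x) \<in> borel_measurable (strip T)"
    and bs: "AE t in time_measure T. b t \<in> L2_sigma"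
    and bi: "integrable (time_measure T) (\<lambda>t. sqrt (LINT x|lebesgue. (norm (b t x))\<^sup>2))"
    using b by (auto simp: L1_L2_sigma_def)
  have "closed {z :: real \<times> (real^'n). norm (snd z) \<le> R}" by (intro closed_Collect_le continuous_intros)
  then have 1: "indicat_real {z :: real \<times> (real^'n). norm (snd z) \<le> R} \<in> borel_measurable (strip T)"
    by (intro measurable_strip borel_measurable_indicator) auto
  have "continuous_on UNIV (\<lambda>z :: real \<times> (real^'n). \<bar>w (fst z)\<bar>)"
    by (intro continuous_intros continuous_on_compose2[OF w]) auto
  then have 2: "(\<lambda>z :: real \<times> (real^'n). \<bar>w (fst z)\<bar>) \<in> borel_measurable (strip T)"
    by (intro measurable_strip borel_measurable_continuous_onI)
  have "(\<lambda>z. norm (case z of (t, x) \<Rightarrow> b t x) * indicator {z. norm (snd z) \<le> R} z * \<bar>w (fst z)\<bar>) \<in> borel_measurable (strip T)"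
    using 1 2 measurable_compose[OF bm borel_measurable_norm] by (intro borel_measurable_times)
  also have "(\<lambda>z. norm (case z of (t, x) \<Rightarrow> b t x) * indicator {z. norm (snd z) \<le> R} z * \<bar>w (fst z)\<bar>) = ?f"
    by (auto simp: fun_eq_iff indicator_def)
  finally have fm: "?f \<in> borel_measurable (strip T)" .
  have "compact (w ` {0..T})" by (intro compact_continuous_image continuous_on_subset[OF w]) auto
  then obtain W where W: "0 < W" "\<forall>y\<in>w ` {0..T}. norm y \<le> W"
    using compact_imp_bounded bounded_pos by blast
  define C where "C = W * (1 + measure lebesgue (cball (0 :: real^'n) R)) / 2"
  have "(\<integral>\<^sup>+z. ennreal (norm (?f z)) \<partial>strip T) = (\<integral>\<^sup>+t. (\<integral>\<^sup>+x. ennreal (norm (?f (t, x))) \<partial>lebesgue) \<partial>time_measure T)"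
    by (intro nn_integral_strip measurable_compose[OF fm]) measurable
  also have "\<dots> \<le> (\<integral>\<^sup>+t. ennreal (C * sqrt (LINT x|lebesgue. (norm (b t x))\<^sup>2)) \<partial>time_measure T)"
  proof (rule nn_integral_mono_AE)
    show "AE t in time_measure T. (\<integral>\<^sup>+x. ennreal (norm (?f (t, x))) \<partial>lebesgue)
       \<le> ennreal (C * sqrt (LINT x|lebesgue. (norm (b t x))\<^sup>2))"
      using bs AE_space
    proof eventually_elim
      case (elim t)
      have "\<bar>w t\<bar> \<le> W" using W elim(2) by (auto simp: space_restrict_space)
      from L2_local_integral_bound[OF elim(1) this, of R] show ?case by (simp add: C_def abs_mult)
    qed
  qed
  also have "\<dots> < \<infinity>"
  proof -
    have i: "integrable (time_measure T) (\<lambda>t. C * sqrt (LINT x|lebesgue. (norm (b t x))\<^sup>2))" using bi by simp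
    have "0 \<le> C" using W by (simp add: C_def)
    then have "(\<integral>\<^sup>+t. ennreal (C * sqrt (LINT x|lebesgue. (norm (b t x))\<^sup>2)) \<partial>time_measure T)
      = ennreal (LINT t|time_measure T. C * sqrt (LINT x|lebesgue. (norm (b t x))\<^sup>2))"
      by (intro nn_integral_eq_integral[OF i] AE_I2) auto
    then show ?thesis by simp
  qed
  finally show ?thesis using fm by (simp add: integrable_iff_bounded)
qed

lemma strip_integral_limit:
  fixes b :: "real \<Rightarrow> real^'n::finite \<Rightarrow> real^'n"
  assumes b: "b \<in> L1_L2_sigma T" and w: "continuous_on UNIV w"
    and u: "\<And>n. continuous_on UNIV (u n)" "\<And>n x. norm (u n x) \<le> B * indicator (cball 0 R) x"
    and U: "\<And>x. (\<lambda>n. u n x) \<longlonglongrightarrow> U x"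
  shows "strip_integrable T (\<lambda>t x. (b t x \<bullet> U x) * w t)"
    and "(\<lambda>n. strip_integral T (\<lambda>t x. (b t x \<bullet> u n x) * w t)) \<longlonglongrightarrow> strip_integral T (\<lambda>t x. (b t x \<bullet> U x) * w t)"
proof -
  let ?g = "\<lambda>z. \<bar>B\<bar> * (case z of (t, x) \<Rightarrow> norm (b t x) * indicator (cball 0 R) x * \<bar>w t\<bar>)"
  have bm: "(\<lambda>(t, x). b t x) \<in> borel_measurable (strip T)" using b by (auto simp: L1_L2_sigma_def)
  have g: "integrable (strip T) ?g" using integrable_strip_local[OF b w, of R] by simp
  have cw: "continuous_on UNIV (\<lambda>z :: real \<times> (real^'n). w (fst z))"
    by (rule continuous_on_compose2[OF w]) (auto intro!: continuous_intros)
  have wm: "(\<lambda>z :: real \<times> (real^'n). w (fst z)) \<in> borel_measurable (strip T)"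
    by (intro measurable_strip borel_measurable_continuous_onI cw)
  have um: "(\<lambda>z :: real \<times> (real^'n). u n (snd z)) \<in> borel_measurable (strip T)" for n
  proof (intro measurable_strip borel_measurable_continuous_onI)
    show "continuous_on UNIV (\<lambda>z :: real \<times> (real^'n). u n (snd z))"
      by (rule continuous_on_compose2[OF u(1)]) (auto intro!: continuous_intros)
  qed
  have Um: "(\<lambda>z :: real \<times> (real^'n). U (snd z)) \<in> borel_measurable (strip T)"
    by (rule borel_measurable_LIMSEQ_metric[OF um]) (rule U)
  have m: "(\<lambda>(t, x). (b t x \<bullet> V x) * w t) \<in> borel_measurable (strip T)"
    if "(\<lambda>z :: real \<times> (real^'n). V (snd z)) \<in> borel_measurable (strip T)" for V
  proof -
    have "(\<lambda>z. ((case z of (t, x) \<Rightarrow> b t x) \<bullet> V (snd z)) * w (fst z)) \<in> borel_measurable (strip T)"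
      by (intro borel_measurable_times borel_measurable_inner bm that wm)
    then show ?thesis by (simp add: case_prod_beta')
  qed
  have lim: "AE z in strip T. (\<lambda>n. case z of (t, x) \<Rightarrow> (b t x \<bullet> u n x) * w t) \<longlonglongrightarrow> (case z of (t, x) \<Rightarrow> (b t x \<bullet> U x) * w t)"
    by (intro AE_I2) (auto split: prod.splits intro!: tendsto_intros U)
  have bd: "AE z in strip T. norm (case z of (t, x) \<Rightarrow> (b t x \<bullet> u n x) * w t) \<le> ?g z" for n
  proof (intro AE_I2)
    fix z :: "real \<times> (real^'n)"
    obtain t x where z: "z = (t, x)" by (cases z)
    have "\<bar>b t x \<bullet> u n x\<bar> \<le> norm (b t x) * norm (u n x)" by (rule Cauchy_Schwarz_ineq2)
    also have "\<dots> \<le> norm (b t x) * (\<bar>B\<bar> * indicator (cball 0 R) x)"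
      using u(2)[of n x] by (intro mult_left_mono) (auto simp: indicator_def split: if_splits)
    finally have "\<bar>b t x \<bullet> u n x\<bar> * \<bar>w t\<bar> \<le> (norm (b t x) * (\<bar>B\<bar> * indicator (cball 0 R) x)) * \<bar>w t\<bar>"
      by (rule mult_right_mono) simp
    then show "norm (case z of (t, x) \<Rightarrow> (b t x \<bullet> u n x) * w t) \<le> ?g z"
      by (simp add: z abs_mult mult_ac)
  qed
  show "strip_integrable T (\<lambda>t x. (b t x \<bullet> U x) * w t)" unfolding strip_integrable_def
    by (rule integrable_dominated_convergence[OF m[OF Um] m[OF um] g lim bd])
  show "(\<lambda>n. strip_integral T (\<lambda>t x. (b t x \<bullet> u n x) * w t)) \<longlonglongrightarrow> strip_integral T (\<lambda>t x. (b t x \<bullet> U x) * w t)"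
    unfolding strip_integral_def
    by (rule integral_dominated_convergence[OF m[OF Um] m[OF um] g lim bd])
qed

lemma C0_1_time_continuous:
  assumes "\<xi> \<in> C0_1_time T"
  shows "continuous_on UNIV \<xi>" "continuous_on UNIV (deriv \<xi>)"
proof -
  obtain D where D: "\<And>t. (\<xi> has_vector_derivative D t) (at t)" "continuous_on UNIV D"
    using assms by (auto simp: C0_1_time_def C1_differentiable_on_def)
  have d: "(\<xi> has_real_derivative D t) (at t)" for t
    using D(1) by (simp add: has_real_derivative_iff_has_vector_derivative)
  then show "continuous_on UNIV \<xi>" by (metis DERIV_continuous_on has_field_derivative_at_within)
  have "deriv \<xi> = D" using d DERIV_imp_deriv by blast
  then show "continuous_on UNIV (deriv \<xi>)" using D(2) by simp
qed

lemma norm_vec_lambda_bound: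
  fixes h :: "'n::finite \<Rightarrow> real^'n \<Rightarrow> real"
  assumes "\<And>i x. \<bar>h i x\<bar> \<le> B i * indicator (cball 0 (R i)) x" "\<And>i. 0 < B i"
  shows "norm (\<chi> i. h i x) \<le> (\<Sum>i\<in>UNIV. B i) * indicator (cball 0 (\<Sum>i\<in>UNIV. \<bar>R i\<bar>)) x"
proof -
  have "norm (\<chi> i. h i x) \<le> (\<Sum>i\<in>UNIV. \<bar>h i x\<bar>)" using norm_le_l1_cart[of "\<chi> i. h i x"] by simp
  also have "\<dots> \<le> (\<Sum>i\<in>UNIV. B i * indicator (cball 0 (\<Sum>i\<in>UNIV. \<bar>R i\<bar>)) x)"
  proof (rule sum_mono)
    fix i
    have "R i \<le> (\<Sum>i\<in>UNIV. \<bar>R i\<bar>)" using member_le_sum[of i UNIV "\<lambda>i. \<bar>R i\<bar>"] by simp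
    then have "B i * indicator (cball 0 (R i)) x \<le> B i * indicator (cball 0 (\<Sum>i\<in>UNIV. \<bar>R i\<bar>)) x"
      using assms(2)[of i] by (intro mult_left_mono) (auto simp: indicator_def)
    then show "\<bar>h i x\<bar> \<le> B i * indicator (cball 0 (\<Sum>i\<in>UNIV. \<bar>R i\<bar>)) x" using assms(1)[of i x] by linarith
  qed
  finally show ?thesis by (simp add: sum_distrib_right)
qed

text \<open>Each component of a \<open>C\<^sup>2\<close> test field is mollified; the values and Laplacians converge pointwise with a
  common compactly supported bound.\<close>

lemma heat_weak_solution_from_smooth:
  fixes b :: "real \<Rightarrow> real^'n::finite \<Rightarrow> real^'n"
  assumes b: "b \<in> L1_L2_sigma T"
    and eq: "\<And>\<xi> \<phi>. \<xi> \<in> C0_1_time T \<Longrightarrow> \<phi> \<in> vector_fields C0_infinity \<Longrightarrow>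
      - strip_integral T (\<lambda>t x. (b t x \<bullet> \<phi> x) * deriv \<xi> t)
      = \<mu> * strip_integral T (\<lambda>t x. (b t x \<bullet> vector_laplacian \<phi> x) * \<xi> t)"
  shows "heat_weak_solution \<mu> T b"
  unfolding heat_weak_solution_def
proof (intro ballI)
  fix \<phi> :: "real^'n \<Rightarrow> real^'n" and \<xi>
  assume \<phi>: "\<phi> \<in> vector_fields C0_2" and \<xi>: "\<xi> \<in> C0_1_time T"
  have "\<exists>a. 0 < fst (snd a) \<and> laplacian_approximates (fst a) (\<lambda>x. \<phi> x $ i) (fst (snd a)) (snd (snd a))" for i
  proof -
    have "(\<lambda>x. \<phi> x $ i) \<in> C0_2" using \<phi> by (simp add: vector_fields_def)
    from C0_2_approximation[OF this] obtain h B R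
      where "0 < B" "laplacian_approximates h (\<lambda>x. \<phi> x $ i) B R" by blast
    then show ?thesis by (intro exI[of _ "(h, B, R)"]) simp
  qed
  then have "\<exists>a. \<forall>i. 0 < fst (snd (a i)) \<and>
      laplacian_approximates (fst (a i)) (\<lambda>x. \<phi> x $ i) (fst (snd (a i))) (snd (snd (a i)))"
    by (intro choice allI)
  then obtain a where a: "\<forall>i. 0 < fst (snd (a i)) \<and>
      laplacian_approximates (fst (a i)) (\<lambda>x. \<phi> x $ i) (fst (snd (a i))) (snd (snd (a i)))" ..
  define H where "H i = fst (a i)" for i
  define B where "B i = fst (snd (a i))" for i
  define R where "R i = snd (snd (a i))" for i
  have B0: "0 < B i" for i using a by (simp add: B_def)
  have H: "laplacian_approximates (H i) (\<lambda>x. \<phi> x $ i) (B i) (R i)" for i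
    using a by (simp add: H_def B_def R_def)
  note H = H[unfolded laplacian_approximates_def]
  have HC: "H i n \<in> C0_infinity" for i n using H by blast
  define u where "u n x = (\<chi> i. H i n x)" for n x
  have ut: "u n \<in> vector_fields C0_infinity" for n by (simp add: vector_fields_def u_def HC)
  have lu: "vector_laplacian (u n) x = (\<chi> i. laplacian (H i n) x)" for n x
    by (simp add: vector_laplacian_def u_def)
  have vl: "vector_laplacian \<phi> x = (\<chi> i. laplacian (\<lambda>y. \<phi> y $ i) x)" for x
    by (simp add: vector_laplacian_def)
  let ?B = "\<Sum>i\<in>UNIV. B i" and ?R = "\<Sum>i\<in>UNIV. \<bar>R i\<bar>"
  have c1: "continuous_on UNIV (u n)" for n
    unfolding u_def by (intro continuous_on_vec_lambda smooth_continuous C0_infinity_smooth HC)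
  have c2: "continuous_on UNIV (vector_laplacian (u n))" for n
    unfolding lu[abs_def] by (intro continuous_on_vec_lambda smooth_continuous C0_infinity_smooth laplacian_C0_infinity HC)
  have b1: "norm (u n x) \<le> ?B * indicator (cball 0 ?R) x" for n x
    unfolding u_def by (rule norm_vec_lambda_bound) (use H B0 in blast)+
  have b2: "norm (vector_laplacian (u n) x) \<le> ?B * indicator (cball 0 ?R) x" for n x
    unfolding lu by (rule norm_vec_lambda_bound) (use H B0 in blast)+
  have l1: "(\<lambda>n. u n x) \<longlonglongrightarrow> \<phi> x" for x
    unfolding u_def by (rule vec_tendstoI) (use H in simp)
  have l2: "(\<lambda>n. vector_laplacian (u n) x) \<longlonglongrightarrow> vector_laplacian \<phi> x" for x
    unfolding lu vl by (rule vec_tendstoI) (use H in simp)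
  note s1 = strip_integral_limit[OF b C0_1_time_continuous(2)[OF \<xi>] c1 b1 l1]
  note s2 = strip_integral_limit[OF b C0_1_time_continuous(1)[OF \<xi>] c2 b2 l2]
  have "- strip_integral T (\<lambda>t x. (b t x \<bullet> \<phi> x) * deriv \<xi> t)
      = \<mu> * strip_integral T (\<lambda>t x. (b t x \<bullet> vector_laplacian \<phi> x) * \<xi> t)"
  proof (rule LIMSEQ_unique)
    show "(\<lambda>n. - strip_integral T (\<lambda>t x. (b t x \<bullet> u n x) * deriv \<xi> t)) \<longlonglongrightarrow>
       - strip_integral T (\<lambda>t x. (b t x \<bullet> \<phi> x) * deriv \<xi> t)" by (intro tendsto_minus s1)
    show "(\<lambda>n. - strip_integral T (\<lambda>t x. (b t x \<bullet> u n x) * deriv \<xi> t)) \<longlonglongrightarrow>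
       \<mu> * strip_integral T (\<lambda>t x. (b t x \<bullet> vector_laplacian \<phi> x) * \<xi> t)"
      unfolding eq[OF \<xi> ut] by (intro tendsto_mult_left s2)
  qed
  then show "strip_integrable T (\<lambda>t x. (b t x \<bullet> \<phi> x) * deriv \<xi> t) \<and>
        strip_integrable T (\<lambda>t x. (b t x \<bullet> vector_laplacian \<phi> x) * \<xi> t) \<and>
        - strip_integral T (\<lambda>t x. (b t x \<bullet> \<phi> x) * deriv \<xi> t)
        = \<mu> * strip_integral T (\<lambda>t x. (b t x \<bullet> vector_laplacian \<phi> x) * \<xi> t)"
    using s1(1) s2(1) by blast
qed

lemma heat_weak_solution_of_mhd:
  fixes v b :: "real \<Rightarrow> real^'n::finite \<Rightarrow> real^'n"
  assumes sol: "mhd_weak_solution \<mu> \<nu> T v b p"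
    and v0: "AE z in strip T. (case z of (t, x) \<Rightarrow> v t x = 0)"
  shows "heat_weak_solution \<mu> T b"
proof (rule heat_weak_solution_from_smooth)
  show "b \<in> L1_L2_sigma T" using sol by (simp add: mhd_weak_solution_def)
  fix \<xi> and \<phi> :: "real^'n \<Rightarrow> real^'n"
  assume \<xi>: "\<xi> \<in> C0_1_time T" and \<phi>: "\<phi> \<in> vector_fields C0_infinity"
  note w = sol[unfolded mhd_weak_solution_def, THEN conjunct2, THEN conjunct2, THEN conjunct2, THEN conjunct2,
        rule_format, OF \<xi> \<phi>]
  have "strip_integral T (\<lambda>t x. frobenius (tensor (v t x) (b t x)) (jacobian \<phi> x) * \<xi> t) = 0"
    unfolding strip_integral_def
    by (rule integral_eq_zero_AE) (use v0 in \<open>eventually_elim, auto simp: frobenius_def tensor_def\<close>)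
  moreover have "strip_integral T (\<lambda>t x. frobenius (tensor (b t x) (v t x)) (jacobian \<phi> x) * \<xi> t) = 0"
    unfolding strip_integral_def
    by (rule integral_eq_zero_AE) (use v0 in \<open>eventually_elim, auto simp: frobenius_def tensor_def\<close>)
  ultimately show "- strip_integral T (\<lambda>t x. (b t x \<bullet> \<phi> x) * deriv \<xi> t)
      = \<mu> * strip_integral T (\<lambda>t x. (b t x \<bullet> vector_laplacian \<phi> x) * \<xi> t)"
    using w by linarith
qed

section \<open>The Liouville theorem\<close>

theorem theorem3p1:
  fixes v b :: "real \<Rightarrow> real^'n::finite \<Rightarrow> real^'n"
    and p :: "real \<Rightarrow> 'n functional"
    and \<phi> :: "real^'n \<Rightarrow> real"
    and T \<mu> \<nu> :: real
  assumes "2 \<le> CARD('n)" and "0 < T" and "0 \<le> \<mu>" and "0 \<le> \<nu>"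
    and "\<phi> \<in> schwartz" and "(LINT x|lebesgue. \<phi> x) \<noteq> 0"
    and "mhd_weak_solution \<mu> \<nu> T v b p"
    and "(\<exists>f. f \<in> L1_plus_L1 T \<and> represented_by T p f)
         \<or> (\<exists>q. 0 < q \<and> q \<le> 1 \<and> p \<in> L1_hardy T \<phi> q)"
  shows "(3 \<le> CARD('n) \<longrightarrow> (AE (t, x) in strip T. v t x = 0 \<and> b t x = 0)) \<and>
         (CARD('n) = 2 \<longrightarrow>
            (AE (t, x) in strip T. v t x = 0) \<and>
            (AE t in time_measure T. \<forall>i j.
               (LINT x|lebesgue. (b t x $ i)\<^sup>2) = (LINT x|lebesgue. (b t x $ j)\<^sup>2)) \<and>
            heat_weak_solution \<mu> T b)"
proof -
  have main: "AE t in time_measure T. (AE x in lebesgue. v t x = 0) \<and>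
      (3 \<le> CARD('n) \<longrightarrow> (AE x in lebesgue. b t x = 0)) \<and>
      (CARD('n) = 2 \<longrightarrow> (\<forall>i j. (LINT x|lebesgue. (b t x $ i)\<^sup>2) = (LINT x|lebesgue. (b t x $ j)\<^sup>2)))"
    using mhd_stress_integral[OF assms(5-8)]
  proof eventually_elim
    case (elim t)
    then obtain s where vt: "v t \<in> L2_sigma" and bt: "b t \<in> L2_sigma" and s: "0 \<le> s"
      "\<And>k. (LINT x|lebesgue. stress (v t) (b t) k k x) = - s" by blast
    note c = stress_integral_consequences[OF vt bt assms(1) s]
    show ?case
      by (intro conjI impI allI) (rule c(1), erule c(2), erule c(3))
  qed
  have vm: "(\<lambda>(t, x). v t x) \<in> borel_measurable (strip T)" and bm: "(\<lambda>(t, x). b t x) \<in> borel_measurable (strip T)"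
    using assms(7) by (auto simp: mhd_weak_solution_def L1_L2_sigma_def)
  have v0: "AE (t, x) in strip T. v t x = 0"
    by (rule AE_strip_zeroI[OF vm]) (use main in \<open>eventually_elim, blast\<close>)
  have "AE (t, x) in strip T. v t x = 0 \<and> b t x = 0" if "3 \<le> CARD('n)"
  proof -
    have "AE (t, x) in strip T. b t x = 0"
      by (rule AE_strip_zeroI[OF bm]) (use main in \<open>eventually_elim, use that in blast\<close>)
    with v0 show ?thesis by eventually_elim auto
  qed
  moreover have "AE t in time_measure T. \<forall>i j.
      (LINT x|lebesgue. (b t x $ i)\<^sup>2) = (LINT x|lebesgue. (b t x $ j)\<^sup>2)" if "CARD('n) = 2"
    using main by eventually_elim (use that in blast)
  ultimately show ?thesis using v0 heat_weak_solution_of_mhd[OF assms(7) v0] by blast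
qed

end
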